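(* Let $(X,o)$ be an irreducible germ of a complex algebraic variety, $\mathcal{I}=(h)$ a principal ideal in $\mathcal{O}_{X,o}$ with $h\neq 0$, and $V$ the analytic subspace of $(X,o)$ determined by $\mathcal{I}$. Let $\underline{\nu}=\{\nu_1,\ldots,\nu_r\}$ be a set of discrete valuations of $\mathbb{C}(X)$, whose valuation rings contain $\mathcal{O}_{X,o}$, such that the Poincaré series $$\mathbf{P}^{\underline{\nu}}_X(\underline{t})=\sum_{\underline{v}\in\mathbb{Z}^r}\left(\sum_{i=0}^{r-1}(-1)^i h_i^{\underline{v}}\right)\underline{t}^{\underline{v}}\quad\text{and}\quad \boldsymbol{\mathcal{P}}^{\underline{\nu}}_V(\underline{t})=\sum_{\underline{v}\in\mathbb{Z}^r}\left(\sum_{i=0}^{r-1}(-1)^i h_i^{\mathcal{I},\underline{v}}\right)\underline{t}^{\underline{v}}$$ are well-defined. Write $\underline{q}=\underline{\nu}(h)=(\nu_1(h),\ldots,\nu_r(h))$. Then $$\boldsymbol{\mathcal{P}}^{\underline{\nu}}_V(\underline{t})=(1-\underline{t}^{\underline{q}})\,\mathbf{P}^{\underline{\nu}}_X(\underline{t}).$$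
   Context: $\mathcal{O}_{X,o}$ is the local ring of germs of functions on $(X,o)$. For $\underline{v}\in\mathbb{Z}^r$ put $M(\underline{v})=\{g\in\mathcal{O}_{X,o}\mid\nu_j(g)\ge v_j,\ 1\le j\le r\}$. For $I\subseteq\{1,\ldots,r\}$, $\underline{e}_I\in\mathbb{Z}^r$ has $j$-th component $1$ if $j\in I$ and $0$ otherwise; $\underline{1}=(1,\ldots,1)$; $\underline{t}^{\underline{v}}=t_1^{v_1}\cdots t_r^{v_r}$. It is not assumed that any $\nu_j$ is centered at the maximal ideal. The numbers $h_i^{\underline{v}}$: fix $\underline{v}\in\mathbb{Z}^r$ and put $V_I=M(\underline{v}+\underline{e}_I)/M(\underline{v}+\underline{1})$ for $I\subseteq\{1,\ldots,r\}$. Let $C_i=\bigoplus_{\#I=i}V_I$ for $0\le i\le r$, and $C_i=0$ for $i=-1$ and $i>r$. For $I=\{a_1<\cdots<a_{i+1}\}$ the map $\partial_{i+1}:C_{i+1}\to C_i$ sends $x\in V_I$ to $(y_J)_{\#J=i}$ with $y_J=(-1)^k x$ if $J=I\setminus\{a_k\}$ (viewing $V_I\subseteq V_J$ via $M(\underline{v}+\underline{e}_I)\subseteq M(\underline{v}+\underline{e}_J)$) and $y_J=0$ if $J\not\subseteq I$; all remaining $\partial_i$ (to or from a zero space) are zero. Then $h_i^{\underline{v}}=\dim_{\mathbb{C}}(\ker\partial_i/\operatorname{im}\partial_{i+1})$. The numbers $h_i^{\mathcal{I},\underline{v}}$ are defined by the same construction with $V_I$ replaced by $V_I^{\mathcal{I}}=(M(\underline{v}+\underline{e}_I)+\mathcal{I})/(M(\underline{v}+\underline{1})+\mathcal{I})$.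 $\mathbf{P}^{\underline{\nu}}_X$ (resp. $\boldsymbol{\mathcal{P}}^{\underline{\nu}}_V$) is well-defined if all $h_i^{\underline{v}}$ (resp. all $h_i^{\mathcal{I},\underline{v}}$) are finite. *)

theory Defs
  imports
    "HOL-Analysis.Finite_Cartesian_Product"
    "HOL-Algebra.Ideal"
    "HOL-Library.Poly_Mapping"
    "Jordan_Normal_Form.Missing_VectorSpace"
begin

section \<open>Irreducible germs of complex algebraic varieties\<close>

text \<open>
  An irreducible germ of a complex algebraic variety has a representative \<open>(X, o)\<close> where \<open>X\<close> is an
  irreducible Zariski closed subset of some \<open>\<complex>\<^sup>n\<close> and \<open>o \<in> X\<close>.
\<close>

inductive_set polynomial_funs :: "(complex ^ 'n \<Rightarrow> complex) set" where
  const: "(\<lambda>_. c) \<in> polynomial_funs"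
| coord: "(\<lambda>x. x $ i) \<in> polynomial_funs"
| add: "f \<in> polynomial_funs \<Longrightarrow> g \<in> polynomial_funs \<Longrightarrow> (\<lambda>x. f x + g x) \<in> polynomial_funs"
| mult: "f \<in> polynomial_funs \<Longrightarrow> g \<in> polynomial_funs \<Longrightarrow> (\<lambda>x. f x * g x) \<in> polynomial_funs"

definition algebraic_set :: "(complex ^ 'n) set \<Rightarrow> bool" where
  "algebraic_set X \<longleftrightarrow> (\<exists>F \<subseteq> polynomial_funs. X = {x. \<forall>f\<in>F. f x = 0})"

definition irreducible_variety :: "(complex ^ 'n) set \<Rightarrow> bool" where
  "irreducible_variety X \<longleftrightarrow> algebraic_set X \<and> X \<noteq> {} \<and>
     (\<forall>Y Z. algebraic_set Y \<longrightarrow> algebraic_set Z \<longrightarrow> X = Y \<union> Z \<longrightarrow> X = Y \<or> X = Z)"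

text \<open>
  The function field \<open>\<complex>(X)\<close>, the field of fractions of the ring of polynomial functions on \<open>X\<close>: a
  pair \<open>(f, g)\<close>, where \<open>g\<close> does not vanish identically on \<open>X\<close>, represents the rational function
  \<open>f / g\<close>. It is made into a \<open>\<complex>\<close>-algebra through the \<^const>\<open>smult\<close> component of the record.
\<close>

type_synonym 'n fraction = "(complex ^ 'n \<Rightarrow> complex) \<times> (complex ^ 'n \<Rightarrow> complex)"

definition fractions :: "(complex ^ 'n) set \<Rightarrow> 'n fraction set" where
  "fractions X = {(f, g). f \<in> polynomial_funs \<and> g \<in> polynomial_funs \<and> (\<exists>x\<in>X. g x \<noteq> 0)}"

definition fraction_rel :: "(complex ^ 'n) set \<Rightarrow> ('n fraction \<times> 'n fraction) set" where
  "fraction_rel X = {((f, g), (f', g')). (f, g) \<in> fractions X \<and> (f', g') \<in> fractions X \<and>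
     (\<forall>x\<in>X. f x * g' x = f' x * g x)}"

definition rational_fun ::
  "(complex ^ 'n) set \<Rightarrow> (complex ^ 'n \<Rightarrow> complex) \<Rightarrow> (complex ^ 'n \<Rightarrow> complex) \<Rightarrow> 'n fraction set"
  where "rational_fun X f g = fraction_rel X `` {(f, g)}"

definition function_field :: "(complex ^ 'n) set \<Rightarrow> (complex, 'n fraction set) module" where
  "function_field X =
     \<lparr>carrier = fractions X // fraction_rel X,
      mult = (\<lambda>A B. \<Union>(f, g)\<in>A. \<Union>(f', g')\<in>B. rational_fun X (\<lambda>x. f x * f' x) (\<lambda>x. g x * g' x)),
      one = rational_fun X (\<lambda>_. 1) (\<lambda>_. 1),
      zero = rational_fun X (\<lambda>_. 0) (\<lambda>_. 1),
      add = (\<lambda>A B. \<Union>(f, g)\<in>A. \<Union>(f', g')\<in>B.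
               rational_fun X (\<lambda>x. f x * g' x + f' x * g x) (\<lambda>x. g x * g' x)),
      smult = (\<lambda>c A. \<Union>(f, g)\<in>A. rational_fun X (\<lambda>x. c * f x) g)\<rparr>"

text \<open>
  Germs at \<open>p\<close> of regular functions are identified with rational functions that have a representative
  \<open>f / g\<close> with \<open>g p \<noteq> 0\<close>; this is faithful because \<open>X\<close> is irreducible.
\<close>

definition local_ring ::
  "(complex ^ 'n) set \<Rightarrow> complex ^ 'n \<Rightarrow> (complex, 'n fraction set) module" where
  "local_ring X p = (function_field X)
     \<lparr>carrier := {rational_fun X f g | f g. f \<in> polynomial_funs \<and> g \<in> polynomial_funs \<and> g p \<noteq> 0}\<rparr>"


section \<open>Discrete valuations\<close>

text \<open>
  A discrete valuation is a map \<open>K - {0} \<rightarrow> \<int>\<close>; its value at zero is \<open>\<infinity>\<close> by convention, so the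
  integer that \<open>\<nu>\<close> assigns to zero is never used. The value group is only required to be a nonzero
  subgroup of \<open>\<int>\<close>.
\<close>

definition discrete_valuation :: "('a, 'm) ring_scheme \<Rightarrow> ('a \<Rightarrow> int) \<Rightarrow> bool" where
  "discrete_valuation K \<nu> \<longleftrightarrow>
     (\<forall>x \<in> carrier K - {\<zero>\<^bsub>K\<^esub>}. \<forall>y \<in> carrier K - {\<zero>\<^bsub>K\<^esub>}. \<nu> (x \<otimes>\<^bsub>K\<^esub> y) = \<nu> x + \<nu> y) \<and>
     (\<forall>x \<in> carrier K - {\<zero>\<^bsub>K\<^esub>}. \<forall>y \<in> carrier K - {\<zero>\<^bsub>K\<^esub>}.
        x \<oplus>\<^bsub>K\<^esub> y \<noteq> \<zero>\<^bsub>K\<^esub> \<longrightarrow> min (\<nu> x) (\<nu> y) \<le> \<nu> (x \<oplus>\<^bsub>K\<^esub> y)) \<and>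
     (\<exists>x \<in> carrier K - {\<zero>\<^bsub>K\<^esub>}. \<nu> x \<noteq> 0)"

definition valuation_ring :: "('a, 'm) ring_scheme \<Rightarrow> ('a \<Rightarrow> int) \<Rightarrow> 'a set" where
  "valuation_ring K \<nu> = {x \<in> carrier K. x = \<zero>\<^bsub>K\<^esub> \<or> 0 \<le> \<nu> x}"

text \<open>
  A family of \<open>r \<ge> 1\<close> valuations is indexed by a finite linearly ordered type \<open>'r\<close> with \<open>r\<close> elements in
  place of \<open>{1, \<dots>, r}\<close>; the order enters through the signs of the boundary maps below.
\<close>

definition valuation_ideal ::
  "('a, 'm) ring_scheme \<Rightarrow> ('r::finite \<Rightarrow> 'a \<Rightarrow> int) \<Rightarrow> int ^ 'r \<Rightarrow> 'a set" where
  "valuation_ideal R \<nu> v = {g \<in> carrier R. g = \<zero>\<^bsub>R\<^esub> \<or> (\<forall>j. v $ j \<le> \<nu> j g)}"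

definition valuation_ideal_plus ::
  "('a, 'm) ring_scheme \<Rightarrow> ('r::finite \<Rightarrow> 'a \<Rightarrow> int) \<Rightarrow> 'a set \<Rightarrow> int ^ 'r \<Rightarrow> 'a set" where
  "valuation_ideal_plus R \<nu> J v = valuation_ideal R \<nu> v <+>\<^bsub>R\<^esub> J"

definition indicator_vec :: "'r::finite set \<Rightarrow> int ^ 'r" where
  "indicator_vec I = (\<chi> j. if j \<in> I then 1 else 0)"


section \<open>Quotients and direct sums of vector spaces\<close>

text \<open>
  The ring multiplication is not part of the structure of a vector space; the components \<^const>\<open>mult\<close>
  and \<^const>\<open>one\<close> of the following records are irrelevant.
\<close>

definition quotient_space :: "('k, 'a, 'm) module_scheme \<Rightarrow> 'a set \<Rightarrow> ('k, 'a set) module" where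
  "quotient_space M N =
     \<lparr>carrier = a_rcosets\<^bsub>M\<^esub> N, mult = (\<lambda>_ _. N), one = N, zero = N, add = set_add M,
      smult = (\<lambda>c A. \<Union>x\<in>A. N +>\<^bsub>M\<^esub> (c \<odot>\<^bsub>M\<^esub> x))\<rparr>"

definition direct_sum_family ::
  "'i set \<Rightarrow> ('i \<Rightarrow> ('k, 'a, 'm) module_scheme) \<Rightarrow> ('k, 'i \<Rightarrow> 'a) module" where
  "direct_sum_family S V =
     \<lparr>carrier = (\<Pi>\<^sub>E I\<in>S. carrier (V I)),
      mult = (\<lambda>_ _. \<lambda>I\<in>S. \<zero>\<^bsub>V I\<^esub>), one = (\<lambda>I\<in>S. \<zero>\<^bsub>V I\<^esub>), zero = (\<lambda>I\<in>S. \<zero>\<^bsub>V I\<^esub>),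
      add = (\<lambda>x y. \<lambda>I\<in>S. x I \<oplus>\<^bsub>V I\<^esub> y I),
      smult = (\<lambda>c x. \<lambda>I\<in>S. c \<odot>\<^bsub>V I\<^esub> x I)\<rparr>"


section \<open>The complex attached to a filtration\<close>

text \<open>
  For a family \<open>F\<close> of subspaces of \<open>R\<close> indexed by \<open>\<int>\<^sup>r\<close>, \<open>graded_piece R F v I\<close> is
  \<open>V\<^sub>I = F (v + e\<^sub>I) / F (v + 1)\<close>. For all \<open>I\<close> the elements of \<open>V\<^sub>I\<close> are cosets of the same subspace, so
  the inclusion \<open>V\<^sub>I \<subseteq> V\<^sub>J\<close> for \<open>J \<subseteq> I\<close> is an inclusion of sets of cosets.
\<close>

definition graded_piece ::
  "('k, 'a, 'm) module_scheme \<Rightarrow> (int ^ 'r \<Rightarrow> 'a set) \<Rightarrow> int ^ 'r \<Rightarrow> 'r::finite set \<Rightarrow> ('k, 'a set) module"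
  where "graded_piece R F v I = quotient_space (R\<lparr>carrier := F (v + indicator_vec I)\<rparr>) (F (v + 1))"

text \<open>
  The index \<open>i\<close> is an integer; for \<open>i < 0\<close> and for \<open>i > r\<close> no \<open>I\<close> has \<open>i\<close> elements, so that
  \<open>chain_space V i\<close> is the zero space.
\<close>

definition chain_space :: "('r::finite set \<Rightarrow> ('k, 'a, 'm) module_scheme) \<Rightarrow> int \<Rightarrow> ('k, 'r set \<Rightarrow> 'a) module"
  where "chain_space V i = direct_sum_family {I. int (card I) = i} V"

text \<open>
  The boundary map from \<open>chain_space V i\<close> to \<open>chain_space V (i - 1)\<close>. The component with index \<open>J\<close> of
  the image collects the contributions of the components of \<open>x\<close> with index \<open>I = J \<union> {a}\<close>, where
  \<open>a \<notin> J\<close>; the sign is \<open>(-1)\<^sup>k\<close> if \<open>a\<close> is the \<open>k\<close>-th smallest element of \<open>I\<close>, counting from 1.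
\<close>

definition boundary ::
  "('r::{finite,linorder} set \<Rightarrow> (complex, 'a, 'm) module_scheme) \<Rightarrow> int \<Rightarrow> ('r set \<Rightarrow> 'a) \<Rightarrow> 'r set \<Rightarrow> 'a"
  where "boundary V i x = (\<lambda>J \<in> {J. int (card J) = i - 1}.
     \<Oplus>\<^bsub>V J\<^esub> a \<in> - J. ((-1) ^ card {b \<in> insert a J. b \<le> a}) \<odot>\<^bsub>V J\<^esub> x (insert a J))"

definition homology_space ::
  "('r::{finite,linorder} set \<Rightarrow> (complex, 'a, 'm) module_scheme) \<Rightarrow> int \<Rightarrow> (complex, ('r set \<Rightarrow> 'a) set) module"
  where "homology_space V i =
     quotient_space
       ((chain_space V i)\<lparr>carrier := a_kernel (chain_space V i) (chain_space V (i - 1)) (boundary V i)\<rparr>)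
       (boundary V (i + 1) ` carrier (chain_space V (i + 1)))"

definition complex_ring :: "complex ring" where
  "complex_ring = \<lparr>carrier = UNIV, mult = (*), one = 1, zero = 0, add = (+)\<rparr>"

definition finite_homology ::
  "(complex, 'a, 'm) module_scheme \<Rightarrow> (int ^ 'r::{finite,linorder} \<Rightarrow> 'a set) \<Rightarrow>
     int ^ 'r::{finite,linorder} \<Rightarrow> int \<Rightarrow> bool"
  where "finite_homology R F v i \<longleftrightarrow>
     vectorspace.fin_dim complex_ring (homology_space (graded_piece R F v) i)"

text \<open>\<^const>\<open>vectorspace.dim\<close> is unspecified for spaces that are not finite-dimensional.\<close>

definition homology_dim ::
  "(complex, 'a, 'm) module_scheme \<Rightarrow> (int ^ 'r::{finite,linorder} \<Rightarrow> 'a set) \<Rightarrow>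
     int ^ 'r::{finite,linorder} \<Rightarrow> int \<Rightarrow> nat"
  where "homology_dim R F v i =
     vectorspace.dim complex_ring (homology_space (graded_piece R F v) i)"


section \<open>Poincare series\<close>

text \<open>
  A formal series \<open>\<Sum>v\<in>\<int>\<^sup>r. a\<^sub>v t\<^sup>v\<close>, unbounded in all directions, is the function \<open>v \<mapsto> a\<^sub>v\<close>. Such series
  form a module over the ring of Laurent polynomials, which is the type \<open>(int ^ 'r) \<Rightarrow>\<^sub>0 int\<close>.
\<close>

definition poincare_well_defined ::
  "(complex, 'a, 'm) module_scheme \<Rightarrow> (int ^ 'r::{finite,linorder} \<Rightarrow> 'a set) \<Rightarrow> bool" where
  "poincare_well_defined R F \<longleftrightarrow> (\<forall>v i. finite_homology R F v i)"

definition poincare_series ::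
  "(complex, 'a, 'm) module_scheme \<Rightarrow> (int ^ 'r::{finite,linorder} \<Rightarrow> 'a set) \<Rightarrow>
     int ^ 'r::{finite,linorder} \<Rightarrow> int" where
  "poincare_series R F v = (\<Sum>i<CARD('r). (-1) ^ i * int (homology_dim R F v (int i)))"

definition laurent_mult ::
  "((int ^ 'r) \<Rightarrow>\<^sub>0 int) \<Rightarrow> (int ^ 'r \<Rightarrow> int) \<Rightarrow> int ^ 'r::finite \<Rightarrow> int"  (infixl \<open>\<star>\<close> 70) where
  "p \<star> A = (\<lambda>v. \<Sum>w\<in>Poly_Mapping.keys p. Poly_Mapping.lookup p w * A (v - w))"

abbreviation laurent_monomial :: "int ^ 'r::finite \<Rightarrow> (int ^ 'r) \<Rightarrow>\<^sub>0 int" where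
  "laurent_monomial q \<equiv> Poly_Mapping.single q 1"

end

theory Submission
  imports Defs
begin

text \<open>
  Write \<open>R\<close> for the local ring, \<open>J = (h)\<close>, \<open>M v\<close> for the valuation ideals and \<open>q = \<nu>(h)\<close>, and fix
  \<open>v\<close>. Intersecting with \<open>J\<close> splits the complex of \<open>M\<close> at \<open>v\<close>: for every \<open>I\<close> the sequence
  \<open>0 \<rightarrow> (M (v + e\<^sub>I) \<inter> J) / (M (v + 1) \<inter> J) \<rightarrow> M (v + e\<^sub>I) / M (v + 1) \<rightarrow>
  (M (v + e\<^sub>I) + J) / (M (v + 1) + J) \<rightarrow> 0\<close>
  is exact and compatible with the boundary maps. Since \<open>\<nu>\<^sub>j (g h) = \<nu>\<^sub>j g + q\<^sub>j\<close> and \<open>R\<close> is a domain,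
  multiplication by \<open>h\<close> is a bijection from \<open>M (w - q)\<close> onto \<open>M w \<inter> J\<close> for every \<open>w\<close>, so that the first
  complex is a copy of the complex of \<open>M\<close> at \<open>v - q\<close>. The third complex is the one that defines the
  series of \<open>V\<close>. Additivity of Euler characteristics then says that the coefficients of the two series
  satisfy \<open>P\<^sub>V v = P\<^sub>X v - P\<^sub>X (v - q)\<close>, which is the claim. The coefficients are full Euler
  characteristics although the index stops at \<open>r - 1\<close>, because the top graded piece
  \<open>M (v + 1) / M (v + 1)\<close> is zero.

  The graded pieces themselves can have infinite dimension, so additivity cannot be read off from
  dimensions of chain spaces; it is a statement about the long exact sequence of homology. If \<open>a\<^sub>i\<close>,
  \<open>b\<^sub>i\<close>, \<open>c\<^sub>i\<close> are the dimensions of the homologies of the three complexes and \<open>k\<^sub>i\<close> is the dimension of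
  the kernel of the map from the first homology to the second one, then exactness gives
  \<open>a\<^sub>i + c\<^sub>i = b\<^sub>i + k\<^sub>i + k\<^bsub>i - 1\<^esub>\<close>, and the alternating sum of \<open>k\<^sub>i + k\<^bsub>i - 1\<^esub>\<close> telescopes to zero.

  The chains are tuples of cosets and homology consists of cosets of tuples of cosets, where induced
  and connecting homomorphisms are cumbersome. So homology is first lifted
  (\<open>homology_has_dim_iff\<close>): it is a quotient \<open>Z / B\<close> of two spaces of chains with coefficients in
  \<open>R\<close>. For such subquotients the relation between \<open>a\<^sub>i\<close>, \<open>b\<^sub>i\<close>, \<open>c\<^sub>i\<close> follows from the isomorphism
  theorems and the modular law alone (\<open>euler_step\<close>), and it sums up to
  \<open>euler_characteristic_additive\<close>. Multiplication by \<open>h\<close> is taken care of by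
  \<open>has_codim_cycles_transport\<close>, and the algebra structure of \<open>R\<close> on which everything rests is derived
  from the fraction representation in the locale \<open>germ_of_variety\<close>.
\<close>


section \<open>Subspaces and linear maps\<close>

context vectorspace begin

lemma subspaceI:
  assumes "W \<subseteq> carrier V" and "\<zero>\<^bsub>V\<^esub> \<in> W"
    and "\<And>x y. x \<in> W \<Longrightarrow> y \<in> W \<Longrightarrow> x \<oplus>\<^bsub>V\<^esub> y \<in> W"
    and "\<And>c x. c \<in> carrier K \<Longrightarrow> x \<in> W \<Longrightarrow> c \<odot>\<^bsub>V\<^esub> x \<in> W"
  shows "subspace K W V"
  using assms by (auto simp: subspace_def submodule_def intro!: vectorspace_axioms module_axioms)

lemma
  assumes "subspace K W V"
  shows subspace_subset: "W \<subseteq> carrier V"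
    and subspace_zero: "\<zero>\<^bsub>V\<^esub> \<in> W"
    and subspace_add: "x \<in> W \<Longrightarrow> y \<in> W \<Longrightarrow> x \<oplus>\<^bsub>V\<^esub> y \<in> W"
    and subspace_smult: "c \<in> carrier K \<Longrightarrow> x \<in> W \<Longrightarrow> c \<odot>\<^bsub>V\<^esub> x \<in> W"
  using assms by (auto simp: subspace_def submodule_def)

lemma subspace_carrier: "subspace K W V \<Longrightarrow> x \<in> W \<Longrightarrow> x \<in> carrier V"
  using subspace_subset by blast

lemma subspace_neg:
  assumes "subspace K W V" "x \<in> W"
  shows "\<ominus>\<^bsub>V\<^esub> x \<in> W"
proof -
  have "(\<ominus>\<^bsub>K\<^esub> \<one>\<^bsub>K\<^esub>) \<odot>\<^bsub>V\<^esub> x \<in> W"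
    using assms by (intro subspace_smult) auto
  then show ?thesis
    using assms subspace_carrier[OF assms] by (simp add: smult_minus_1)
qed

lemma subspace_minus:
  "subspace K W V \<Longrightarrow> x \<in> W \<Longrightarrow> y \<in> W \<Longrightarrow> x \<ominus>\<^bsub>V\<^esub> y \<in> W"
  by (simp add: a_minus_def subspace_add subspace_neg)

lemma add_minus_cancel:
  "x \<in> carrier V \<Longrightarrow> y \<in> carrier V \<Longrightarrow> (x \<oplus>\<^bsub>V\<^esub> y) \<ominus>\<^bsub>V\<^esub> y = x"
  by (simp add: a_minus_def M.a_assoc M.r_neg)

lemma minus_add_cancel:
  "x \<in> carrier V \<Longrightarrow> y \<in> carrier V \<Longrightarrow> (x \<ominus>\<^bsub>V\<^esub> y) \<oplus>\<^bsub>V\<^esub> y = x"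
  by (simp add: a_minus_def M.a_assoc M.l_neg)

lemma subspace_add_left_iff:
  assumes "subspace K W V" "y \<in> W" "x \<in> carrier V"
  shows "x \<oplus>\<^bsub>V\<^esub> y \<in> W \<longleftrightarrow> x \<in> W"
  using assms subspace_add subspace_minus add_minus_cancel subspace_carrier by metis

lemma subspace_add_right_iff:
  assumes "subspace K W V" "y \<in> W" "x \<in> carrier V"
  shows "y \<oplus>\<^bsub>V\<^esub> x \<in> W \<longleftrightarrow> x \<in> W"
  using assms subspace_add_left_iff subspace_carrier M.a_comm by metis

lemma subspace_self: "subspace K (carrier V) V"
  by (rule subspaceI) auto

lemma subspace_Int: "subspace K A V \<Longrightarrow> subspace K B V \<Longrightarrow> subspace K (A \<inter> B) V"
  by (rule subspaceI) (auto dest: subspace_subset subspace_zero intro: subspace_add subspace_smult)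

lemma mem_set_add: "x \<in> A <+>\<^bsub>V\<^esub> B \<longleftrightarrow> (\<exists>a\<in>A. \<exists>b\<in>B. x = a \<oplus>\<^bsub>V\<^esub> b)"
  by (auto simp: set_add_def')

lemma subspace_set_add:
  assumes "subspace K A V" "subspace K B V"
  shows "subspace K (A <+>\<^bsub>V\<^esub> B) V"
proof -
  have "A <+>\<^bsub>V\<^esub> B = submodule_sum A B"
    by (auto simp: set_add_def' submodule_sum_def)
  then show ?thesis
    using sum_is_subspace[OF assms] by simp
qed

lemma set_add_upper1: "subspace K A V \<Longrightarrow> subspace K B V \<Longrightarrow> A \<subseteq> A <+>\<^bsub>V\<^esub> B"
  using subspace_zero[of B] subspace_carrier[of A]
  unfolding subset_iff mem_set_add by (metis M.r_zero)

lemma set_add_upper2: "subspace K A V \<Longrightarrow> subspace K B V \<Longrightarrow> B \<subseteq> A <+>\<^bsub>V\<^esub> B"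
  using subspace_zero[of A] subspace_carrier[of B]
  unfolding subset_iff mem_set_add by (metis M.l_zero)

lemma set_add_least: "subspace K C V \<Longrightarrow> A \<subseteq> C \<Longrightarrow> B \<subseteq> C \<Longrightarrow> A <+>\<^bsub>V\<^esub> B \<subseteq> C"
  using subspace_add[of C] unfolding subset_iff mem_set_add by metis

lemma set_add_mono: "A \<subseteq> A' \<Longrightarrow> B \<subseteq> B' \<Longrightarrow> A <+>\<^bsub>V\<^esub> B \<subseteq> A' <+>\<^bsub>V\<^esub> B'"
  unfolding subset_iff mem_set_add by metis

lemma modular_law:
  assumes "subspace K A V" "subspace K B V" "subspace K C V" "A \<subseteq> C"
  shows "(A <+>\<^bsub>V\<^esub> B) \<inter> C = A <+>\<^bsub>V\<^esub> (B \<inter> C)"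
proof -
  have "a \<oplus>\<^bsub>V\<^esub> b \<in> C \<longleftrightarrow> b \<in> C" if "a \<in> A" "b \<in> B" for a b
    using that assms subspace_carrier by (intro subspace_add_right_iff) auto
  then show ?thesis
    by (auto simp: mem_set_add) blast+
qed

lemma subspace_of_vs_iff:
  assumes "subspace K Z V"
  shows "subspace K B (vs Z) \<longleftrightarrow> subspace K B V \<and> B \<subseteq> Z"
  using assms subspace_is_vs[OF assms]
  by (auto simp: subspace_def submodule_def vectorspace_def)

lemma fin_dim_subspace:
  assumes "fin_dim" and W: "subspace K W V"
  shows "vectorspace.fin_dim K (vs W)"
proof -
  interpret W: vectorspace K "vs W" using W by (rule subspace_is_vs)
  have sub: "submodule K W V" using W by simp
  have eq: "W.lin_dep S \<longleftrightarrow> lin_dep S" if "S \<subseteq> W" for S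
    using span_li_not_depend(2)[OF that sub] by simp
  have "\<exists>A. finite A \<and> maximal A (\<lambda>S. S \<subseteq> W \<and> lin_indpt S)"
  proof (rule maximal_exists)
    show "finite A \<and> card A \<le> dim" if "A \<subseteq> W \<and> lin_indpt A" for A
      using that li_le_dim[OF assms(1)] subspace_subset[OF W] by blast
    show "{} \<subseteq> W \<and> lin_indpt {}"
      by (auto simp: lin_dep_def)
  qed
  then obtain A where A: "finite A" "maximal A (\<lambda>S. S \<subseteq> W \<and> lin_indpt S)" by blast
  have "maximal A (\<lambda>S. S \<subseteq> carrier (vs W) \<and> W.lin_indpt S)"
    using A(2) by (simp add: maximal_def) (metis eq)
  then have "W.basis A" by (rule W.max_li_is_basis)
  then show ?thesis
    using A(1) by (auto simp: W.fin_dim_def W.basis_def)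
qed

end

lemma linear_mapI:
  assumes "vectorspace K V" "vectorspace K W"
    and "\<And>x. x \<in> carrier V \<Longrightarrow> T x \<in> carrier W"
    and "\<And>x y. x \<in> carrier V \<Longrightarrow> y \<in> carrier V \<Longrightarrow> T (x \<oplus>\<^bsub>V\<^esub> y) = T x \<oplus>\<^bsub>W\<^esub> T y"
    and "\<And>c x. c \<in> carrier K \<Longrightarrow> x \<in> carrier V \<Longrightarrow> T (c \<odot>\<^bsub>V\<^esub> x) = c \<odot>\<^bsub>W\<^esub> T x"
  shows "linear_map K V W T"
  using assms by (auto simp: linear_map_def mod_hom_def mod_hom_axioms_def module_hom_def vectorspace_def)

lemma (in linear_map) subspace_vimage:
  assumes "subspace K A V" "subspace K B W"
  shows "subspace K {x \<in> A. T x \<in> B} V"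
  using assms V.subspace_subset[OF assms(1)]
  by (intro V.subspaceI)
    (auto simp: V.subspace_zero V.subspace_add V.subspace_smult W.subspace_zero W.subspace_add
       W.subspace_smult subset_iff)

lemma (in linear_map) subspace_image:
  assumes "subspace K A V"
  shows "subspace K (T ` A) W"
proof (rule W.subspaceI)
  note [simp] = V.subspace_carrier[OF assms]
  show "T ` A \<subseteq> carrier W" by auto
  show "\<zero>\<^bsub>W\<^esub> \<in> T ` A" using V.subspace_zero[OF assms] T0_is_0 by (metis imageI)
  show "x \<oplus>\<^bsub>W\<^esub> y \<in> T ` A" if "x \<in> T ` A" "y \<in> T ` A" for x y
    using that V.subspace_add[OF assms] by (auto simp flip: T_add)
  show "c \<odot>\<^bsub>W\<^esub> x \<in> T ` A" if "c \<in> carrier K" "x \<in> T ` A" for c x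
    using that V.subspace_smult[OF assms] by (auto simp flip: T_smult)
qed

lemma (in linear_map) linear_map_restrict:
  assumes "subspace K A V" "subspace K B W" "T ` A \<subseteq> B"
  shows "linear_map K (V.vs A) (W.vs B) T"
  using assms V.subspace_carrier[OF assms(1)]
  by (intro linear_mapI V.subspace_is_vs W.subspace_is_vs) auto

text \<open>
  The universal property of a quotient, stated for an arbitrary surjection \<open>f\<close> instead of a projection
  onto cosets: it is used for several models of the same quotient.
\<close>
lemma linear_map_factor:
  assumes f: "linear_map K V W f" and g: "linear_map K V W' g"
    and surj: "f ` carrier V = carrier W"
    and ker: "\<And>x. x \<in> carrier V \<Longrightarrow> f x = \<zero>\<^bsub>W\<^esub> \<Longrightarrow> g x = \<zero>\<^bsub>W'\<^esub>"
  obtains T where "linear_map K W W' T" "\<And>x. x \<in> carrier V \<Longrightarrow> T (f x) = g x"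
proof -
  interpret f: linear_map K V W f by (rule f)
  interpret g: linear_map K V W' g by (rule g)
  define s where "s w = (SOME x. x \<in> carrier V \<and> f x = w)" for w
  have s: "s w \<in> carrier V" "f (s w) = w" if "w \<in> carrier W" for w
  proof -
    have "\<exists>x. x \<in> carrier V \<and> f x = w" using that surj by (metis imageE)
    from someI_ex[OF this] show "s w \<in> carrier V" "f (s w) = w"
      unfolding s_def by auto
  qed
  have eq: "g x = g y" if "x \<in> carrier V" "y \<in> carrier V" "f x = f y" for x y
  proof -
    have "f (x \<ominus>\<^bsub>V\<^esub> y) = \<zero>\<^bsub>W\<^esub>"
      using that by simp
    then have "g x \<ominus>\<^bsub>W'\<^esub> g y = \<zero>\<^bsub>W'\<^esub>"
      using ker[of "x \<ominus>\<^bsub>V\<^esub> y"] that by simp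
    then show ?thesis
      using that by simp
  qed
  have T: "g (s (f x)) = g x" if "x \<in> carrier V" for x
    using that s by (intro eq) auto
  have "linear_map K W W' (\<lambda>w. g (s w))"
  proof (rule linear_mapI)
    show "g (s (x \<oplus>\<^bsub>W\<^esub> y)) = g (s x) \<oplus>\<^bsub>W'\<^esub> g (s y)" if "x \<in> carrier W" "y \<in> carrier W" for x y
      using that s T[of "s x \<oplus>\<^bsub>V\<^esub> s y"] by simp
    show "g (s (c \<odot>\<^bsub>W\<^esub> x)) = c \<odot>\<^bsub>W'\<^esub> g (s x)" if "c \<in> carrier K" "x \<in> carrier W" for c x
      using that s T[of "c \<odot>\<^bsub>V\<^esub> s x"] by simp
  qed (use s in \<open>auto intro: f.W.vectorspace_axioms g.W.vectorspace_axioms\<close>)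
  then show thesis using T by (intro that) auto
qed

text \<open>
  A dimension statement for record-based spaces. It includes finite dimensionality because
  \<^const>\<open>vectorspace.dim\<close> carries no information otherwise.
\<close>
definition has_dim :: "('k, 'm) ring_scheme \<Rightarrow> ('k, 'a, 'n) module_scheme \<Rightarrow> nat \<Rightarrow> bool" where
  "has_dim K V n \<longleftrightarrow> vectorspace K V \<and> vectorspace.fin_dim K V \<and> vectorspace.dim K V = n"

lemma has_dim_bij:
  assumes "linear_map K V W T" "inj_on T (carrier V)" "T ` carrier V = carrier W" "has_dim K V n"
  shows "has_dim K W n"
proof -
  interpret linear_map K V W T by fact
  show ?thesis
    using assms dim_eq image_fin_dim W.vectorspace_axioms by (auto simp: has_dim_def)
qed

lemma has_dim_rank_nullity:
  assumes "linear_map K V W T" "T ` carrier V = carrier W" "has_dim K V n"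
  obtains k m where "has_dim K (V\<lparr>carrier := {x \<in> carrier V. T x = \<zero>\<^bsub>W\<^esub>}\<rparr>) k" "has_dim K W m" "n = k + m"
proof -
  interpret linear_map K V W T by fact
  have ker: "{x \<in> carrier V. T x = \<zero>\<^bsub>W\<^esub>} = kerT" by (auto simp: ker_def)
  have "has_dim K (V.vs kerT) (vectorspace.dim K (V.vs kerT))"
    using assms(3) V.fin_dim_subspace[OF _ kerT_is_subspace] V.subspace_is_vs[OF kerT_is_subspace]
    by (auto simp: has_dim_def)
  moreover have "has_dim K W (vectorspace.dim K W)"
    using assms image_fin_dim W.vectorspace_axioms by (auto simp: has_dim_def)
  moreover have "n = vectorspace.dim K (V.vs kerT) + vectorspace.dim K W"
    using rank_nullity assms by (auto simp: has_dim_def im_def)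
  ultimately show thesis using that unfolding ker by blast
qed

text \<open>
  Two surjections with the same domain and the same kernel have isomorphic targets. This is how
  homology, a quotient of tuples of cosets, gets compared with a quotient of plain tuples.
\<close>
lemma same_kernel_has_dim:
  assumes f: "linear_map K V W f" and g: "linear_map K V W' g"
    and "f ` carrier V = carrier W" "g ` carrier V = carrier W'"
    and ker: "\<And>x. x \<in> carrier V \<Longrightarrow> f x = \<zero>\<^bsub>W\<^esub> \<longleftrightarrow> g x = \<zero>\<^bsub>W'\<^esub>"
    and "has_dim K W n"
  shows "has_dim K W' n"
proof -
  interpret f: linear_map K V W f by (rule f)
  interpret g: linear_map K V W' g by (rule g)
  obtain T where T: "linear_map K W W' T" "\<And>x. x \<in> carrier V \<Longrightarrow> T (f x) = g x"
    using linear_map_factor[OF f g] assms by metis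
  interpret T: linear_map K W W' T by (rule T)
  have "inj_on T (carrier W)"
  proof (rule T.Ke0_imp_inj, safe)
    fix w assume w: "w \<in> carrier (f.W.vs T.kerT)"
    then obtain x where x: "x \<in> carrier V" "w = f x"
      using assms(3) by (auto simp: T.ker_def)
    then have "g x = \<zero>\<^bsub>W'\<^esub>" using w T(2) by (auto simp: T.ker_def)
    then show "w = \<zero>\<^bsub>W\<^esub>" using ker x by simp
  qed (auto simp: T.ker_def)
  moreover have "T ` carrier W = carrier W'"
    using assms(3,4) T(2) by (metis (no_types, lifting) image_cong image_image)
  ultimately show ?thesis
    using has_dim_bij[OF T(1)] assms by blast
qed

lemma has_dim_unique: "has_dim K V n \<Longrightarrow> has_dim K V m \<Longrightarrow> n = m"
  by (simp add: has_dim_def)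


section \<open>Quotient spaces and codimension\<close>

context vectorspace begin

context
  fixes N assumes N: "subspace K N V"
begin

lemma coset_eq_iff:
  assumes "x \<in> carrier V" "y \<in> carrier V"
  shows "N +>\<^bsub>V\<^esub> x = N +>\<^bsub>V\<^esub> y \<longleftrightarrow> x \<ominus>\<^bsub>V\<^esub> y \<in> N"
proof
  assume "N +>\<^bsub>V\<^esub> x = N +>\<^bsub>V\<^esub> y"
  moreover have "x \<in> N +>\<^bsub>V\<^esub> x"
    using assms subspace_zero[OF N] by (force simp: a_r_coset_def')
  ultimately obtain n where "n \<in> N" "x = n \<oplus>\<^bsub>V\<^esub> y"
    by (auto simp: a_r_coset_def')
  then show "x \<ominus>\<^bsub>V\<^esub> y \<in> N"
    using assms subspace_carrier[OF N] by (simp add: add_minus_cancel)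
next
  have *: "N +>\<^bsub>V\<^esub> x \<subseteq> N +>\<^bsub>V\<^esub> y" if "x \<ominus>\<^bsub>V\<^esub> y \<in> N" "x \<in> carrier V" "y \<in> carrier V" for x y
  proof
    fix z assume "z \<in> N +>\<^bsub>V\<^esub> x"
    then obtain n where n: "n \<in> N" "z = n \<oplus>\<^bsub>V\<^esub> x" by (auto simp: a_r_coset_def')
    then have "z = (n \<oplus>\<^bsub>V\<^esub> (x \<ominus>\<^bsub>V\<^esub> y)) \<oplus>\<^bsub>V\<^esub> y"
      using that subspace_carrier[OF N] by (simp add: M.a_assoc minus_add_cancel)
    then show "z \<in> N +>\<^bsub>V\<^esub> y"
      using subspace_add[OF N n(1) that(1)] by (auto simp: a_r_coset_def')
  qed
  assume "x \<ominus>\<^bsub>V\<^esub> y \<in> N"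
  moreover from subspace_neg[OF N this] have "y \<ominus>\<^bsub>V\<^esub> x \<in> N"
    using assms by (simp add: a_minus_def M.minus_add M.a_comm)
  ultimately show "N +>\<^bsub>V\<^esub> x = N +>\<^bsub>V\<^esub> y"
    using * assms by blast
qed

lemma coset_eq_zero_iff:
  assumes "x \<in> carrier V"
  shows "N +>\<^bsub>V\<^esub> x = N \<longleftrightarrow> x \<in> N"
proof -
  have "N +>\<^bsub>V\<^esub> \<zero>\<^bsub>V\<^esub> = N"
    using subspace_carrier[OF N] by (auto simp: a_r_coset_def')
  then show ?thesis
    using coset_eq_iff[OF assms M.zero_closed] add_minus_cancel[OF assms M.zero_closed] assms by simp
qed

lemma quotient_carrier: "carrier (quotient_space V N) = (\<lambda>x. N +>\<^bsub>V\<^esub> x) ` carrier V"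
  by (auto simp: quotient_space_def A_RCOSETS_def')

lemma quotient_zero: "\<zero>\<^bsub>quotient_space V N\<^esub> = N"
  by (simp add: quotient_space_def)

lemma quotient_add:
  assumes "x \<in> carrier V" "y \<in> carrier V"
  shows "(N +>\<^bsub>V\<^esub> x) \<oplus>\<^bsub>quotient_space V N\<^esub> (N +>\<^bsub>V\<^esub> y) = N +>\<^bsub>V\<^esub> (x \<oplus>\<^bsub>V\<^esub> y)"
proof -
  have "additive_subgroup N V"
    using subspace_zero[OF N] subspace_add[OF N] subspace_neg[OF N] subspace_subset[OF N]
    by (intro additive_subgroup.intro M.add.subgroupI) (auto simp: a_inv_def)
  then interpret abelian_subgroup N V
    by (rule abelian_subgroupI3) (rule M.abelian_group_axioms)
  show ?thesis
    using a_rcos_sum[OF assms] by (simp add: quotient_space_def)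
qed

lemma quotient_smult:
  assumes "x \<in> carrier V" "c \<in> carrier K"
  shows "c \<odot>\<^bsub>quotient_space V N\<^esub> (N +>\<^bsub>V\<^esub> x) = N +>\<^bsub>V\<^esub> (c \<odot>\<^bsub>V\<^esub> x)"
proof -
  have "N +>\<^bsub>V\<^esub> (c \<odot>\<^bsub>V\<^esub> z) = N +>\<^bsub>V\<^esub> (c \<odot>\<^bsub>V\<^esub> x)" if z: "z \<in> N +>\<^bsub>V\<^esub> x" for z
  proof -
    obtain n where n: "n \<in> N" "z = n \<oplus>\<^bsub>V\<^esub> x" using z by (auto simp: a_r_coset_def')
    have "n \<in> carrier V" using n N subspace_carrier by blast
    then have "c \<odot>\<^bsub>V\<^esub> z \<ominus>\<^bsub>V\<^esub> c \<odot>\<^bsub>V\<^esub> x = c \<odot>\<^bsub>V\<^esub> n"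
      using n assms by (simp add: smult_r_distr add_minus_cancel)
    then show ?thesis
      using n assms \<open>n \<in> carrier V\<close> subspace_smult[OF N] by (subst coset_eq_iff) auto
  qed
  then have "(\<lambda>z. N +>\<^bsub>V\<^esub> (c \<odot>\<^bsub>V\<^esub> z)) ` (N +>\<^bsub>V\<^esub> x) = (\<lambda>z. N +>\<^bsub>V\<^esub> (c \<odot>\<^bsub>V\<^esub> x)) ` (N +>\<^bsub>V\<^esub> x)"
    by (intro image_cong refl)
  moreover have "N +>\<^bsub>V\<^esub> x \<noteq> {}"
    using assms subspace_zero[OF N] by (force simp: a_r_coset_def')
  ultimately show ?thesis
    by (simp only: quotient_space_def module.simps image_constant_conv) simp
qed

lemma vectorspace_quotient: "vectorspace K (quotient_space V N)"
proof (rule vs_criteria)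
  let ?Q = "quotient_space V N"
  have zero: "N = N +>\<^bsub>V\<^esub> \<zero>\<^bsub>V\<^esub>"
    using coset_eq_zero_iff[of "\<zero>\<^bsub>V\<^esub>"] subspace_zero[OF N] by simp
  note s = quotient_carrier quotient_add quotient_smult
  show "field K" ..
  show "\<zero>\<^bsub>?Q\<^esub> \<in> carrier ?Q"
    using zero by (auto simp: s quotient_zero)
  show "\<forall>v\<in>carrier ?Q. \<exists>w\<in>carrier ?Q. v \<oplus>\<^bsub>?Q\<^esub> w = \<zero>\<^bsub>?Q\<^esub>"
  proof
    fix v assume "v \<in> carrier ?Q"
    then obtain x where x: "x \<in> carrier V" "v = N +>\<^bsub>V\<^esub> x" by (auto simp: s)
    then have "v \<oplus>\<^bsub>?Q\<^esub> (N +>\<^bsub>V\<^esub> (\<ominus>\<^bsub>V\<^esub> x)) = \<zero>\<^bsub>?Q\<^esub>"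
      using zero by (simp add: s quotient_zero M.r_neg)
    then show "\<exists>w\<in>carrier ?Q. v \<oplus>\<^bsub>?Q\<^esub> w = \<zero>\<^bsub>?Q\<^esub>"
      using x by (auto simp: s)
  qed
  show "\<forall>v\<in>carrier ?Q. v \<oplus>\<^bsub>?Q\<^esub> \<zero>\<^bsub>?Q\<^esub> = v"
    unfolding quotient_zero by (subst zero) (auto simp: s)
qed (auto simp: quotient_carrier quotient_add quotient_smult M.a_comm M.a_assoc M.a_lcomm smult_l_distr
       smult_r_distr smult_assoc1)

lemma linear_map_quotient: "linear_map K V (quotient_space V N) (\<lambda>x. N +>\<^bsub>V\<^esub> x)"
  by (intro linear_mapI vectorspace_quotient vectorspace_axioms)
    (auto simp: quotient_carrier quotient_add quotient_smult)

end

end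

text \<open>
  All homology spaces below are treated as quotients \<open>Z / B\<close> of subspaces of one ambient space. The
  codimension of \<open>B\<close> in \<open>Z\<close> is a relation, so that finiteness is part of the statement and is
  inherited by intermediate subspaces in \<open>has_codim_split\<close>.
\<close>
definition has_codim ::
  "('k, 'm) ring_scheme \<Rightarrow> ('k, 'a, 'n) module_scheme \<Rightarrow> 'a set \<Rightarrow> 'a set \<Rightarrow> nat \<Rightarrow> bool" where
  "has_codim K V Z B n \<longleftrightarrow> subspace K Z V \<and> subspace K B V \<and> B \<subseteq> Z \<and>
     has_dim K (quotient_space (V\<lparr>carrier := Z\<rparr>) B) n"

lemma has_codim_unique: "has_codim K V Z B n \<Longrightarrow> has_codim K V Z B m \<Longrightarrow> n = m"
  by (auto simp: has_codim_def dest: has_dim_unique)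

text \<open>The first isomorphism theorem.\<close>
lemma (in vectorspace) has_codim_iff_kernel:
  assumes Z: "subspace K Z V" and g: "linear_map K (vs Z) W g" "g ` Z = carrier W"
    and ker: "\<And>x. x \<in> Z \<Longrightarrow> g x = \<zero>\<^bsub>W\<^esub> \<longleftrightarrow> x \<in> B"
    and B: "B \<subseteq> Z"
  shows "has_codim K V Z B n \<longleftrightarrow> has_dim K W n"
proof -
  interpret Z: vectorspace K "vs Z" using Z by (rule subspace_is_vs)
  interpret g: linear_map K "vs Z" W g by (rule g)
  have "B = g.kerT" using B ker by (auto simp: g.ker_def)
  then have B': "subspace K B (vs Z)" using g.kerT_is_subspace by simp
  let ?q = "\<lambda>x. B +>\<^bsub>vs Z\<^esub> x"
  have q: "linear_map K (vs Z) (quotient_space (vs Z) B) ?q" "?q ` Z = carrier (quotient_space (vs Z) B)"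
    using Z.linear_map_quotient[OF B'] Z.quotient_carrier[OF B'] by auto
  have ker': "?q x = \<zero>\<^bsub>quotient_space (vs Z) B\<^esub> \<longleftrightarrow> g x = \<zero>\<^bsub>W\<^esub>" if "x \<in> Z" for x
    using that ker Z.coset_eq_zero_iff[OF B'] Z.quotient_zero[OF B'] by simp
  have "has_dim K (quotient_space (vs Z) B) n \<longleftrightarrow> has_dim K W n"
    using same_kernel_has_dim[OF q(1) g(1)] same_kernel_has_dim[OF g(1) q(1)] q(2) g(2) ker'
    by (metis carrier_vs_is_self)
  then show ?thesis
    using subspace_of_vs_iff[OF Z] B' Z by (auto simp: has_codim_def)
qed

text \<open>
  A linear map \<open>f\<close> from \<open>Z\<close> to \<open>Z'\<close> induces an isomorphism \<open>Z / B \<cong> Z' / B'\<close> if it is onto modulo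
  \<open>B'\<close> and if \<open>B\<close> is the preimage of \<open>B'\<close>. In this form no map on cosets has to be written down.
\<close>
lemma has_codim_map:
  assumes V: "vectorspace K V" and W: "vectorspace K W"
    and Z: "subspace K Z V" and Z': "subspace K Z' W" and B': "subspace K B' W" "B' \<subseteq> Z'"
    and B: "B \<subseteq> Z"
    and f: "linear_map K (V\<lparr>carrier := Z\<rparr>) W f"
    and im: "\<And>z. z \<in> Z \<Longrightarrow> f z \<in> Z'"
    and surj: "\<And>z'. z' \<in> Z' \<Longrightarrow> \<exists>z\<in>Z. \<exists>b\<in>B'. z' = f z \<oplus>\<^bsub>W\<^esub> b"
    and ker: "\<And>z. z \<in> Z \<Longrightarrow> f z \<in> B' \<longleftrightarrow> z \<in> B"
  shows "has_codim K V Z B n \<longleftrightarrow> has_codim K W Z' B' n"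
proof -
  interpret V: vectorspace K V by (rule V)
  interpret W: vectorspace K W by (rule W)
  interpret f: linear_map K "V.vs Z" W f by (rule f)
  interpret Z': vectorspace K "W.vs Z'" using Z' by (rule W.subspace_is_vs)
  have B'Z': "subspace K B' (W.vs Z')"
    using W.subspace_of_vs_iff[OF Z'] B' by simp
  let ?Q = "quotient_space (W.vs Z') B'"
  let ?q = "\<lambda>x. B' +>\<^bsub>W.vs Z'\<^esub> x"
  interpret q: linear_map K "W.vs Z'" ?Q ?q
    by (rule Z'.linear_map_quotient[OF B'Z'])
  have lin: "linear_map K (V.vs Z) ?Q (\<lambda>z. ?q (f z))"
    using im q.T_add q.T_smult q.T_im f.T_add f.T_smult
    by (intro linear_mapI q.W.vectorspace_axioms f.V.vectorspace_axioms) auto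
  have "?q ` (f ` Z) = carrier ?Q"
  proof -
    have "?q z' \<in> ?q ` (f ` Z)" if z': "z' \<in> Z'" for z'
    proof -
      obtain z b where zb: "z \<in> Z" "b \<in> B'" "z' = f z \<oplus>\<^bsub>W\<^esub> b" using surj[OF z'] by blast
      have b: "b \<in> Z'" "?q b = \<zero>\<^bsub>?Q\<^esub>"
        using zb(2) B' Z'.coset_eq_zero_iff[OF B'Z'] Z'.quotient_zero[OF B'Z'] by auto
      have "?q z' = ?q (f z)"
        using q.T_add[of "f z" b] q.T_im[of "f z"] b zb im[OF zb(1)] by simp
      then show ?thesis using zb by auto
    qed
    then show ?thesis
      using im unfolding Z'.quotient_carrier[OF B'Z'] by auto
  qed
  moreover have "?q (f z) = \<zero>\<^bsub>?Q\<^esub> \<longleftrightarrow> z \<in> B" if "z \<in> Z" for z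
    using that im ker Z'.coset_eq_zero_iff[OF B'Z'] Z'.quotient_zero[OF B'Z'] by simp
  ultimately have "has_codim K V Z B n \<longleftrightarrow> has_dim K ?Q n"
    using V.has_codim_iff_kernel[OF Z lin _ _ B] by (auto simp: image_image)
  then show ?thesis
    using Z' B' by (auto simp: has_codim_def)
qed

lemma (in vectorspace) linear_map_id: "subspace K Z V \<Longrightarrow> linear_map K (vs Z) V (\<lambda>x. x)"
  using subspace_carrier by (intro linear_mapI subspace_is_vs vectorspace_axioms) auto

lemma (in vectorspace) has_codim_second_iso:
  assumes Z: "subspace K Z V" and B: "subspace K B V"
  shows "has_codim K V Z (Z \<inter> B) n \<longleftrightarrow> has_codim K V (Z <+>\<^bsub>V\<^esub> B) B n"
  using assms set_add_upper1[OF assms] set_add_upper2[OF assms]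
  by (intro has_codim_map[where f = "\<lambda>x. x"] vectorspace_axioms subspace_set_add linear_map_id)
    (auto simp: mem_set_add)

text \<open>
  For \<open>B \<subseteq> Y \<subseteq> Z\<close> this is rank-nullity for the projection \<open>Z / B \<rightarrow> Z / Y\<close>, whose kernel is \<open>Y / B\<close>.
\<close>
lemma (in vectorspace) has_codim_split:
  assumes n: "has_codim K V Z B n" and Y: "subspace K Y V" "B \<subseteq> Y" "Y \<subseteq> Z"
  obtains k m where "has_codim K V Y B k" "has_codim K V Z Y m" "n = k + m"
proof -
  have Z: "subspace K Z V" and B: "subspace K B V" "B \<subseteq> Z"
    and n: "has_dim K (quotient_space (vs Z) B) n"
    using n by (auto simp: has_codim_def)
  interpret Z: vectorspace K "vs Z" using Z by (rule subspace_is_vs)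
  have B': "subspace K B (vs Z)" and Y': "subspace K Y (vs Z)"
    using subspace_of_vs_iff[OF Z] B Y by auto
  let ?QB = "quotient_space (vs Z) B" and ?qB = "\<lambda>x. B +>\<^bsub>vs Z\<^esub> x"
  let ?QY = "quotient_space (vs Z) Y" and ?qY = "\<lambda>x. Y +>\<^bsub>vs Z\<^esub> x"
  note qB = Z.linear_map_quotient[OF B'] and qY = Z.linear_map_quotient[OF Y']
  interpret qB: linear_map K "vs Z" ?QB ?qB by (rule qB)
  interpret qY: linear_map K "vs Z" ?QY ?qY by (rule qY)
  have zB: "?qB x = \<zero>\<^bsub>?QB\<^esub> \<longleftrightarrow> x \<in> B" if "x \<in> Z" for x
    using that Z.coset_eq_zero_iff[OF B'] Z.quotient_zero[OF B'] by simp
  have zY: "?qY x = \<zero>\<^bsub>?QY\<^esub> \<longleftrightarrow> x \<in> Y" if "x \<in> Z" for x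
    using that Z.coset_eq_zero_iff[OF Y'] Z.quotient_zero[OF Y'] by simp
  obtain T where T: "linear_map K ?QB ?QY T" "\<And>x. x \<in> Z \<Longrightarrow> T (?qB x) = ?qY x"
  proof (rule linear_map_factor[OF qB qY])
    show "?qB ` carrier (vs Z) = carrier ?QB" by (rule Z.quotient_carrier[OF B', symmetric])
    show "?qY x = \<zero>\<^bsub>?QY\<^esub>" if "x \<in> carrier (vs Z)" "?qB x = \<zero>\<^bsub>?QB\<^esub>" for x
      using that zB[of x] zY[of x] Y(2) by (metis carrier_vs_is_self subsetD)
  qed simp
  interpret T: linear_map K ?QB ?QY T by (rule T)
  have "T ` carrier ?QB = carrier ?QY"
    using T(2) by (auto simp: Z.quotient_carrier[OF B'] Z.quotient_carrier[OF Y'] image_image)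
  then obtain k m where km: "has_dim K (?QB\<lparr>carrier := {x \<in> carrier ?QB. T x = \<zero>\<^bsub>?QY\<^esub>}\<rparr>) k"
    "has_dim K ?QY m" "n = k + m"
    using has_dim_rank_nullity[OF T(1) _ n] by blast
  have ker: "{x \<in> carrier ?QB. T x = \<zero>\<^bsub>?QY\<^esub>} = ?qB ` Y"
  proof -
    have "T (?qB x) = \<zero>\<^bsub>?QY\<^esub> \<longleftrightarrow> x \<in> Y" if "x \<in> Z" for x
      using that T(2) zY by simp
    then show ?thesis
      using Y(3) unfolding Z.quotient_carrier[OF B'] by auto
  qed
  have lin: "linear_map K (vs Y) (?QB\<lparr>carrier := ?qB ` Y\<rparr>) ?qB"
    using qB.linear_map_restrict[OF Y' qB.subspace_image[OF Y']] by simp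
  have "has_codim K V Y B k"
  proof (rule iffD2[OF has_codim_iff_kernel[OF Y(1) lin]])
    show "?qB x = \<zero>\<^bsub>?QB\<lparr>carrier := ?qB ` Y\<rparr>\<^esub> \<longleftrightarrow> x \<in> B" if "x \<in> Y" for x
      using that zB[of x] Y(3) by auto
  qed (use km(1)[unfolded ker] Y in auto)
  moreover have "has_codim K V Z Y m"
    using km Z Y by (simp add: has_codim_def)
  ultimately show thesis using km that by blast
qed

lemma (in vectorspace) has_codim_trivial:
  assumes "has_codim K V Z B n" "Z \<subseteq> B"
  shows "n = 0"
proof -
  have Z: "subspace K Z V" and B: "B = Z"
    and n: "has_dim K (quotient_space (vs Z) B) n"
    using assms by (auto simp: has_codim_def)
  interpret Z: vectorspace K "vs Z" using Z by (rule subspace_is_vs)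
  interpret Q: vectorspace K "quotient_space (vs Z) B" using n by (simp add: has_dim_def)
  have "carrier (quotient_space (vs Z) B) = {\<zero>\<^bsub>quotient_space (vs Z) B\<^esub>}"
    unfolding B using Z.coset_eq_zero_iff[OF Z.subspace_self] Z.M.zero_closed
    by (auto simp: Z.quotient_carrier[OF Z.subspace_self, simplified] Z.quotient_zero[OF Z.subspace_self, simplified] image_iff)
  then have "Q.dim = 0"
    using Q.span_closed[of "{\<zero>\<^bsub>quotient_space (vs Z) B\<^esub>}"]
    by (intro Q.dim0I) (auto simp: Q.span_self)
  then show ?thesis using n by (simp add: has_dim_def)
qed

lemma (in vectorspace) set_add_comm:
  assumes "subspace K A V" "subspace K B V"
  shows "A <+>\<^bsub>V\<^esub> B = B <+>\<^bsub>V\<^esub> A"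
  using M.a_comm subspace_carrier[OF assms(1)] subspace_carrier[OF assms(2)]
  by (auto simp: mem_set_add set_eq_iff) blast+

section \<open>One step of the long exact homology sequence\<close>

text \<open>
  The spaces \<open>N\<^sub>i \<subseteq> M\<^sub>i\<close> and \<open>J\<^sub>i\<close> are subspaces of the ambient spaces \<open>E\<^sub>i\<close>; the hypotheses \<open>a\<close>,
  \<open>b\<close>, \<open>c\<close> give the dimensions of the homology in degree 1 of the complexes
  \<open>(M \<inter> J) / (N \<inter> J)\<close>, \<open>M / N\<close> and \<open>(M + J) / (N + J)\<close>, lifted to the ambient spaces. These complexes
  form a short exact sequence. The number \<open>k\<close> is the dimension of the kernel of the map from the first
  homology to the second one in degree 1; \<open>k'\<close> is the same number in degree 0, which is also the rank
  of the connecting homomorphism that starts in the third homology in degree 1. The proof produces both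
  by splitting the three homology spaces along the images of these maps:
  \<open>a = k + m\<close>, \<open>b = m + k1\<close> and \<open>c = k1 + k'\<close>, where \<open>m\<close> is the rank of the map from the first homology
  to the second one and \<open>k1\<close> that of the map from the second one to the third one.
\<close>
lemma euler_step:
  assumes d2: "linear_map K E2 E1 d2" and d1: "linear_map K E1 E0 d1"
    and dd: "\<And>x. x \<in> carrier E2 \<Longrightarrow> d1 (d2 x) = \<zero>\<^bsub>E0\<^esub>"
    and M2: "subspace K M2 E2" and J2: "subspace K J2 E2"
    and M1: "subspace K M1 E1" and N1: "subspace K N1 E1" and J1: "subspace K J1 E1"
    and N0: "subspace K N0 E0" and J0: "subspace K J0 E0"
    and NM: "N1 \<subseteq> M1" and dM: "d2 ` M2 \<subseteq> M1" and dN: "d1 ` N1 \<subseteq> N0"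
    and dJ: "d2 ` J2 \<subseteq> J1" "d1 ` J1 \<subseteq> J0"
    and a: "has_codim K E1 {x \<in> M1 \<inter> J1. d1 x \<in> N0 \<inter> J0} (d2 ` (M2 \<inter> J2) <+>\<^bsub>E1\<^esub> (N1 \<inter> J1)) a"
    and b: "has_codim K E1 {x \<in> M1. d1 x \<in> N0} (d2 ` M2 <+>\<^bsub>E1\<^esub> N1) b"
    and c: "has_codim K E1 {x \<in> M1 <+>\<^bsub>E1\<^esub> J1. d1 x \<in> N0 <+>\<^bsub>E0\<^esub> J0}
      (d2 ` (M2 <+>\<^bsub>E2\<^esub> J2) <+>\<^bsub>E1\<^esub> (N1 <+>\<^bsub>E1\<^esub> J1)) c"
  obtains k k' where
    "has_codim K E1 (J1 \<inter> (d2 ` M2 <+>\<^bsub>E1\<^esub> N1)) (d2 ` (M2 \<inter> J2) <+>\<^bsub>E1\<^esub> (N1 \<inter> J1)) k"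
    "has_codim K E0 (J0 \<inter> (d1 ` M1 <+>\<^bsub>E0\<^esub> N0)) (d1 ` (M1 \<inter> J1) <+>\<^bsub>E0\<^esub> (N0 \<inter> J0)) k'"
    "a + c = b + k + k'"
proof -
  interpret E2: vectorspace K E2 using d2 by (simp add: linear_map_def)
  interpret E1: vectorspace K E1 using d1 by (simp add: linear_map_def)
  interpret E0: vectorspace K E0 using d1 by (simp add: linear_map_def)
  interpret d2: linear_map K E2 E1 d2 by (rule d2)
  interpret d1: linear_map K E1 E0 d1 by (rule d1)
  define MJ where "MJ = M1 \<inter> J1"
  define Za where "Za = {x \<in> M1 \<inter> J1. d1 x \<in> N0 \<inter> J0}"
  define Zb where "Zb = {x \<in> M1. d1 x \<in> N0}"
  define Zc where "Zc = {x \<in> M1 <+>\<^bsub>E1\<^esub> J1. d1 x \<in> N0 <+>\<^bsub>E0\<^esub> J0}"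
  define Ba where "Ba = d2 ` (M2 \<inter> J2) <+>\<^bsub>E1\<^esub> (N1 \<inter> J1)"
  define Bb where "Bb = d2 ` M2 <+>\<^bsub>E1\<^esub> N1"
  define Bc where "Bc = d2 ` (M2 <+>\<^bsub>E2\<^esub> J2) <+>\<^bsub>E1\<^esub> (N1 <+>\<^bsub>E1\<^esub> J1)"
  \<comment> \<open>\<open>P\<close> consists of the elements of \<open>M1\<close> that become cycles modulo \<open>J\<close>: every class of the third
    homology has a representative in \<open>P\<close>.\<close>
  define P where "P = {x \<in> M1. d1 x \<in> N0 <+>\<^bsub>E0\<^esub> J0}"
  define Q where "Q = d1 ` M1 <+>\<^bsub>E0\<^esub> N0"
  define B0 where "B0 = d1 ` MJ <+>\<^bsub>E0\<^esub> N0"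
  note carr1 = E1.subspace_carrier[OF M1] E1.subspace_carrier[OF N1] E1.subspace_carrier[OF J1]
  note carr0 = E0.subspace_carrier[OF N0] E0.subspace_carrier[OF J0]
  have dM2: "subspace K (d2 ` M2) E1" by (rule d2.subspace_image[OF M2])
  have NJ0: "subspace K (N0 <+>\<^bsub>E0\<^esub> J0) E0" by (rule E0.subspace_set_add[OF N0 J0])
  have MJ: "subspace K MJ E1" unfolding MJ_def by (rule E1.subspace_Int[OF M1 J1])
  have Za: "subspace K Za E1" and Zb: "subspace K Zb E1" and P: "subspace K P E1"
    unfolding Za_def Zb_def P_def
    by (intro d1.subspace_vimage E1.subspace_Int E0.subspace_Int M1 J1 N0 J0 NJ0)+
  have Ba: "subspace K Ba E1" unfolding Ba_def
    by (intro E1.subspace_set_add d2.subspace_image E2.subspace_Int E1.subspace_Int M2 J2 N1 J1)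
  have Bb: "subspace K Bb E1" unfolding Bb_def by (rule E1.subspace_set_add[OF dM2 N1])
  have dM1: "subspace K (d1 ` M1) E0" and dMJ: "subspace K (d1 ` MJ) E0"
    by (rule d1.subspace_image[OF M1], rule d1.subspace_image[OF MJ])
  have Q: "subspace K Q E0" unfolding Q_def by (rule E0.subspace_set_add[OF dM1 N0])
  have B0: "subspace K B0 E0" unfolding B0_def by (rule E0.subspace_set_add[OF dMJ N0])
  have ZaZb: "Za = Zb \<inter> J1" using dJ by (auto simp: Za_def Zb_def)
  have dM2Zb: "d2 ` M2 \<subseteq> Zb"
    using dM dd E2.subspace_carrier[OF M2] E0.subspace_zero[OF N0] by (auto simp: Zb_def)
  have BbZb: "Bb \<subseteq> Zb" unfolding Bb_def
    using dM2Zb NM dN by (intro E1.set_add_least[OF Zb]) (auto simp: Zb_def)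
  have ZbP: "Zb \<subseteq> P"
    using E0.set_add_upper1[OF N0 J0] by (auto simp: Zb_def P_def)
  have MJP: "MJ \<subseteq> P"
    using E0.set_add_upper2[OF N0 J0] dJ by (auto simp: MJ_def P_def)
  have J1P: "J1 \<inter> P = MJ" using MJP by (auto simp: MJ_def P_def)
  have BbJ1: "subspace K (Bb <+>\<^bsub>E1\<^esub> J1) E1" by (rule E1.subspace_set_add[OF Bb J1])
  have N1Bb: "N1 \<subseteq> Bb" and dM2Bb: "d2 ` M2 \<subseteq> Bb"
    unfolding Bb_def by (rule E1.set_add_upper2[OF dM2 N1], rule E1.set_add_upper1[OF dM2 N1])
  \<comment> \<open>The third homology is \<open>P / (Bb + MJ)\<close>: it is \<open>(P + Bc) / Bc\<close>, and \<open>P \<inter> Bc\<close> is computed with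
    the modular law.\<close>
  have Bc_eq: "Bc = Bb <+>\<^bsub>E1\<^esub> J1"
  proof
    have "d2 ` (M2 <+>\<^bsub>E2\<^esub> J2) \<subseteq> Bb <+>\<^bsub>E1\<^esub> J1"
    proof safe
      fix x assume "x \<in> M2 <+>\<^bsub>E2\<^esub> J2"
      then obtain m j where mj: "m \<in> M2" "j \<in> J2" "x = m \<oplus>\<^bsub>E2\<^esub> j" by (auto simp: E2.mem_set_add)
      then have "d2 x = d2 m \<oplus>\<^bsub>E1\<^esub> d2 j"
        using E2.subspace_carrier[OF M2] E2.subspace_carrier[OF J2] by simp
      then show "d2 x \<in> Bb <+>\<^bsub>E1\<^esub> J1"
        using mj dM2Bb dJ unfolding E1.mem_set_add by blast
    qed
    moreover have "N1 <+>\<^bsub>E1\<^esub> J1 \<subseteq> Bb <+>\<^bsub>E1\<^esub> J1"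
      using N1Bb by (intro E1.set_add_mono) auto
    ultimately show "Bc \<subseteq> Bb <+>\<^bsub>E1\<^esub> J1"
      unfolding Bc_def by (rule E1.set_add_least[OF BbJ1])
    have Bc: "subspace K Bc E1" unfolding Bc_def
      by (intro E1.subspace_set_add d2.subspace_image E2.subspace_set_add M2 J2 N1 J1)
    have up1: "d2 ` (M2 <+>\<^bsub>E2\<^esub> J2) \<subseteq> Bc" and up2: "N1 <+>\<^bsub>E1\<^esub> J1 \<subseteq> Bc"
      unfolding Bc_def
      by (intro E1.set_add_upper1 E1.set_add_upper2 E1.subspace_set_add d2.subspace_image
          E2.subspace_set_add M2 J2 N1 J1)+
    have "d2 ` M2 \<subseteq> Bc" using up1 E2.set_add_upper1[OF M2 J2] by blast
    moreover have "N1 \<subseteq> Bc" "J1 \<subseteq> Bc"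
      using up2 E1.set_add_upper1[OF N1 J1] E1.set_add_upper2[OF N1 J1] by auto
    ultimately show "Bb <+>\<^bsub>E1\<^esub> J1 \<subseteq> Bc"
      unfolding Bb_def by (intro E1.set_add_least[OF Bc])
  qed
  have Bc: "subspace K Bc E1" unfolding Bc_eq by (rule BbJ1)
  have PBc: "P \<inter> Bc = Bb <+>\<^bsub>E1\<^esub> MJ"
    using E1.modular_law[OF Bb J1 P] BbZb ZbP by (simp add: Bc_eq Int_commute J1P)
  have Zc_eq: "Zc = P <+>\<^bsub>E1\<^esub> Bc"
  proof
    have Zc': "subspace K Zc E1" unfolding Zc_def
      by (intro d1.subspace_vimage E1.subspace_set_add NJ0 M1 J1)
    have "P \<subseteq> Zc"
      using E1.set_add_upper1[OF M1 J1] by (auto simp: P_def Zc_def)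
    moreover have "J1 \<subseteq> Zc"
      using E1.set_add_upper2[OF M1 J1] E0.set_add_upper2[OF N0 J0] dJ by (auto simp: Zc_def)
    moreover have "Bc \<subseteq> Zc" unfolding Bc_eq
      using calculation BbZb ZbP by (intro E1.set_add_least[OF Zc']) auto
    ultimately show "P <+>\<^bsub>E1\<^esub> Bc \<subseteq> Zc" by (intro E1.set_add_least[OF Zc'])
    show "Zc \<subseteq> P <+>\<^bsub>E1\<^esub> Bc"
    proof
      fix x assume x: "x \<in> Zc"
      then obtain m j where mj: "m \<in> M1" "j \<in> J1" "x = m \<oplus>\<^bsub>E1\<^esub> j"
        by (auto simp: Zc_def E1.mem_set_add)
      then have "d1 x = d1 m \<oplus>\<^bsub>E0\<^esub> d1 j" using carr1 by simp
      moreover have "d1 j \<in> N0 <+>\<^bsub>E0\<^esub> J0" using mj dJ E0.set_add_upper2[OF N0 J0] by auto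
      ultimately have "m \<in> P"
        using E0.subspace_add_left_iff[OF NJ0, of "d1 j" "d1 m"] mj x carr1
        by (simp add: P_def Zc_def)
      moreover have "j \<in> Bc" using mj E1.set_add_upper2[OF Bb J1] by (auto simp: Bc_eq)
      ultimately show "x \<in> P <+>\<^bsub>E1\<^esub> Bc" using mj unfolding E1.mem_set_add by blast
    qed
  qed
  have BbMJ: "subspace K (Bb <+>\<^bsub>E1\<^esub> MJ) E1" and ZbMJ: "subspace K (Zb <+>\<^bsub>E1\<^esub> MJ) E1"
    by (intro E1.subspace_set_add Bb MJ Zb)+
  have "has_codim K E1 P (Bb <+>\<^bsub>E1\<^esub> MJ) c"
    using c E1.has_codim_second_iso[OF P Bc, of c] unfolding PBc Zc_eq[symmetric]
    by (simp add: Zc_def Bc_def)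
  moreover have "Bb <+>\<^bsub>E1\<^esub> MJ \<subseteq> Zb <+>\<^bsub>E1\<^esub> MJ"
    using BbZb by (intro E1.set_add_mono) auto
  moreover have "Zb <+>\<^bsub>E1\<^esub> MJ \<subseteq> P"
    using ZbP MJP by (intro E1.set_add_least[OF P])
  \<comment> \<open>\<open>(Zb + MJ) / (Bb + MJ)\<close> is the image of the second homology in the third one, and
    \<open>P / (Zb + MJ)\<close> is the cokernel, that is, the image of the connecting homomorphism.\<close>
  ultimately obtain k1 k' where k1: "has_codim K E1 (Zb <+>\<^bsub>E1\<^esub> MJ) (Bb <+>\<^bsub>E1\<^esub> MJ) k1"
    and k': "has_codim K E1 P (Zb <+>\<^bsub>E1\<^esub> MJ) k'" and ceq: "c = k1 + k'"
    using E1.has_codim_split[OF _ ZbMJ] by blast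
  have BbZa: "subspace K (Bb <+>\<^bsub>E1\<^esub> Za) E1" by (intro E1.subspace_set_add Bb Za)
  have "Zb <+>\<^bsub>E1\<^esub> MJ = Zb <+>\<^bsub>E1\<^esub> (Bb <+>\<^bsub>E1\<^esub> MJ)"
  proof
    show "Zb <+>\<^bsub>E1\<^esub> MJ \<subseteq> Zb <+>\<^bsub>E1\<^esub> (Bb <+>\<^bsub>E1\<^esub> MJ)"
      using E1.set_add_upper2[OF Bb MJ] by (intro E1.set_add_mono) auto
    show "Zb <+>\<^bsub>E1\<^esub> (Bb <+>\<^bsub>E1\<^esub> MJ) \<subseteq> Zb <+>\<^bsub>E1\<^esub> MJ"
      using E1.set_add_upper1[OF Zb MJ] BbZb
      by (intro E1.set_add_least[OF ZbMJ] E1.set_add_mono) auto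
  qed
  moreover have "Zb \<inter> (Bb <+>\<^bsub>E1\<^esub> MJ) = Bb <+>\<^bsub>E1\<^esub> Za"
  proof -
    have "MJ \<inter> Zb = Za" by (auto simp: ZaZb MJ_def Zb_def)
    then show ?thesis
      using E1.modular_law[OF Bb MJ Zb BbZb] by (simp add: Int_commute)
  qed
  ultimately have k1': "has_codim K E1 Zb (Bb <+>\<^bsub>E1\<^esub> Za) k1"
    using k1 E1.has_codim_second_iso[OF Zb BbMJ, of k1] by simp
  \<comment> \<open>\<open>(Bb + Za) / Bb\<close> is the image of the first homology in the second one.\<close>
  have "has_codim K E1 Zb Bb b" using b by (simp add: Zb_def Bb_def)
  moreover have "Bb \<subseteq> Bb <+>\<^bsub>E1\<^esub> Za" by (rule E1.set_add_upper1[OF Bb Za])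
  moreover have "Bb <+>\<^bsub>E1\<^esub> Za \<subseteq> Zb" using BbZb ZaZb by (intro E1.set_add_least[OF Zb]) auto
  ultimately obtain m where m: "has_codim K E1 (Bb <+>\<^bsub>E1\<^esub> Za) Bb m" and beq: "b = m + k1"
    using E1.has_codim_split[OF _ BbZa] has_codim_unique[OF k1'] by metis
  have m': "has_codim K E1 Za (Za \<inter> Bb) m"
    using m E1.has_codim_second_iso[OF Za Bb, of m] E1.set_add_comm[OF Bb Za] by simp
  have "has_codim K E1 Za Ba a" using a by (simp add: Za_def Ba_def)
  moreover have "Ba \<subseteq> Za \<inter> Bb"
  proof -
    have 1: "Ba \<subseteq> Bb" unfolding Ba_def Bb_def by (intro E1.set_add_mono) auto
    have "Ba \<subseteq> J1" unfolding Ba_def using dJ by (intro E1.set_add_least[OF J1]) auto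
    then show ?thesis using 1 BbZb by (auto simp: ZaZb)
  qed
  ultimately obtain k where k: "has_codim K E1 (Za \<inter> Bb) Ba k" and aeq: "a = k + m"
    using E1.has_codim_split[OF _ E1.subspace_Int[OF Za Bb]] has_codim_unique[OF m']
    by (metis inf_le1)
  have k_eq: "has_codim K E1 (J1 \<inter> Bb) Ba k"
  proof -
    have "Za \<inter> Bb = J1 \<inter> Bb" using BbZb by (auto simp: ZaZb)
    then show ?thesis using k by simp
  qed
  \<comment> \<open>It remains to identify the cokernel \<open>P / (Zb + MJ)\<close> with the kernel in degree 0. The connecting
    homomorphism sends \<open>z \<in> P\<close> to the part of \<open>d1 z \<in> N0 + J0\<close> in \<open>J0\<close>, which is not well defined as
    an element. Modulo \<open>N0\<close> it is \<open>d1\<close> itself, so \<open>d1\<close> is used as a map into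
    \<open>((N0 + J0) \<inter> Q) / B0\<close>, where \<open>Q\<close> and \<open>B0\<close> contain \<open>N0\<close>; then \<open>N0\<close> is removed by the second
    isomorphism theorem.\<close>
  have N0Q: "N0 \<subseteq> Q" and N0B0: "N0 \<subseteq> B0" and dM1Q: "d1 ` M1 \<subseteq> Q"
    unfolding Q_def B0_def
    by (rule E0.set_add_upper2[OF dM1 N0], rule E0.set_add_upper2[OF dMJ N0],
        rule E0.set_add_upper1[OF dM1 N0])
  have NJQ: "subspace K ((N0 <+>\<^bsub>E0\<^esub> J0) \<inter> Q) E0" by (rule E0.subspace_Int[OF NJ0 Q])
  have dMJJ: "d1 ` MJ \<subseteq> J0 \<inter> Q" using dJ dM1Q by (auto simp: MJ_def)
  have B0sub: "B0 \<subseteq> (N0 <+>\<^bsub>E0\<^esub> J0) \<inter> Q" unfolding B0_def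
    using dMJJ E0.set_add_upper2[OF N0 J0] E0.set_add_upper1[OF N0 J0] N0Q
    by (intro E0.set_add_least[OF NJQ]) auto
  have "has_codim K E0 ((N0 <+>\<^bsub>E0\<^esub> J0) \<inter> Q) B0 k'"
  proof -
    have "has_codim K E1 P (Zb <+>\<^bsub>E1\<^esub> MJ) k' \<longleftrightarrow> has_codim K E0 ((N0 <+>\<^bsub>E0\<^esub> J0) \<inter> Q) B0 k'"
    proof (rule has_codim_map[OF E1.vectorspace_axioms E0.vectorspace_axioms P NJQ B0 B0sub])
      show "Zb <+>\<^bsub>E1\<^esub> MJ \<subseteq> P" by fact
      have "E0\<lparr>carrier := carrier E0\<rparr> = E0" by simp
      then show "linear_map K (E1\<lparr>carrier := P\<rparr>) E0 d1"
        using d1.linear_map_restrict[OF P E0.subspace_self] E1.subspace_carrier[OF P]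
        by (auto simp: image_subset_iff)
      show "d1 z \<in> (N0 <+>\<^bsub>E0\<^esub> J0) \<inter> Q" if "z \<in> P" for z
        using that dM1Q by (auto simp: P_def)
      show "\<exists>z\<in>P. \<exists>b\<in>B0. z' = d1 z \<oplus>\<^bsub>E0\<^esub> b" if z': "z' \<in> (N0 <+>\<^bsub>E0\<^esub> J0) \<inter> Q" for z'
      proof -
        obtain m n where mn: "m \<in> M1" "n \<in> N0" "z' = d1 m \<oplus>\<^bsub>E0\<^esub> n"
          using z' by (auto simp: Q_def E0.mem_set_add)
        then have "d1 m \<in> N0 <+>\<^bsub>E0\<^esub> J0"
          using z' E0.subspace_add_left_iff[OF NJ0, of n "d1 m"] E0.set_add_upper1[OF N0 J0] carr1
          by auto
        then have "m \<in> P" using mn by (simp add: P_def)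
        then show ?thesis using mn N0B0 by blast
      qed
      show "d1 z \<in> B0 \<longleftrightarrow> z \<in> Zb <+>\<^bsub>E1\<^esub> MJ" if z: "z \<in> P" for z
      proof
        have zM: "z \<in> M1" using z by (simp add: P_def)
        assume "d1 z \<in> B0"
        then obtain x n where xn: "x \<in> MJ" "n \<in> N0" "d1 z = d1 x \<oplus>\<^bsub>E0\<^esub> n"
          by (auto simp: B0_def E0.mem_set_add)
        have xM: "x \<in> M1" using xn by (simp add: MJ_def)
        have "d1 (z \<ominus>\<^bsub>E1\<^esub> x) = n"
          using xn zM xM carr1 carr0 by (simp add: E0.M.a_comm[of "d1 x"] E0.add_minus_cancel)
        then have "z \<ominus>\<^bsub>E1\<^esub> x \<in> Zb"
          using E1.subspace_minus[OF M1 zM xM] xn by (simp add: Zb_def)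
        moreover have "z = (z \<ominus>\<^bsub>E1\<^esub> x) \<oplus>\<^bsub>E1\<^esub> x"
          using E1.minus_add_cancel carr1 zM xM by simp
        ultimately show "z \<in> Zb <+>\<^bsub>E1\<^esub> MJ" using xn unfolding E1.mem_set_add by blast
      next
        assume "z \<in> Zb <+>\<^bsub>E1\<^esub> MJ"
        then obtain y x where yx: "y \<in> Zb" "x \<in> MJ" "z = y \<oplus>\<^bsub>E1\<^esub> x" by (auto simp: E1.mem_set_add)
        then have "d1 z = d1 x \<oplus>\<^bsub>E0\<^esub> d1 y" "d1 y \<in> N0"
          using carr1 by (auto simp: Zb_def MJ_def E0.M.a_comm)
        then show "d1 z \<in> B0" using yx unfolding B0_def E0.mem_set_add by blast
      qed
    qed
    then show ?thesis using k' by simp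
  qed
  moreover have "(J0 \<inter> Q) \<inter> B0 = d1 ` MJ <+>\<^bsub>E0\<^esub> (N0 \<inter> J0)"
  proof -
    have "N0 \<inter> (J0 \<inter> Q) = N0 \<inter> J0" using N0Q by auto
    then show ?thesis
      using E0.modular_law[OF dMJ N0 E0.subspace_Int[OF J0 Q] dMJJ]
      by (simp add: B0_def Int_commute)
  qed
  moreover have "(J0 \<inter> Q) <+>\<^bsub>E0\<^esub> B0 = (N0 <+>\<^bsub>E0\<^esub> J0) \<inter> Q"
  proof
    show "(J0 \<inter> Q) <+>\<^bsub>E0\<^esub> B0 \<subseteq> (N0 <+>\<^bsub>E0\<^esub> J0) \<inter> Q"
      using E0.set_add_upper2[OF N0 J0] B0sub by (intro E0.set_add_least[OF NJQ]) auto
    show "(N0 <+>\<^bsub>E0\<^esub> J0) \<inter> Q \<subseteq> (J0 \<inter> Q) <+>\<^bsub>E0\<^esub> B0"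
    proof
      fix x assume x: "x \<in> (N0 <+>\<^bsub>E0\<^esub> J0) \<inter> Q"
      then obtain n j where nj: "n \<in> N0" "j \<in> J0" "x = n \<oplus>\<^bsub>E0\<^esub> j" by (auto simp: E0.mem_set_add)
      then have "j \<in> Q"
        using x E0.subspace_add_right_iff[OF Q, of n j] N0Q carr0 by auto
      moreover have "x = j \<oplus>\<^bsub>E0\<^esub> n" using nj carr0 by (simp add: E0.M.a_comm)
      ultimately show "x \<in> (J0 \<inter> Q) <+>\<^bsub>E0\<^esub> B0"
        using nj N0B0 unfolding E0.mem_set_add by blast
    qed
  qed
  ultimately have "has_codim K E0 (J0 \<inter> Q) (d1 ` MJ <+>\<^bsub>E0\<^esub> (N0 \<inter> J0)) k'"
    using E0.has_codim_second_iso[OF E0.subspace_Int[OF J0 Q] B0, of k'] by simp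
  then show thesis
    using that k_eq aeq beq ceq by (simp add: Ba_def Bb_def Q_def MJ_def)
qed

section \<open>The complex of a nested family of spaces\<close>
lemma field_complex_ring: "field complex_ring"
proof -
  have "cring complex_ring"
  proof (rule cringI)
    have "\<exists>y. y + x = 0" for x :: complex by (rule exI[of _ "- x"]) simp
    then show "abelian_group complex_ring"
      by (intro abelian_groupI) (auto simp: complex_ring_def)
  qed (auto simp: complex_ring_def algebra_simps intro!: comm_monoidI)
  moreover have "c \<in> Units complex_ring \<longleftrightarrow> c \<noteq> 0" for c
    by (auto simp: Units_def complex_ring_def intro!: exI[of _ "inverse c"])
  then have "Units complex_ring = carrier complex_ring - {\<zero>\<^bsub>complex_ring\<^esub>}"
    by (auto simp: complex_ring_def)
  ultimately show ?thesis
    by (rule cring.cring_fieldI)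
qed

lemma complex_ring_simps [simp]:
  "carrier complex_ring = UNIV" "\<zero>\<^bsub>complex_ring\<^esub> = 0" "\<one>\<^bsub>complex_ring\<^esub> = 1"
  "x \<otimes>\<^bsub>complex_ring\<^esub> y = x * y" "x \<oplus>\<^bsub>complex_ring\<^esub> y = x + y"
  by (simp_all add: complex_ring_def)

lemma (in linear_map) T_finsum:
  assumes "g \<in> A \<rightarrow> carrier V"
  shows "T (finsum V g A) = (\<Oplus>\<^bsub>W\<^esub>a\<in>A. T (g a))"
  using assms
proof (induct A rule: infinite_finite_induct)
  case (insert a A)
  then have "g a \<in> carrier V" "finsum V g A \<in> carrier V" "(\<lambda>a. T (g a)) \<in> insert a A \<rightarrow> carrier W"
    by auto
  with insert show ?case by (simp add: V.module.M.finsum_insert W.module.M.finsum_insert)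
qed auto

lemma (in vectorspace) finsum_vs:
  assumes "subspace K W V" "g \<in> A \<rightarrow> W"
  shows "finsum (vs W) g A = finsum V g A"
proof -
  interpret linear_map K "vs W" V "\<lambda>x. x" using assms(1) by (rule linear_map_id)
  show ?thesis using T_finsum[of g A] assms by simp
qed

lemma (in vectorspace) subspace_finsum:
  assumes "subspace K W V" "g \<in> A \<rightarrow> W"
  shows "finsum V g A \<in> W"
proof -
  interpret W: vectorspace K "vs W" using assms(1) by (rule subspace_is_vs)
  show ?thesis
    using W.M.finsum_closed[of g A] assms by (simp add: finsum_vs)
qed

lemma (in abelian_monoid) finsum_swap:
  assumes "finite A" "finite B" "\<And>a b. a \<in> A \<Longrightarrow> b \<in> B \<Longrightarrow> f a b \<in> carrier G"
  shows "(\<Oplus>a\<in>A. \<Oplus>b\<in>B. f a b) = (\<Oplus>b\<in>B. \<Oplus>a\<in>A. f a b)"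
  using assms(1,3)
proof (induct A)
  case empty
  then show ?case by simp
next
  case (insert x A)
  have "(\<Oplus>a\<in>insert x A. \<Oplus>b\<in>B. f a b) = (\<Oplus>b\<in>B. f x b) \<oplus> (\<Oplus>b\<in>B. \<Oplus>a\<in>A. f a b)"
    using insert by (simp add: Pi_def)
  also have "\<dots> = (\<Oplus>b\<in>B. f x b \<oplus> (\<Oplus>a\<in>A. f a b))"
    using insert by (subst finsum_addf) (auto simp: Pi_def)
  also have "\<dots> = (\<Oplus>b\<in>B. \<Oplus>a\<in>insert x A. f a b)"
    using insert by (intro finsum_cong') (auto simp: Pi_def)
  finally show ?case .
qed

lemma vectorspace_direct_sum_family:
  assumes V: "\<And>I. I \<in> S \<Longrightarrow> vectorspace K (V I)" and K: "field K"
  shows "vectorspace K (direct_sum_family S V)"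
proof -
  let ?D = "direct_sum_family S V"
  have m: "module K (V I)" if "I \<in> S" for I
    using V[OF that] by (simp add: vectorspace_def)
  have g: "abelian_group (V I)" if "I \<in> S" for I
    using m[OF that] by (simp add: module_def)
  have am: "abelian_monoid (V I)" if "I \<in> S" for I
    using g[OF that] by (simp add: abelian_group_def)
  have mem: "x I \<in> carrier (V I)" if "x \<in> (\<Pi>\<^sub>E I\<in>S. carrier (V I))" "I \<in> S" for x I
    using that by (rule PiE_mem)
  note s = direct_sum_family_def mem abelian_monoid.zero_closed[OF am] abelian_monoid.a_closed[OF am]
    module.smult_closed[OF m]
  show ?thesis
  proof (rule vs_criteria)
    show "field K" by (rule K)
    show "\<forall>v\<in>carrier ?D. \<exists>w\<in>carrier ?D. v \<oplus>\<^bsub>?D\<^esub> w = \<zero>\<^bsub>?D\<^esub>"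
    proof
      fix v assume v: "v \<in> carrier ?D"
      then have "(\<lambda>I\<in>S. \<ominus>\<^bsub>V I\<^esub> v I) \<in> carrier ?D"
        by (auto simp: direct_sum_family_def intro: abelian_group.a_inv_closed[OF g] mem)
      moreover have "v \<oplus>\<^bsub>?D\<^esub> (\<lambda>I\<in>S. \<ominus>\<^bsub>V I\<^esub> v I) = \<zero>\<^bsub>?D\<^esub>"
        using v by (auto simp: direct_sum_family_def intro!: restrict_ext abelian_group.r_neg[OF g] mem)
      ultimately show "\<exists>w\<in>carrier ?D. v \<oplus>\<^bsub>?D\<^esub> w = \<zero>\<^bsub>?D\<^esub>" by blast
    qed
    have "(\<lambda>I\<in>S. v I \<oplus>\<^bsub>V I\<^esub> \<zero>\<^bsub>V I\<^esub>) = v" "(\<lambda>I\<in>S. \<one>\<^bsub>K\<^esub> \<odot>\<^bsub>V I\<^esub> v I) = v"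
      if v: "v \<in> (\<Pi>\<^sub>E I\<in>S. carrier (V I))" for v
    proof -
      have "(\<lambda>I\<in>S. v I \<oplus>\<^bsub>V I\<^esub> \<zero>\<^bsub>V I\<^esub>) = restrict v S"
        by (rule restrict_ext) (simp add: abelian_monoid.r_zero[OF am] mem[OF v])
      moreover have "(\<lambda>I\<in>S. \<one>\<^bsub>K\<^esub> \<odot>\<^bsub>V I\<^esub> v I) = restrict v S"
        by (rule restrict_ext) (simp add: module.smult_one[OF m] mem[OF v])
      moreover have "restrict v S = v" using v by (rule PiE_restrict)
      ultimately show "(\<lambda>I\<in>S. v I \<oplus>\<^bsub>V I\<^esub> \<zero>\<^bsub>V I\<^esub>) = v" "(\<lambda>I\<in>S. \<one>\<^bsub>K\<^esub> \<odot>\<^bsub>V I\<^esub> v I) = v" by (simp_all only:)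
    qed
    then show "\<forall>v\<in>carrier ?D. v \<oplus>\<^bsub>?D\<^esub> \<zero>\<^bsub>?D\<^esub> = v" "\<forall>v\<in>carrier ?D. \<one>\<^bsub>K\<^esub> \<odot>\<^bsub>?D\<^esub> v = v"
      by (auto simp: direct_sum_family_def cong: restrict_cong)
  qed (auto simp: s abelian_monoid.a_comm[OF am] abelian_monoid.a_assoc[OF am] abelian_monoid.a_lcomm[OF am]
      module.smult_l_distr[OF m] module.smult_r_distr[OF m] module.smult_assoc1[OF m]
      intro!: restrict_ext)
qed

text \<open>
  The boundary map adds components from different spaces \<open>V I\<close>, so it is linear only if the operations
  of these spaces agree and the spaces are nested.
\<close>
definition nested_family :: "('i set \<Rightarrow> (complex, 'a, 'm) module_scheme) \<Rightarrow> bool" where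
  "nested_family V \<longleftrightarrow> (\<forall>I. vectorspace complex_ring (V I)) \<and>
     (\<forall>I J. J \<subseteq> I \<longrightarrow> carrier (V I) \<subseteq> carrier (V J)) \<and>
     (\<forall>I J. (\<oplus>\<^bsub>V I\<^esub>) = (\<oplus>\<^bsub>V J\<^esub>) \<and> (\<odot>\<^bsub>V I\<^esub>) = (\<odot>\<^bsub>V J\<^esub>))"

lemma nested_family_const: "vectorspace complex_ring R \<Longrightarrow> nested_family (\<lambda>_. R)"
  by (simp add: nested_family_def)

lemma vectorspace_chain_space:
  "nested_family V \<Longrightarrow> vectorspace complex_ring (chain_space V i)"
  unfolding chain_space_def nested_family_def
  by (intro vectorspace_direct_sum_family field_complex_ring) auto

lemma chain_space_simps:
  "carrier (chain_space V i) = (\<Pi>\<^sub>E I\<in>{I. int (card I) = i}. carrier (V I))"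
  "\<zero>\<^bsub>chain_space V i\<^esub> = (\<lambda>I\<in>{I. int (card I) = i}. \<zero>\<^bsub>V I\<^esub>)"
  "x \<oplus>\<^bsub>chain_space V i\<^esub> y = (\<lambda>I\<in>{I. int (card I) = i}. x I \<oplus>\<^bsub>V I\<^esub> y I)"
  "c \<odot>\<^bsub>chain_space V i\<^esub> x = (\<lambda>I\<in>{I. int (card I) = i}. c \<odot>\<^bsub>V I\<^esub> x I)"
  by (simp_all add: chain_space_def direct_sum_family_def)

lemma card_insert_face:
  fixes J :: "'r::finite set"
  shows "a \<notin> J \<Longrightarrow> int (card J) = i - 1 \<Longrightarrow> int (card (insert a J)) = i"
  by simp

definition face_sign :: "'r::{finite,linorder} \<Rightarrow> 'r set \<Rightarrow> complex" where
  "face_sign a J = (-1) ^ card {b \<in> insert a J. b \<le> a}"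

lemma boundary_apply:
  "int (card J) = i - 1 \<Longrightarrow>
     boundary V i x J = (\<Oplus>\<^bsub>V J\<^esub>a\<in>-J. face_sign a J \<odot>\<^bsub>V J\<^esub> x (insert a J))"
  by (simp add: boundary_def face_sign_def)

lemma linear_map_boundary:
  fixes V :: "'r::{finite,linorder} set \<Rightarrow> (complex, 'a, 'm) module_scheme"
  assumes V: "nested_family V"
  shows "linear_map complex_ring (chain_space V i) (chain_space V (i - 1)) (boundary V i)"
proof -
  have comp: "x (insert a J) \<in> carrier (V J)"
    if "x \<in> carrier (chain_space V i)" "a \<in> - J" "int (card J) = i - 1" for x a J
  proof -
    have "int (card (insert a J)) = i" using that card_insert_face by blast
    then have "x (insert a J) \<in> carrier (V (insert a J))"
      using that(1) PiE_mem by (fastforce simp: chain_space_simps)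
    moreover have "carrier (V (insert a J)) \<subseteq> carrier (V J)"
      using V unfolding nested_family_def by blast
    ultimately show ?thesis by blast
  qed
  have "(\<Oplus>\<^bsub>V J\<^esub>a\<in>-J. face_sign a J \<odot>\<^bsub>V J\<^esub> x (insert a J)) \<in> carrier (V J)"
    "(\<Oplus>\<^bsub>V J\<^esub>a\<in>-J. face_sign a J \<odot>\<^bsub>V J\<^esub> (x \<oplus>\<^bsub>chain_space V i\<^esub> y) (insert a J)) =
     (\<Oplus>\<^bsub>V J\<^esub>a\<in>-J. face_sign a J \<odot>\<^bsub>V J\<^esub> x (insert a J)) \<oplus>\<^bsub>V J\<^esub>
     (\<Oplus>\<^bsub>V J\<^esub>a\<in>-J. face_sign a J \<odot>\<^bsub>V J\<^esub> y (insert a J))"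
    "(\<Oplus>\<^bsub>V J\<^esub>a\<in>-J. face_sign a J \<odot>\<^bsub>V J\<^esub> (c \<odot>\<^bsub>chain_space V i\<^esub> x) (insert a J)) =
     c \<odot>\<^bsub>V J\<^esub> (\<Oplus>\<^bsub>V J\<^esub>a\<in>-J. face_sign a J \<odot>\<^bsub>V J\<^esub> x (insert a J))"
    if J: "int (card J) = i - 1"
      and xy: "x \<in> carrier (chain_space V i)" "y \<in> carrier (chain_space V i)" for J x y c
  proof -
    interpret J: vectorspace complex_ring "V J" using V by (simp add: nested_family_def)
    note [simp] = comp[OF xy(1) _ J] comp[OF xy(2) _ J]
    have add: "(x \<oplus>\<^bsub>chain_space V i\<^esub> y) (insert a J) = x (insert a J) \<oplus>\<^bsub>V J\<^esub> y (insert a J)"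
      and smult: "(c \<odot>\<^bsub>chain_space V i\<^esub> x) (insert a J) = c \<odot>\<^bsub>V J\<^esub> x (insert a J)" if "a \<in> -J" for a
    proof -
      have *: "int (card (insert a J)) = i" using that J card_insert_face by blast
      have "(\<oplus>\<^bsub>V (insert a J)\<^esub>) = (\<oplus>\<^bsub>V J\<^esub>)" "(\<odot>\<^bsub>V (insert a J)\<^esub>) = (\<odot>\<^bsub>V J\<^esub>)"
        using V unfolding nested_family_def by blast+
      then show "(x \<oplus>\<^bsub>chain_space V i\<^esub> y) (insert a J) = x (insert a J) \<oplus>\<^bsub>V J\<^esub> y (insert a J)"
        "(c \<odot>\<^bsub>chain_space V i\<^esub> x) (insert a J) = c \<odot>\<^bsub>V J\<^esub> x (insert a J)"
        using * by (simp_all add: chain_space_simps)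
    qed
    show "(\<Oplus>\<^bsub>V J\<^esub>a\<in>-J. face_sign a J \<odot>\<^bsub>V J\<^esub> x (insert a J)) \<in> carrier (V J)"
      by (rule J.M.finsum_closed) auto
    have "(\<Oplus>\<^bsub>V J\<^esub>a\<in>-J. face_sign a J \<odot>\<^bsub>V J\<^esub> (x \<oplus>\<^bsub>chain_space V i\<^esub> y) (insert a J)) =
     (\<Oplus>\<^bsub>V J\<^esub>a\<in>-J. face_sign a J \<odot>\<^bsub>V J\<^esub> x (insert a J) \<oplus>\<^bsub>V J\<^esub> face_sign a J \<odot>\<^bsub>V J\<^esub> y (insert a J))"
      by (intro J.M.finsum_cong') (auto simp: add J.smult_r_distr)
    also have "\<dots> = (\<Oplus>\<^bsub>V J\<^esub>a\<in>-J. face_sign a J \<odot>\<^bsub>V J\<^esub> x (insert a J)) \<oplus>\<^bsub>V J\<^esub>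
     (\<Oplus>\<^bsub>V J\<^esub>a\<in>-J. face_sign a J \<odot>\<^bsub>V J\<^esub> y (insert a J))"
      by (intro J.M.finsum_addf) auto
    finally show "(\<Oplus>\<^bsub>V J\<^esub>a\<in>-J. face_sign a J \<odot>\<^bsub>V J\<^esub> (x \<oplus>\<^bsub>chain_space V i\<^esub> y) (insert a J)) =
     (\<Oplus>\<^bsub>V J\<^esub>a\<in>-J. face_sign a J \<odot>\<^bsub>V J\<^esub> x (insert a J)) \<oplus>\<^bsub>V J\<^esub>
     (\<Oplus>\<^bsub>V J\<^esub>a\<in>-J. face_sign a J \<odot>\<^bsub>V J\<^esub> y (insert a J))" .
    have "(\<Oplus>\<^bsub>V J\<^esub>a\<in>-J. face_sign a J \<odot>\<^bsub>V J\<^esub> (c \<odot>\<^bsub>chain_space V i\<^esub> x) (insert a J)) =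
     (\<Oplus>\<^bsub>V J\<^esub>a\<in>-J. c \<odot>\<^bsub>V J\<^esub> (face_sign a J \<odot>\<^bsub>V J\<^esub> x (insert a J)))"
      by (intro J.M.finsum_cong') (auto simp: smult mult.commute simp flip: J.smult_assoc1)
    also have "\<dots> = c \<odot>\<^bsub>V J\<^esub> (\<Oplus>\<^bsub>V J\<^esub>a\<in>-J. face_sign a J \<odot>\<^bsub>V J\<^esub> x (insert a J))"
      by (intro J.finsum_smult[symmetric]) auto
    finally show "(\<Oplus>\<^bsub>V J\<^esub>a\<in>-J. face_sign a J \<odot>\<^bsub>V J\<^esub> (c \<odot>\<^bsub>chain_space V i\<^esub> x) (insert a J)) =
     c \<odot>\<^bsub>V J\<^esub> (\<Oplus>\<^bsub>V J\<^esub>a\<in>-J. face_sign a J \<odot>\<^bsub>V J\<^esub> x (insert a J))" .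
  qed
  note * = this
  show ?thesis
  proof (rule linear_mapI[OF vectorspace_chain_space[OF V] vectorspace_chain_space[OF V]])
    fix x y c assume xy: "x \<in> carrier (chain_space V i)" "y \<in> carrier (chain_space V i)"
    show "boundary V i x \<in> carrier (chain_space V (i - 1))"
      unfolding chain_space_simps(1)[of V "i - 1"]
    proof (rule PiE_I)
      show "boundary V i x J \<in> carrier (V J)" if "J \<in> {J. int (card J) = i - 1}" for J
        using *(1)[OF _ xy, of J] that by (simp add: boundary_apply)
    qed (simp add: boundary_def)
    show "boundary V i (x \<oplus>\<^bsub>chain_space V i\<^esub> y) =
        boundary V i x \<oplus>\<^bsub>chain_space V (i - 1)\<^esub> boundary V i y"
      using *(2)[OF _ xy] by (auto simp: chain_space_simps(3)[of V "i - 1"] fun_eq_iff restrict_def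
          boundary_apply) (simp add: boundary_def)
    show "boundary V i (c \<odot>\<^bsub>chain_space V i\<^esub> x) =
        c \<odot>\<^bsub>chain_space V (i - 1)\<^esub> boundary V i x"
      using *(3)[OF _ xy] by (auto simp: chain_space_simps(4)[of V "i - 1"] fun_eq_iff restrict_def
          boundary_apply) (simp add: boundary_def)
  qed
qed

text \<open>
  Removing \<open>a\<close> and \<open>b\<close> in either order: the sign of the larger of the two changes if the smaller one
  is present, and the other sign does not change.
\<close>
lemma face_sign_anticommute:
  assumes "a \<noteq> b" "a \<notin> J" "b \<notin> J"
  shows "face_sign a J * face_sign b (insert a J) = - (face_sign b J * face_sign a (insert b J))"
proof -
  have 1: "face_sign a J = - ((-1) ^ card {c \<in> J. c \<le> a})" if "a \<notin> J" for a :: 'a and J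
  proof -
    have "{c \<in> insert a J. c \<le> a} = insert a {c \<in> J. c \<le> a}" by auto
    then show ?thesis using that by (simp add: face_sign_def)
  qed
  have 2: "face_sign b (insert a J) = (if a \<le> b then - face_sign b J else face_sign b J)"
    if "a \<noteq> b" "a \<notin> J" "b \<notin> J" for a b :: 'a
  proof -
    have "{c \<in> insert a J. c \<le> b} = (if a \<le> b then insert a {c \<in> J. c \<le> b} else {c \<in> J. c \<le> b})"
      by auto
    then show ?thesis using that by (simp add: 1)
  qed
  show ?thesis using assms by (auto simp: 2)
qed

text \<open>
  The double sum over the two added elements \<open>a\<close>, \<open>b\<close> is antisymmetric, hence equal to its negative.
\<close>
lemma boundary_boundary:
  fixes R :: "(complex, 'a, 'm) module_scheme"
  assumes R: "vectorspace complex_ring R"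
    and x: "x \<in> carrier (chain_space (\<lambda>_. R) (i + 1))"
  shows "boundary (\<lambda>_. R) i (boundary (\<lambda>_. R) (i + 1) x) = \<zero>\<^bsub>chain_space (\<lambda>_. R) (i - 1)\<^esub>"
proof
  interpret R: vectorspace complex_ring R by (rule R)
  fix J :: "'b set"
  show "boundary (\<lambda>_. R) i (boundary (\<lambda>_. R) (i + 1) x) J = \<zero>\<^bsub>chain_space (\<lambda>_. R) (i - 1)\<^esub> J"
  proof (cases "int (card J) = i - 1")
    case True
    \<comment> \<open>The diagonal is filled with zeros so that both sums run over the same set \<open>- J\<close> and can be
      swapped.\<close>
    define f where "f a b = (if a = b then \<zero>\<^bsub>R\<^esub> else
      (face_sign a J * face_sign b (insert a J)) \<odot>\<^bsub>R\<^esub> x (insert b (insert a J)))" for a b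
    have xc: "x (insert b (insert a J)) \<in> carrier R" if "a \<notin> J" "b \<notin> insert a J" for a b
    proof -
      have "int (card (insert a J)) = i" using that True card_insert_face by blast
      then have "int (card (insert b (insert a J))) = i + 1" using that(2) by simp
      then show ?thesis using x PiE_mem by (fastforce simp: chain_space_simps)
    qed
    have f: "f a b \<in> carrier R" if "a \<in> -J" "b \<in> -J" for a b
      using that xc by (auto simp: f_def)
    define S where "S = (\<Oplus>\<^bsub>R\<^esub>a\<in>-J. \<Oplus>\<^bsub>R\<^esub>b\<in>-J. f a b)"
    have S: "S \<in> carrier R" unfolding S_def using f by (intro R.M.finsum_closed) auto
    have "boundary (\<lambda>_. R) i (boundary (\<lambda>_. R) (i + 1) x) J =
      (\<Oplus>\<^bsub>R\<^esub>a\<in>-J. face_sign a J \<odot>\<^bsub>R\<^esub> boundary (\<lambda>_. R) (i + 1) x (insert a J))"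
      using True by (rule boundary_apply)
    also have "\<dots> = S" unfolding S_def
    proof (intro R.M.finsum_cong' refl)
      fix a assume a: "a \<in> -J"
      have "int (card (insert a J)) = i + 1 - 1" using a True by simp
      then have "face_sign a J \<odot>\<^bsub>R\<^esub> boundary (\<lambda>_. R) (i + 1) x (insert a J) =
        face_sign a J \<odot>\<^bsub>R\<^esub> (\<Oplus>\<^bsub>R\<^esub>b\<in>-insert a J. face_sign b (insert a J) \<odot>\<^bsub>R\<^esub> x (insert b (insert a J)))"
        by (simp add: boundary_apply)
      also have "\<dots> = (\<Oplus>\<^bsub>R\<^esub>b\<in>-insert a J. face_sign a J \<odot>\<^bsub>R\<^esub>
          (face_sign b (insert a J) \<odot>\<^bsub>R\<^esub> x (insert b (insert a J))))"
        using a xc by (intro R.finsum_smult) auto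
      also have "\<dots> = (\<Oplus>\<^bsub>R\<^esub>b\<in>-J. f a b)"
      proof (rule R.M.add.finprod_mono_neutral_cong_left)
        show "face_sign a J \<odot>\<^bsub>R\<^esub> (face_sign b (insert a J) \<odot>\<^bsub>R\<^esub> x (insert b (insert a J))) = f a b"
          if "b \<in> - insert a J" for b
          using that a xc by (auto simp: f_def simp flip: R.smult_assoc1)
      qed (use f a in \<open>auto simp: f_def\<close>)
      finally show "face_sign a J \<odot>\<^bsub>R\<^esub> boundary (\<lambda>_. R) (i + 1) x (insert a J) = (\<Oplus>\<^bsub>R\<^esub>b\<in>-J. f a b)" .
    qed (use f in auto)
    also have "S = \<zero>\<^bsub>R\<^esub>"
    proof -
      have anti: "f a b \<oplus>\<^bsub>R\<^esub> f b a = \<zero>\<^bsub>R\<^esub>" if "a \<in> -J" "b \<in> -J" for a b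
      proof (cases "a = b")
        case False
        let ?s = "face_sign a J * face_sign b (insert a J)"
        let ?y = "x (insert b (insert a J))"
        have "f b a = (- ?s) \<odot>\<^bsub>R\<^esub> ?y"
          using False that face_sign_anticommute[of a b J] by (simp add: f_def insert_commute)
        then have "f a b \<oplus>\<^bsub>R\<^esub> f b a = (?s + (- ?s)) \<odot>\<^bsub>R\<^esub> ?y"
          using R.smult_l_distr[of ?s "- ?s" ?y] xc[of a b] False that by (simp add: f_def)
        then show ?thesis using xc[of a b] False that R.lmult_0 by simp
      qed (simp add: f_def)
      have "S = (\<Oplus>\<^bsub>R\<^esub>b\<in>-J. \<Oplus>\<^bsub>R\<^esub>a\<in>-J. f a b)"
        unfolding S_def using f by (intro R.M.finsum_swap) auto
      then have "S \<oplus>\<^bsub>R\<^esub> S = (\<Oplus>\<^bsub>R\<^esub>a\<in>-J. \<Oplus>\<^bsub>R\<^esub>b\<in>-J. f a b) \<oplus>\<^bsub>R\<^esub> (\<Oplus>\<^bsub>R\<^esub>a\<in>-J. \<Oplus>\<^bsub>R\<^esub>b\<in>-J. f b a)"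
        by (simp add: S_def)
      also have "\<dots> = (\<Oplus>\<^bsub>R\<^esub>a\<in>-J. (\<Oplus>\<^bsub>R\<^esub>b\<in>-J. f a b) \<oplus>\<^bsub>R\<^esub> (\<Oplus>\<^bsub>R\<^esub>b\<in>-J. f b a))"
        using f by (intro R.M.finsum_addf[symmetric]) (auto simp: Pi_def)
      also have "\<dots> = (\<Oplus>\<^bsub>R\<^esub>a\<in>-J. \<Oplus>\<^bsub>R\<^esub>b\<in>-J. f a b \<oplus>\<^bsub>R\<^esub> f b a)"
        using f by (intro R.M.finsum_cong' refl R.M.finsum_addf[symmetric]) (auto simp: Pi_def)
      also have "\<dots> = \<zero>\<^bsub>R\<^esub>" using anti by (intro R.M.finsum_all0) auto
      finally have "(1 / 2) \<odot>\<^bsub>R\<^esub> (S \<oplus>\<^bsub>R\<^esub> S) = \<zero>\<^bsub>R\<^esub>" by simp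
      then have "(1 / 2 + 1 / 2) \<odot>\<^bsub>R\<^esub> S = \<zero>\<^bsub>R\<^esub>"
        using S R.smult_l_distr[of "1 / 2" "1 / 2" S] by (simp add: R.smult_r_distr)
      then show ?thesis using S R.smult_one[of S] by simp
    qed
    finally show ?thesis using True by (simp add: chain_space_simps)
  qed (simp add: boundary_def chain_space_simps)
qed

section \<open>Lifting homology to chains with coefficients in the ring\<close>
definition subchains :: "('r::finite set \<Rightarrow> 'a set) \<Rightarrow> int \<Rightarrow> ('r set \<Rightarrow> 'a) set" where
  "subchains U i = (\<Pi>\<^sub>E I\<in>{I. int (card I) = i}. U I)"

text \<open>
  For a nested family \<open>U\<close> with smallest member \<open>U UNIV\<close>, these are the cycles and boundaries of the
  complex with the pieces \<open>U I / U UNIV\<close>, lifted to tuples of elements of \<open>R\<close>: cycles have their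
  boundary in \<open>U UNIV\<close>, and boundaries absorb all tuples with entries in \<open>U UNIV\<close>. For
  \<open>U I = F (v + e\<^sub>I)\<close> the space \<open>U UNIV\<close> is \<open>F (v + 1)\<close>.
\<close>
definition cycles ::
  "(complex, 'a, 'm) module_scheme \<Rightarrow> ('r::{finite,linorder} set \<Rightarrow> 'a set) \<Rightarrow> int \<Rightarrow> ('r set \<Rightarrow> 'a) set"
  where "cycles R U i = {x \<in> subchains U i. boundary (\<lambda>_. R) i x \<in> subchains (\<lambda>_. U UNIV) (i - 1)}"

definition boundaries ::
  "(complex, 'a, 'm) module_scheme \<Rightarrow> ('r::{finite,linorder} set \<Rightarrow> 'a set) \<Rightarrow> int \<Rightarrow> ('r set \<Rightarrow> 'a) set"
  where "boundaries R U i =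
     boundary (\<lambda>_. R) (i + 1) ` subchains U (i + 1) <+>\<^bsub>chain_space (\<lambda>_. R) i\<^esub> subchains (\<lambda>_. U UNIV) i"

lemma subchains_mem: "x \<in> subchains U i \<Longrightarrow> int (card I) = i \<Longrightarrow> x I \<in> U I"
  by (auto simp: subchains_def PiE_mem)

lemma subchains_mono: "(\<And>I. int (card I) = i \<Longrightarrow> U I \<subseteq> W I) \<Longrightarrow> subchains U i \<subseteq> subchains W i"
  unfolding subchains_def by (rule PiE_mono) auto

lemma subchains_Int: "subchains U i \<inter> subchains W i = subchains (\<lambda>I. U I \<inter> W I) i"
  by (auto simp: subchains_def PiE_iff)

lemma subspace_subchains:
  fixes R :: "(complex, 'a, 'm) module_scheme" and U :: "'r::{finite,linorder} set \<Rightarrow> 'a set"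
  assumes R: "vectorspace complex_ring R" and U: "\<And>I. subspace complex_ring (U I) R"
  shows "subspace complex_ring (subchains U i) (chain_space (\<lambda>_. R) i)"
proof -
  interpret R: vectorspace complex_ring R by (rule R)
  interpret C: vectorspace complex_ring "chain_space (\<lambda>_ :: 'r set. R) i"
    by (intro vectorspace_chain_space nested_family_const R)
  show ?thesis
    by (rule C.subspaceI)
      (auto simp: chain_space_simps subchains_def PiE_mem
        intro!: R.subspace_carrier[OF U] R.subspace_zero[OF U] R.subspace_add[OF U]
          R.subspace_smult[OF U] dest: PiE_mem)
qed

locale nested_subspaces = vectorspace complex_ring R
  for R :: "(complex, 'a, 'm) module_scheme" +
  fixes U :: "'r::{finite,linorder} set \<Rightarrow> 'a set"
  assumes U: "subspace complex_ring (U I) R"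
    and antimono: "J \<subseteq> I \<Longrightarrow> U I \<subseteq> U J"
begin

abbreviation "D \<equiv> boundary (\<lambda>_ :: 'r set. R)"
abbreviation "E \<equiv> chain_space (\<lambda>_ :: 'r set. R)"
abbreviation "N \<equiv> U UNIV"
abbreviation "G I \<equiv> quotient_space (R\<lparr>carrier := U I\<rparr>) N"

lemma D_linear: "linear_map complex_ring (E i) (E (i - 1)) (D i)"
  by (intro linear_map_boundary nested_family_const vectorspace_axioms)

lemma E_vectorspace: "vectorspace complex_ring (E i)"
  by (intro vectorspace_chain_space nested_family_const vectorspace_axioms)

lemma subchains_U: "subspace complex_ring (subchains U i) (E i)"
  by (intro subspace_subchains vectorspace_axioms U)

lemma subchains_N: "subspace complex_ring (subchains (\<lambda>_. N) i) (E i)"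
  by (intro subspace_subchains vectorspace_axioms U)

lemma subchains_N_subset: "subchains (\<lambda>_. N) i \<subseteq> subchains U i"
  by (intro subchains_mono antimono) auto

lemma boundary_subchains:
  assumes "x \<in> subchains U i"
  shows "D i x \<in> subchains U (i - 1)"
  unfolding subchains_def
proof (rule PiE_I)
  fix J :: "'r set" assume J: "J \<in> {J. int (card J) = i - 1}"
  have "x (insert a J) \<in> U J" if "a \<in> -J" for a
  proof -
    have "x (insert a J) \<in> U (insert a J)"
      using assms that J by (intro subchains_mem) auto
    then show ?thesis using antimono[of J "insert a J"] by auto
  qed
  then show "D i x J \<in> U J"
    using J by (auto simp: boundary_apply intro!: subspace_finsum[OF U] subspace_smult[OF U])
qed (simp add: boundary_def)

lemma N_subspace: "subspace complex_ring N (vs (U I))"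
  using subspace_of_vs_iff[OF U] U antimono by auto

lemma coset_vs: "N +>\<^bsub>vs (U I)\<^esub> x = N +>\<^bsub>R\<^esub> x"
  by (simp add: a_r_coset_def')

lemma linear_map_coset: "linear_map complex_ring (vs (U I)) (G I) (\<lambda>x. N +>\<^bsub>R\<^esub> x)"
proof -
  interpret I: vectorspace complex_ring "vs (U I)" using U by (rule subspace_is_vs)
  show ?thesis using I.linear_map_quotient[OF N_subspace] by (simp add: coset_vs)
qed

lemma carrier_G: "carrier (G I) = (\<lambda>x. N +>\<^bsub>R\<^esub> x) ` U I"
proof -
  interpret I: vectorspace complex_ring "vs (U I)" using U by (rule subspace_is_vs)
  show ?thesis using I.quotient_carrier[OF N_subspace] by (simp add: coset_vs)
qed

lemma zero_G: "\<zero>\<^bsub>G I\<^esub> = N"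
  by (simp add: quotient_space_def)

lemma nested_family_G: "nested_family G"
proof -
  have "vectorspace complex_ring (G I)" for I
    using linear_map_coset[of I] by (simp add: linear_map_def)
  moreover have "carrier (G I) \<subseteq> carrier (G J)" if "J \<subseteq> I" for I J
    using antimono[OF that] by (auto simp: carrier_G)
  moreover have "(\<oplus>\<^bsub>G I\<^esub>) = (\<oplus>\<^bsub>G J\<^esub>)" "(\<odot>\<^bsub>G I\<^esub>) = (\<odot>\<^bsub>G J\<^esub>)" for I J
    by (auto simp: quotient_space_def fun_eq_iff set_add_def' a_r_coset_def')
  ultimately show ?thesis by (simp add: nested_family_def)
qed

definition proj :: "int \<Rightarrow> ('r set \<Rightarrow> 'a) \<Rightarrow> 'r set \<Rightarrow> 'a set" where
  "proj i x = (\<lambda>I\<in>{I. int (card I) = i}. N +>\<^bsub>R\<^esub> x I)"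

lemma linear_map_proj:
  "linear_map complex_ring ((E i)\<lparr>carrier := subchains U i\<rparr>) (chain_space G i) (proj i)"
proof (rule linear_mapI)
  interpret E: vectorspace complex_ring "E i" by (rule E_vectorspace)
  show "vectorspace complex_ring ((E i)\<lparr>carrier := subchains U i\<rparr>)"
    by (rule E.subspace_is_vs[OF subchains_U])
  show "vectorspace complex_ring (chain_space G i)"
    by (rule vectorspace_chain_space[OF nested_family_G])
  show "proj i x \<in> carrier (chain_space G i)"
    if "x \<in> carrier ((E i)\<lparr>carrier := subchains U i\<rparr>)" for x
    using that by (auto simp: proj_def chain_space_simps carrier_G intro: subchains_mem)
  have add: "N +>\<^bsub>R\<^esub> (x \<oplus>\<^bsub>R\<^esub> y) = (N +>\<^bsub>R\<^esub> x) \<oplus>\<^bsub>G I\<^esub> (N +>\<^bsub>R\<^esub> y)"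
    and smult: "N +>\<^bsub>R\<^esub> (c \<odot>\<^bsub>R\<^esub> x) = c \<odot>\<^bsub>G I\<^esub> (N +>\<^bsub>R\<^esub> x)" if "x \<in> U I" "y \<in> U I" for x y c I
  proof -
    interpret I: linear_map complex_ring "vs (U I)" "G I" "\<lambda>x. N +>\<^bsub>R\<^esub> x" by (rule linear_map_coset)
    show "N +>\<^bsub>R\<^esub> (x \<oplus>\<^bsub>R\<^esub> y) = (N +>\<^bsub>R\<^esub> x) \<oplus>\<^bsub>G I\<^esub> (N +>\<^bsub>R\<^esub> y)"
      "N +>\<^bsub>R\<^esub> (c \<odot>\<^bsub>R\<^esub> x) = c \<odot>\<^bsub>G I\<^esub> (N +>\<^bsub>R\<^esub> x)"
      using I.T_add[of x y] I.T_smult[of c x] that by simp_all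
  qed
  show "proj i (x \<oplus>\<^bsub>(E i)\<lparr>carrier := subchains U i\<rparr>\<^esub> y) = proj i x \<oplus>\<^bsub>chain_space G i\<^esub> proj i y"
    if "x \<in> carrier ((E i)\<lparr>carrier := subchains U i\<rparr>)" "y \<in> carrier ((E i)\<lparr>carrier := subchains U i\<rparr>)" for x y
  proof -
    have *: "x I \<in> U I" "y I \<in> U I" if "int (card I) = i" for I
      using \<open>x \<in> carrier _\<close> \<open>y \<in> carrier _\<close> that by (auto intro: subchains_mem)
    show ?thesis
      unfolding proj_def chain_space_simps(3)[where V = G]
      by (rule restrict_ext) (simp add: chain_space_simps add[OF *])
  qed
  show "proj i (c \<odot>\<^bsub>(E i)\<lparr>carrier := subchains U i\<rparr>\<^esub> x) = c \<odot>\<^bsub>chain_space G i\<^esub> proj i x"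
    if "x \<in> carrier ((E i)\<lparr>carrier := subchains U i\<rparr>)" for c x
  proof -
    have *: "x I \<in> U I" if "int (card I) = i" for I
      using \<open>x \<in> carrier _\<close> that by (auto intro: subchains_mem)
    show ?thesis
      unfolding proj_def chain_space_simps(4)[where V = G]
      by (rule restrict_ext) (simp add: chain_space_simps smult[OF * *])
  qed
qed

lemma proj_surj: "proj i ` subchains U i = carrier (chain_space G i)"
proof -
  interpret p: linear_map complex_ring "(E i)\<lparr>carrier := subchains U i\<rparr>" "chain_space G i" "proj i"
    by (rule linear_map_proj)
  have "y \<in> proj i ` subchains U i" if y: "y \<in> carrier (chain_space G i)" for y
  proof -
    have "\<exists>x\<in>U I. N +>\<^bsub>R\<^esub> x = y I" if "int (card I) = i" for I
    proof -
      have "y I \<in> carrier (G I)"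
        using y that by (auto simp: chain_space_simps intro: PiE_mem)
      then show ?thesis unfolding carrier_G by blast
    qed
    then obtain x where x: "\<And>I. int (card I) = i \<Longrightarrow> x I \<in> U I \<and> N +>\<^bsub>R\<^esub> x I = y I" by metis
    let ?x = "restrict x {I. int (card I) = i}"
    have "?x \<in> subchains U i" using x by (auto simp: subchains_def)
    moreover have "proj i ?x = y"
    proof (rule PiE_ext)
      show "y \<in> Pi\<^sub>E {I. int (card I) = i} (\<lambda>I. carrier (G I))"
        using y by (simp add: chain_space_simps)
      show "proj i ?x \<in> Pi\<^sub>E {I. int (card I) = i} (\<lambda>I. carrier (G I))"
        using p.T_im[of ?x] calculation by (simp add: chain_space_simps)
    qed (use x in \<open>simp add: proj_def\<close>)
    ultimately show ?thesis by blast
  qed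
  then show ?thesis using p.T_im by auto
qed

lemma proj_eq_zero_iff:
  assumes "x \<in> subchains U i"
  shows "proj i x = \<zero>\<^bsub>chain_space G i\<^esub> \<longleftrightarrow> x \<in> subchains (\<lambda>_. N) i"
proof -
  have "N +>\<^bsub>R\<^esub> x I = N \<longleftrightarrow> x I \<in> N" if "int (card I) = i" for I
    using coset_eq_zero_iff[OF U] subspace_carrier[OF U] subchains_mem[OF assms that] by blast
  moreover have "x \<in> extensional {I. int (card I) = i}"
    using assms by (auto simp: subchains_def PiE_def)
  moreover have "proj i x = \<zero>\<^bsub>chain_space G i\<^esub> \<longleftrightarrow> (\<forall>I. int (card I) = i \<longrightarrow> N +>\<^bsub>R\<^esub> x I = N)"
    unfolding proj_def chain_space_simps zero_G
    by (auto simp: fun_eq_iff restrict_def)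
  ultimately show ?thesis
    by (auto simp: subchains_def PiE_iff)
qed

text \<open>
  Each \<open>G J\<close> receives a linear map from \<open>U J\<close>, and a linear map commutes with the finite sum that
  defines the boundary.
\<close>
lemma boundary_proj:
  assumes "x \<in> subchains U i"
  shows "boundary G i (proj i x) = proj (i - 1) (D i x)"
proof
  fix J
  show "boundary G i (proj i x) J = proj (i - 1) (D i x) J"
  proof (cases "int (card J) = i - 1")
    case True
    interpret J: linear_map complex_ring "vs (U J)" "G J" "\<lambda>x. N +>\<^bsub>R\<^esub> x" by (rule linear_map_coset)
    have x: "x (insert a J) \<in> U J" and p: "proj i x (insert a J) = N +>\<^bsub>R\<^esub> x (insert a J)"
      if "a \<in> -J" for a
    proof -
      have c: "int (card (insert a J)) = i" using that True by simp
      have "x (insert a J) \<in> U (insert a J)"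
        using assms c by (rule subchains_mem)
      then show "x (insert a J) \<in> U J" using antimono[of J "insert a J"] by auto
      show "proj i x (insert a J) = N +>\<^bsub>R\<^esub> x (insert a J)" using c by (simp add: proj_def)
    qed
    have mem: "(\<lambda>a. face_sign a J \<odot>\<^bsub>R\<^esub> x (insert a J)) \<in> -J \<rightarrow> U J"
      using x by (auto intro: subspace_smult[OF U])
    have "boundary G i (proj i x) J = (\<Oplus>\<^bsub>G J\<^esub>a\<in>-J. face_sign a J \<odot>\<^bsub>G J\<^esub> proj i x (insert a J))"
      by (rule boundary_apply[OF True])
    also have "\<dots> = (\<Oplus>\<^bsub>G J\<^esub>a\<in>-J. N +>\<^bsub>R\<^esub> (face_sign a J \<odot>\<^bsub>R\<^esub> x (insert a J)))"
    proof (intro J.W.module.M.finsum_cong' refl)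
      fix a assume "a \<in> -J"
      then show "face_sign a J \<odot>\<^bsub>G J\<^esub> proj i x (insert a J) =
          N +>\<^bsub>R\<^esub> (face_sign a J \<odot>\<^bsub>R\<^esub> x (insert a J))"
        using J.T_smult[of "face_sign a J" "x (insert a J)"] x[of a] p[of a] by simp
    qed (use mem in \<open>auto simp: carrier_G\<close>)
    also have "\<dots> = N +>\<^bsub>R\<^esub> finsum (vs (U J)) (\<lambda>a. face_sign a J \<odot>\<^bsub>R\<^esub> x (insert a J)) (-J)"
      using mem by (intro J.T_finsum[symmetric]) simp
    also have "\<dots> = N +>\<^bsub>R\<^esub> D i x J"
      using mem by (simp add: finsum_vs[OF U] boundary_apply[OF True])
    finally show ?thesis using True by (simp add: proj_def)
  qed (simp add: boundary_def proj_def)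
qed

lemma D_linear_Suc: "linear_map complex_ring (E (i + 1)) (E i) (D (i + 1))"
  using D_linear[of "i + 1"] by simp

lemma boundary_boundary_subchains:
  assumes "y \<in> subchains U (i + 1)"
  shows "D i (D (i + 1) y) \<in> subchains (\<lambda>_. N) (i - 1)"
proof -
  have "y \<in> carrier (E (i + 1))"
    by (rule vectorspace.subspace_carrier[OF E_vectorspace subchains_U assms])
  then show ?thesis
    using boundary_boundary[OF vectorspace_axioms, of y i]
      vectorspace.subspace_zero[OF E_vectorspace subchains_N] by simp
qed

lemma subspace_cycles: "subspace complex_ring (cycles R U i) (E i)"
  unfolding cycles_def by (rule linear_map.subspace_vimage[OF D_linear subchains_U subchains_N])

lemma subspace_boundaries: "subspace complex_ring (boundaries R U i) (E i)"
  unfolding boundaries_def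
  by (rule vectorspace.subspace_set_add[OF E_vectorspace
        linear_map.subspace_image[OF D_linear_Suc subchains_U] subchains_N])

lemma boundaries_subset_cycles: "boundaries R U i \<subseteq> cycles R U i"
  unfolding boundaries_def
proof (rule vectorspace.set_add_least[OF E_vectorspace subspace_cycles])
  show "D (i + 1) ` subchains U (i + 1) \<subseteq> cycles R U i"
  proof
    fix w assume "w \<in> D (i + 1) ` subchains U (i + 1)"
    then obtain y where y: "w = D (i + 1) y" "y \<in> subchains U (i + 1)" by (rule imageE)
    have "D (i + 1) y \<in> subchains U i" using boundary_subchains[OF y(2)] by simp
    then show "w \<in> cycles R U i"
      unfolding cycles_def y(1) by (intro CollectI conjI boundary_boundary_subchains[OF y(2)])
  qed
  interpret N: nested_subspaces R "\<lambda>_. N"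
    by (intro nested_subspaces.intro nested_subspaces_axioms.intro vectorspace_axioms U order_refl)
  show "subchains (\<lambda>_. N) i \<subseteq> cycles R U i"
    unfolding cycles_def using subchains_N_subset N.boundary_subchains by blast
qed

lemma boundary_image_eq:
  "boundary G (i + 1) ` carrier (chain_space G (i + 1)) =
     (\<lambda>y. proj i (D (i + 1) y)) ` subchains U (i + 1)"
  using boundary_proj[of _ "i + 1"] by (auto simp: image_image simp flip: proj_surj)

lemma subspace_kernel:
  "subspace complex_ring (a_kernel (chain_space G i) (chain_space G (i - 1)) (boundary G i)) (chain_space G i)"
proof -
  interpret linear_map complex_ring "chain_space G i" "chain_space G (i - 1)" "boundary G i"
    by (rule linear_map_boundary[OF nested_family_G])
  show ?thesis using kerT_is_subspace by (simp add: a_kernel_def' ker_def)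
qed

lemma subspace_boundary_image:
  "subspace complex_ring (boundary G (i + 1) ` carrier (chain_space G (i + 1))) (chain_space G i)"
proof -
  have "linear_map complex_ring (chain_space G (i + 1)) (chain_space G i) (boundary G (i + 1))"
    using linear_map_boundary[OF nested_family_G, of "i + 1"] by simp
  then interpret linear_map complex_ring "chain_space G (i + 1)" "chain_space G i" "boundary G (i + 1)" .
  show ?thesis using imT_is_subspace by (simp add: im_def)
qed

lemma boundary_image_subset_kernel:
  "boundary G (i + 1) ` carrier (chain_space G (i + 1)) \<subseteq>
     a_kernel (chain_space G i) (chain_space G (i - 1)) (boundary G i)"
proof
  interpret p: linear_map complex_ring "(E i)\<lparr>carrier := subchains U i\<rparr>" "chain_space G i" "proj i"
    by (rule linear_map_proj)
  fix b assume "b \<in> boundary G (i + 1) ` carrier (chain_space G (i + 1))"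
  then obtain y where y: "y \<in> subchains U (i + 1)" "b = proj i (D (i + 1) y)"
    unfolding boundary_image_eq by (rule imageE)
  have dch: "D (i + 1) y \<in> subchains U i"
    using boundary_subchains[OF y(1)] by simp
  have "boundary G i b = proj (i - 1) (D i (D (i + 1) y))"
    using boundary_proj[OF dch] y(2) by simp
  also have "\<dots> = \<zero>\<^bsub>chain_space G (i - 1)\<^esub>"
    using proj_eq_zero_iff[of "D i (D (i + 1) y)" "i - 1"] boundary_boundary_subchains[OF y(1)]
      subchains_N_subset by blast
  moreover have "b \<in> carrier (chain_space G i)"
    using p.T_im[of "D (i + 1) y"] dch y(2) by simp
  ultimately show "b \<in> a_kernel (chain_space G i) (chain_space G (i - 1)) (boundary G i)"
    by (simp add: a_kernel_def')
qed

lemma vectorspace_homology: "vectorspace complex_ring (homology_space G i)"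
proof -
  interpret C: vectorspace complex_ring "chain_space G i"
    by (rule vectorspace_chain_space[OF nested_family_G])
  have "subspace complex_ring (boundary G (i + 1) ` carrier (chain_space G (i + 1)))
      (C.vs (a_kernel (chain_space G i) (chain_space G (i - 1)) (boundary G i)))"
    using C.subspace_of_vs_iff[OF subspace_kernel] subspace_boundary_image boundary_image_subset_kernel
    by blast
  then show ?thesis
    unfolding homology_space_def
    by (rule vectorspace.vectorspace_quotient[OF C.subspace_is_vs[OF subspace_kernel]])
qed

text \<open>
  The projection of chains onto tuples of cosets is surjective, has the chains with entries in \<open>N\<close> as
  its kernel and commutes with the boundary maps, so it maps lifted cycles and boundaries onto those of
  the graded complex.
\<close>
theorem homology_has_dim_iff:
  "has_dim complex_ring (homology_space G i) n \<longleftrightarrow>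
     has_codim complex_ring (E i) (cycles R U i) (boundaries R U i) n"
proof -
  interpret E: vectorspace complex_ring "E i" by (rule E_vectorspace)
  interpret C: vectorspace complex_ring "chain_space G i"
    by (rule vectorspace_chain_space[OF nested_family_G])
  interpret p: linear_map complex_ring "(E i)\<lparr>carrier := subchains U i\<rparr>" "chain_space G i" "proj i"
    by (rule linear_map_proj)
  define Z where "Z = a_kernel (chain_space G i) (chain_space G (i - 1)) (boundary G i)"
  define B where "B = boundary G (i + 1) ` carrier (chain_space G (i + 1))"
  have Z: "subspace complex_ring Z (chain_space G i)" and B: "subspace complex_ring B (chain_space G i)"
    and BZ: "B \<subseteq> Z"
    unfolding Z_def B_def
    by (rule subspace_kernel subspace_boundary_image boundary_image_subset_kernel)+
  have dch: "D (i + 1) y \<in> subchains U i" if "y \<in> subchains U (i + 1)" for y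
    using boundary_subchains[OF that] by simp
  have B_eq: "B = (\<lambda>y. proj i (D (i + 1) y)) ` subchains U (i + 1)"
    unfolding B_def by (rule boundary_image_eq)
  have ch: "subchains U i \<subseteq> carrier (E i)" using E.subspace_subset[OF subchains_U] .
  note cyc = subspace_cycles[of i]
  have Z_iff: "proj i x \<in> Z \<longleftrightarrow> D i x \<in> subchains (\<lambda>_. N) (i - 1)" if "x \<in> subchains U i" for x
    using that boundary_proj[OF that] proj_eq_zero_iff[OF boundary_subchains[OF that]] p.T_im[of x]
    by (simp add: Z_def a_kernel_def')
  note bnd_sub = boundaries_subset_cycles[of i]
  have "has_codim complex_ring (E i) (cycles R U i) (boundaries R U i) n \<longleftrightarrow>
      has_codim complex_ring (chain_space G i) Z B n"
  proof (rule has_codim_map[OF E.vectorspace_axioms C.vectorspace_axioms cyc Z B BZ bnd_sub])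
    have "subspace complex_ring (cycles R U i) (E.vs (subchains U i))"
      using E.subspace_of_vs_iff[OF subchains_U] cyc by (auto simp: cycles_def)
    from p.linear_map_restrict[OF this C.subspace_self]
    show "linear_map complex_ring ((E i)\<lparr>carrier := cycles R U i\<rparr>) (chain_space G i) (proj i)"
      using p.T_im by (auto simp: cycles_def image_subset_iff)
    show "proj i z \<in> Z" if "z \<in> cycles R U i" for z
      using that Z_iff by (simp add: cycles_def)
    show "\<exists>z\<in>cycles R U i. \<exists>b\<in>B. z' = proj i z \<oplus>\<^bsub>chain_space G i\<^esub> b" if z': "z' \<in> Z" for z'
    proof -
      have "z' \<in> carrier (chain_space G i)" using z' by (rule C.subspace_carrier[OF Z])
      then obtain x where x: "x \<in> subchains U i" "z' = proj i x" using proj_surj by blast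
      then have "x \<in> cycles R U i" using z' Z_iff by (simp add: cycles_def)
      moreover have "z' = proj i x \<oplus>\<^bsub>chain_space G i\<^esub> \<zero>\<^bsub>chain_space G i\<^esub>"
        using x p.T_im[of x] by simp
      ultimately show ?thesis using C.subspace_zero[OF B] by blast
    qed
    show "proj i z \<in> B \<longleftrightarrow> z \<in> boundaries R U i" if z: "z \<in> cycles R U i" for z
    proof
      have zc: "z \<in> subchains U i" using z by (simp add: cycles_def)
      assume "proj i z \<in> B"
      then obtain y where y: "y \<in> subchains U (i + 1)" "proj i z = proj i (D (i + 1) y)"
        by (auto simp: B_eq)
      let ?w = "z \<ominus>\<^bsub>E i\<^esub> D (i + 1) y"
      have w: "?w \<in> subchains U i" using E.subspace_minus[OF subchains_U zc dch[OF y(1)]] .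
      have z_eq: "z = D (i + 1) y \<oplus>\<^bsub>E i\<^esub> ?w"
      proof -
        have mem: "z \<in> carrier (E i)" "D (i + 1) y \<in> carrier (E i)" "?w \<in> carrier (E i)"
          by (rule subsetD[OF ch], fact zc dch[OF y(1)] w)+
        have "z = ?w \<oplus>\<^bsub>E i\<^esub> D (i + 1) y"
          by (rule E.minus_add_cancel[symmetric, OF mem(1,2)])
        also have "\<dots> = D (i + 1) y \<oplus>\<^bsub>E i\<^esub> ?w"
          by (rule E.M.a_comm[OF mem(3,2)])
        finally show ?thesis .
      qed
      have "proj i z = proj i (D (i + 1) y) \<oplus>\<^bsub>chain_space G i\<^esub> proj i ?w"
        using p.T_add[of "D (i + 1) y" ?w] w dch[OF y(1)] z_eq by simp
      then have "proj i ?w = \<zero>\<^bsub>chain_space G i\<^esub>"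
      proof -
        have mem: "proj i z \<in> carrier (chain_space G i)" "proj i ?w \<in> carrier (chain_space G i)"
          using p.T_im[of ?w] p.T_im[of z] w zc by simp_all
        have "proj i z = proj i z \<oplus>\<^bsub>chain_space G i\<^esub> proj i ?w"
          using \<open>proj i z = _ \<oplus>\<^bsub>chain_space G i\<^esub> _\<close> unfolding y(2)[symmetric] .
        also have "\<dots> = proj i ?w \<oplus>\<^bsub>chain_space G i\<^esub> proj i z"
          by (rule C.M.a_comm[OF mem])
        finally have eq: "proj i ?w \<oplus>\<^bsub>chain_space G i\<^esub> proj i z = proj i z" by (rule sym)
        have "proj i ?w = (proj i ?w \<oplus>\<^bsub>chain_space G i\<^esub> proj i z) \<ominus>\<^bsub>chain_space G i\<^esub> proj i z"
          by (rule C.add_minus_cancel[symmetric, OF mem(2,1)])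
        also have "\<dots> = (\<zero>\<^bsub>chain_space G i\<^esub> \<oplus>\<^bsub>chain_space G i\<^esub> proj i z) \<ominus>\<^bsub>chain_space G i\<^esub> proj i z"
          by (simp only: eq C.M.l_zero[OF mem(1)])
        also have "\<dots> = \<zero>\<^bsub>chain_space G i\<^esub>"
          by (rule C.add_minus_cancel[OF C.M.zero_closed mem(1)])
        finally show ?thesis .
      qed
      then have "?w \<in> subchains (\<lambda>_. N) i" using proj_eq_zero_iff[OF w] by simp
      then show "z \<in> boundaries R U i"
        using z_eq y(1) unfolding boundaries_def E.mem_set_add by blast
    next
      assume "z \<in> boundaries R U i"
      then obtain y w where yw: "y \<in> subchains U (i + 1)" "w \<in> subchains (\<lambda>_. N) i"
        "z = D (i + 1) y \<oplus>\<^bsub>E i\<^esub> w"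
        by (auto simp: boundaries_def E.mem_set_add)
      have w: "w \<in> subchains U i" using yw subchains_N_subset by blast
      have "proj i z = proj i (D (i + 1) y) \<oplus>\<^bsub>chain_space G i\<^esub> proj i w"
        using p.T_add[of "D (i + 1) y" w] w dch[OF yw(1)] yw(3) by simp
      also have "proj i w = \<zero>\<^bsub>chain_space G i\<^esub>" using proj_eq_zero_iff[OF w] yw by simp
      finally have "proj i z = proj i (D (i + 1) y)"
        using p.T_im[of "D (i + 1) y"] dch[OF yw(1)] by simp
      then show "proj i z \<in> B" using yw(1) by (auto simp: B_eq)
    qed
  qed
  also have "\<dots> \<longleftrightarrow> has_dim complex_ring (homology_space G i) n"
    using Z B BZ by (simp add: has_codim_def homology_space_def Z_def B_def)
  finally show ?thesis by simp
qed

end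

section \<open>Additivity of the Euler characteristic\<close>
lemma subchains_set_add:
  fixes R :: "(complex, 'a, 'm) module_scheme" and U W :: "'r::{finite,linorder} set \<Rightarrow> 'a set"
  shows "subchains (\<lambda>I. U I <+>\<^bsub>R\<^esub> W I) i = subchains U i <+>\<^bsub>chain_space (\<lambda>_. R) i\<^esub> subchains W i"
proof
  show "subchains (\<lambda>I. U I <+>\<^bsub>R\<^esub> W I) i \<subseteq> subchains U i <+>\<^bsub>chain_space (\<lambda>_. R) i\<^esub> subchains W i"
  proof
    fix x assume x: "x \<in> subchains (\<lambda>I. U I <+>\<^bsub>R\<^esub> W I) i"
    have "\<exists>u w. u \<in> U I \<and> w \<in> W I \<and> x I = u \<oplus>\<^bsub>R\<^esub> w" if "int (card I) = i" for I
      using subchains_mem[OF x that] by (auto simp: set_add_def')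
    then obtain u w where uw: "\<And>I. int (card I) = i \<Longrightarrow> u I \<in> U I \<and> w I \<in> W I \<and> x I = u I \<oplus>\<^bsub>R\<^esub> w I"
      by metis
    let ?S = "{I :: 'r set. int (card I) = i}"
    have "restrict u ?S \<in> subchains U i" "restrict w ?S \<in> subchains W i"
      using uw by (auto simp: subchains_def)
    moreover have "x = restrict u ?S \<oplus>\<^bsub>chain_space (\<lambda>_. R) i\<^esub> restrict w ?S"
    proof
      fix I show "x I = (restrict u ?S \<oplus>\<^bsub>chain_space (\<lambda>_. R) i\<^esub> restrict w ?S) I"
        using uw x by (cases "I \<in> ?S") (auto simp: chain_space_simps subchains_def PiE_def extensional_def)
    qed
    ultimately show "x \<in> subchains U i <+>\<^bsub>chain_space (\<lambda>_. R) i\<^esub> subchains W i"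
      unfolding set_add_def' by blast
  qed
  show "subchains U i <+>\<^bsub>chain_space (\<lambda>_. R) i\<^esub> subchains W i \<subseteq> subchains (\<lambda>I. U I <+>\<^bsub>R\<^esub> W I) i"
  proof
    fix x assume "x \<in> subchains U i <+>\<^bsub>chain_space (\<lambda>_. R) i\<^esub> subchains W i"
    then obtain u w where uw: "u \<in> subchains U i" "w \<in> subchains W i"
      "x = u \<oplus>\<^bsub>chain_space (\<lambda>_. R) i\<^esub> w" unfolding set_add_def' by blast
    have "u I \<oplus>\<^bsub>R\<^esub> w I \<in> U I <+>\<^bsub>R\<^esub> W I" if "int (card I) = i" for I
      using subchains_mem[OF uw(1) that] subchains_mem[OF uw(2) that] by (auto simp: set_add_def')
    then show "x \<in> subchains (\<lambda>I. U I <+>\<^bsub>R\<^esub> W I) i"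
      by (auto simp: uw(3) chain_space_simps subchains_def)
  qed
qed

lemma alternating_telescope:
  fixes k :: "int \<Rightarrow> int"
  shows "(\<Sum>i<n. (-1) ^ i * (k (int i) + k (int i - 1))) = k (-1) - (-1) ^ n * k (int n - 1)"
  by (induction n) (auto simp: algebra_simps)

context nested_subspaces begin

text \<open>
  Homology vanishes outside the degrees \<open>0, \<dots>, r - 1\<close>: below 0 and above \<open>r\<close> there are no index
  sets, and in degree \<open>r\<close> the only index set is \<open>UNIV\<close>, for which the piece \<open>U UNIV / U UNIV\<close> is zero.
\<close>
lemma cycles_subset_boundaries:
  assumes "i < 0 \<or> int CARD('r) \<le> i"
  shows "cycles R U i \<subseteq> boundaries R U i"
proof -
  have *: "I = UNIV" if "int (card I) = i" for I :: "'r set"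
  proof (rule card_subset_eq)
    have "card I \<le> CARD('r)" by (rule card_mono) auto
    then show "card I = CARD('r)" using assms that by auto
  qed auto
  have "subchains U i \<subseteq> subchains (\<lambda>_. N) i"
  proof (rule subchains_mono)
    show "U I \<subseteq> N" if "int (card I) = i" for I using *[OF that] by simp
  qed
  moreover have "subchains (\<lambda>_. N) i \<subseteq> boundaries R U i"
  proof -
    interpret E: vectorspace complex_ring "E i" by (rule E_vectorspace)
    have "linear_map complex_ring (E (i + 1)) (E i) (D (i + 1))" using D_linear[of "i + 1"] by simp
    then have "subspace complex_ring (D (i + 1) ` subchains U (i + 1)) (E i)"
      by (rule linear_map.subspace_image[OF _ subchains_U])
    then show ?thesis unfolding boundaries_def by (rule E.set_add_upper2[OF _ subchains_N])
  qed
  ultimately show ?thesis by (auto simp: cycles_def)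
qed

text \<open>
  The three complexes belong to the families \<open>U I \<inter> J\<close>, \<open>U I\<close> and \<open>U I + J\<close>. The numbers \<open>k i\<close> of
  \<open>euler_step\<close> vanish for \<open>i = -1\<close> and \<open>i = r - 1\<close>, as is seen from its relation in degrees \<open>-1\<close> and
  \<open>r\<close>, where the first and the third homology are zero.
\<close>
theorem euler_characteristic_additive:
  fixes a b c :: "int \<Rightarrow> nat"
  assumes J: "subspace complex_ring J R"
    and a: "\<And>i. has_codim complex_ring (E i) (cycles R (\<lambda>I. U I \<inter> J) i) (boundaries R (\<lambda>I. U I \<inter> J) i) (a i)"
    and b: "\<And>i. has_codim complex_ring (E i) (cycles R U i) (boundaries R U i) (b i)"
    and c: "\<And>i. has_codim complex_ring (E i) (cycles R (\<lambda>I. U I <+>\<^bsub>R\<^esub> J) i)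
      (boundaries R (\<lambda>I. U I <+>\<^bsub>R\<^esub> J) i) (c i)"
  shows "(\<Sum>i<CARD('r). (-1) ^ i * int (b (int i))) =
    (\<Sum>i<CARD('r). (-1) ^ i * int (a (int i))) + (\<Sum>i<CARD('r). (-1) ^ i * int (c (int i)))"
proof -
  interpret A: nested_subspaces R "\<lambda>I. U I \<inter> J"
    using antimono by (intro nested_subspaces.intro nested_subspaces_axioms.intro vectorspace_axioms
      subspace_Int U J Int_mono order_refl)
  interpret C: nested_subspaces R "\<lambda>I. U I <+>\<^bsub>R\<^esub> J"
    using antimono by (intro nested_subspaces.intro nested_subspaces_axioms.intro vectorspace_axioms
      subspace_set_add U J set_add_mono order_refl)
  interpret JJ: nested_subspaces R "\<lambda>_ :: 'r set. J"
    by (intro nested_subspaces.intro nested_subspaces_axioms.intro vectorspace_axioms J order_refl)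
  interpret NN: nested_subspaces R "\<lambda>_ :: 'r set. N"
    by (intro nested_subspaces.intro nested_subspaces_axioms.intro vectorspace_axioms U order_refl)
  define P where "P i = has_codim complex_ring (E i)
    (subchains (\<lambda>_. J) i \<inter> (D (i + 1) ` subchains U (i + 1) <+>\<^bsub>E i\<^esub> subchains (\<lambda>_. N) i))
    (D (i + 1) ` (subchains U (i + 1) \<inter> subchains (\<lambda>_. J) (i + 1)) <+>\<^bsub>E i\<^esub>
      (subchains (\<lambda>_. N) i \<inter> subchains (\<lambda>_. J) i))" for i
  have "\<exists>k k'. P i k \<and> P (i - 1) k' \<and> a i + c i = b i + k + k'" for i
  proof -
    have D': "linear_map complex_ring (E (i + 1)) (E i) (D (i + 1))"
      using D_linear[of "i + 1"] by simp
    obtain k k' where "has_codim complex_ring (E i)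
      (subchains (\<lambda>_. J) i \<inter> (D (i + 1) ` subchains U (i + 1) <+>\<^bsub>E i\<^esub> subchains (\<lambda>_. N) i))
      (D (i + 1) ` (subchains U (i + 1) \<inter> subchains (\<lambda>_. J) (i + 1)) <+>\<^bsub>E i\<^esub>
        (subchains (\<lambda>_. N) i \<inter> subchains (\<lambda>_. J) i)) k"
      "has_codim complex_ring (E (i - 1))
      (subchains (\<lambda>_. J) (i - 1) \<inter> (D i ` subchains U i <+>\<^bsub>E (i - 1)\<^esub> subchains (\<lambda>_. N) (i - 1)))
      (D i ` (subchains U i \<inter> subchains (\<lambda>_. J) i) <+>\<^bsub>E (i - 1)\<^esub>
        (subchains (\<lambda>_. N) (i - 1) \<inter> subchains (\<lambda>_. J) (i - 1))) k'"
      "a i + c i = b i + k + k'"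
    proof (rule euler_step[OF D' D_linear boundary_boundary[OF vectorspace_axioms]
          subchains_U JJ.subchains_U subchains_U subchains_N JJ.subchains_U subchains_N JJ.subchains_U])
      show "subchains (\<lambda>_. N) i \<subseteq> subchains U i" by (rule subchains_N_subset)
      show "D (i + 1) ` subchains U (i + 1) \<subseteq> subchains U i"
        using boundary_subchains[of _ "i + 1"] by auto
      show "D i ` subchains (\<lambda>_. N) i \<subseteq> subchains (\<lambda>_. N) (i - 1)"
        using NN.boundary_subchains[of _ i] by auto
      show "D (i + 1) ` subchains (\<lambda>_. J) (i + 1) \<subseteq> subchains (\<lambda>_. J) i"
        using JJ.boundary_subchains[of _ "i + 1"] by auto
      show "D i ` subchains (\<lambda>_. J) i \<subseteq> subchains (\<lambda>_. J) (i - 1)"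
        using JJ.boundary_subchains[of _ i] by auto
    qed (use a[of i] b[of i] c[of i] in \<open>simp_all only: cycles_def boundaries_def subchains_Int subchains_set_add\<close>)
    then show ?thesis
      by (auto simp: P_def)
  qed
  then obtain k k' where k: "\<And>i. P i (k i)" "\<And>i. P (i - 1) (k' i)" "\<And>i. a i + c i = b i + k i + k' i"
    by metis
  have k': "k' i = k (i - 1)" for i
    using k(1)[of "i - 1"] k(2)[of i] unfolding P_def by (rule has_codim_unique[symmetric])
  have rel: "a i + c i = b i + k i + k (i - 1)" for i
    using k(3) k' by simp
  have zero: "a i = 0 \<and> c i = 0" if "i < 0 \<or> int CARD('r) \<le> i" for i
    using vectorspace.has_codim_trivial[OF E_vectorspace a A.cycles_subset_boundaries[OF that]]
      vectorspace.has_codim_trivial[OF E_vectorspace c C.cycles_subset_boundaries[OF that]] by simp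
  have "k (-1) = 0" using rel[of "-1"] zero[of "-1"] by simp
  moreover have "k (int CARD('r) - 1) = 0"
    using rel[of "int CARD('r)"] zero[of "int CARD('r)"] by simp
  moreover have "(\<Sum>i<CARD('r). (-1) ^ i * int (a (int i))) + (\<Sum>i<CARD('r). (-1) ^ i * int (c (int i))) -
    (\<Sum>i<CARD('r). (-1) ^ i * int (b (int i))) =
    (\<Sum>i<CARD('r). (-1) ^ i * (int (k (int i)) + int (k (int i - 1))))"
  proof -
    have "int (a i) + int (c i) - int (b i) = int (k i) + int (k (i - 1))" for i
      using rel[of i] by linarith
    then show ?thesis
      by (simp flip: sum.distrib sum_subtractf distrib_left right_diff_distrib)
  qed
  ultimately show ?thesis
    using alternating_telescope[of "\<lambda>i. int (k i)" "CARD('r)"] by simp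
qed

end

text \<open>
  An injective endomorphism \<open>f\<close> of \<open>R\<close> that maps each \<open>U I\<close> onto \<open>W I\<close> gives, entry by entry, an
  isomorphism of complexes. It is applied to multiplication by a nonzero element.
\<close>
lemma has_codim_cycles_transport:
  fixes R :: "(complex, 'a, 'm) module_scheme" and U W :: "'r::{finite,linorder} set \<Rightarrow> 'a set"
  assumes U: "nested_subspaces R U" and W: "nested_subspaces R W"
    and f: "linear_map complex_ring R R f" and inj: "inj_on f (carrier R)"
    and UW: "\<And>I x. x \<in> carrier R \<Longrightarrow> f x \<in> W I \<longleftrightarrow> x \<in> U I"
    and Wf: "\<And>I. W I \<subseteq> f ` carrier R"
  shows "has_codim complex_ring (chain_space (\<lambda>_ :: 'r set. R) i) (cycles R U i) (boundaries R U i) n \<longleftrightarrow>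
    has_codim complex_ring (chain_space (\<lambda>_ :: 'r set. R) i) (cycles R W i) (boundaries R W i) n"
proof -
  interpret U: nested_subspaces R U by (rule U)
  interpret W: nested_subspaces R W by (rule W)
  interpret f: linear_map complex_ring R R f by (rule f)
  interpret E: vectorspace complex_ring "U.E i" by (rule U.E_vectorspace)
  interpret E': vectorspace complex_ring "U.E (i + 1)" by (rule U.E_vectorspace)
  have D'_lin: "linear_map complex_ring (U.E (i + 1)) (U.E i) (U.D (i + 1))"
    using U.D_linear[of "i + 1"] by simp
  interpret D: linear_map complex_ring "U.E i" "U.E (i - 1)" "U.D i" by (rule U.D_linear)
  interpret D': linear_map complex_ring "U.E (i + 1)" "U.E i" "U.D (i + 1)" by (rule D'_lin)
  define F where "F j x = (\<lambda>I\<in>{I :: 'r set. int (card I) = j}. f (x I))" for j x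
  have mem: "x I \<in> carrier R" if "x \<in> carrier (U.E j)" "int (card I) = j" for x I j
    using that by (auto simp: chain_space_simps intro: PiE_mem)
  have F_lin: "linear_map complex_ring (U.E j) (U.E j) (F j)" for j
  proof (rule linear_mapI[OF U.E_vectorspace U.E_vectorspace])
    fix x y c assume x: "x \<in> carrier (U.E j)" and y: "y \<in> carrier (U.E j)"
    show "F j x \<in> carrier (U.E j)"
      using mem[OF x] by (auto simp: F_def chain_space_simps)
    show "F j (x \<oplus>\<^bsub>U.E j\<^esub> y) = F j x \<oplus>\<^bsub>U.E j\<^esub> F j y"
      using mem[OF x] mem[OF y] by (auto simp: F_def chain_space_simps intro!: restrict_ext)
    show "F j (c \<odot>\<^bsub>U.E j\<^esub> x) = c \<odot>\<^bsub>U.E j\<^esub> F j x"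
      using mem[OF x] by (auto simp: F_def chain_space_simps intro!: restrict_ext)
  qed
  interpret F: linear_map complex_ring "U.E i" "U.E i" "F i" by (rule F_lin)
  have F_D: "U.D j (F j x) = F (j - 1) (U.D j x)" if x: "x \<in> carrier (U.E j)" for j x
  proof
    fix J show "U.D j (F j x) J = F (j - 1) (U.D j x) J"
    proof (cases "int (card J) = j - 1")
      case True
      have c: "int (card (insert a J)) = j" if "a \<in> -J" for a using that True by simp
      have "U.D j (F j x) J = (\<Oplus>\<^bsub>R\<^esub>a\<in>-J. face_sign a J \<odot>\<^bsub>R\<^esub> F j x (insert a J))"
        by (rule boundary_apply[OF True])
      also have "\<dots> = (\<Oplus>\<^bsub>R\<^esub>a\<in>-J. f (face_sign a J \<odot>\<^bsub>R\<^esub> x (insert a J)))"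
        using c mem[OF x] by (intro U.M.finsum_cong') (auto simp: F_def)
      also have "\<dots> = f (\<Oplus>\<^bsub>R\<^esub>a\<in>-J. face_sign a J \<odot>\<^bsub>R\<^esub> x (insert a J))"
        using c mem[OF x] by (intro f.T_finsum[symmetric]) auto
      also have "\<dots> = F (j - 1) (U.D j x) J"
        using True by (simp add: F_def boundary_apply[OF True])
      finally show ?thesis .
    qed (simp add: boundary_def F_def)
  qed
  have inE: "subchains U j \<subseteq> carrier (U.E j)" "subchains (\<lambda>_. U UNIV) j \<subseteq> carrier (U.E j)" for j
    by (rule vectorspace.subspace_subset[OF U.E_vectorspace U.subchains_U],
        rule vectorspace.subspace_subset[OF U.E_vectorspace U.subchains_N])
  \<comment> \<open>The index map \<open>g\<close> allows for both instances that are needed: the identity for \<open>subchains W\<close> and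
    the constant \<open>UNIV\<close> for the chains with entries in the smallest member.\<close>
  have F_iff: "F j x \<in> subchains (\<lambda>I. W (g I)) j \<longleftrightarrow> x \<in> subchains (\<lambda>I. U (g I)) j"
    if x: "x \<in> carrier (U.E j)" for x j and g :: "'r set \<Rightarrow> 'r set"
  proof -
    have "x \<in> extensional {I. int (card I) = j}"
      using x by (auto simp: chain_space_simps PiE_def)
    then show ?thesis
      using mem[OF x] UW by (auto simp: F_def subchains_def PiE_iff)
  qed
  have F_iff1: "F j x \<in> subchains W j \<longleftrightarrow> x \<in> subchains U j" if "x \<in> carrier (U.E j)" for x j
    using F_iff[OF that, of "\<lambda>I. I"] by simp
  have F_iff2: "F j x \<in> subchains (\<lambda>_. W UNIV) j \<longleftrightarrow> x \<in> subchains (\<lambda>_. U UNIV) j"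
    if "x \<in> carrier (U.E j)" for x j
    using F_iff[OF that, of "\<lambda>_. UNIV"] by simp
  have F_surj: "\<exists>x\<in>carrier (U.E j). z = F j x" if z: "z \<in> subchains (\<lambda>I. W (g I)) j"
    for z j and g :: "'r set \<Rightarrow> 'r set"
  proof -
    have "\<exists>y. y \<in> carrier R \<and> f y = z I" if "int (card I) = j" for I
      using Wf[of "g I"] subchains_mem[OF z that] by (metis imageE subsetD)
    then obtain y where y: "\<And>I. int (card I) = j \<Longrightarrow> y I \<in> carrier R \<and> f (y I) = z I" by metis
    let ?y = "restrict y {I. int (card I) = j}"
    have "?y \<in> carrier (U.E j)" using y by (auto simp: chain_space_simps)
    moreover have "z = F j ?y"
    proof
      fix I show "z I = F j ?y I"
        using y z by (cases "int (card I) = j") (auto simp: F_def subchains_def PiE_def extensional_def)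
    qed
    ultimately show ?thesis by blast
  qed
  have F_inj: "x = y" if "x \<in> carrier (U.E j)" "y \<in> carrier (U.E j)" "F j x = F j y" for x y j
  proof (rule PiE_ext)
    show "x \<in> (\<Pi>\<^sub>E I\<in>{I. int (card I) = j}. carrier R)" "y \<in> (\<Pi>\<^sub>E I\<in>{I. int (card I) = j}. carrier R)"
      using that by (auto simp: chain_space_simps)
    show "x I = y I" if "I \<in> {I. int (card I) = j}" for I
    proof (rule inj_onD[OF inj])
      show "f (x I) = f (y I)"
        using fun_cong[OF \<open>F j x = F j y\<close>, of I] that by (simp add: F_def)
      show "x I \<in> carrier R" "y I \<in> carrier R"
        using mem that \<open>x \<in> carrier _\<close> \<open>y \<in> carrier _\<close> by auto
    qed
  qed
  have sub: "subspace complex_ring (cycles R V i) (U.E i)" "subspace complex_ring (boundaries R V i) (U.E i)"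
    "boundaries R V i \<subseteq> cycles R V i" if V: "nested_subspaces R V" for V :: "'r set \<Rightarrow> 'a set"
    by (rule nested_subspaces.subspace_cycles[OF V], rule nested_subspaces.subspace_boundaries[OF V],
        rule nested_subspaces.boundaries_subset_cycles[OF V])
  have F_cyc: "F i z \<in> cycles R W i \<longleftrightarrow> z \<in> cycles R U i" if "z \<in> carrier (U.E i)" for z
    unfolding cycles_def using F_iff1[OF that] F_iff2[OF D.T_im[OF that]] F_D[OF that] by auto
  show ?thesis
  proof (rule has_codim_map[OF E.vectorspace_axioms E.vectorspace_axioms sub(1)[OF U] sub(1)[OF W]
        sub(2)[OF W] sub(3)[OF W] sub(3)[OF U]])
    show "linear_map complex_ring ((U.E i)\<lparr>carrier := cycles R U i\<rparr>) (U.E i) (F i)"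
      using F.linear_map_restrict[OF sub(1)[OF U] E.subspace_self] F.T_im
        E.subspace_subset[OF sub(1)[OF U]] by (auto simp: image_subset_iff subset_iff)
    show "F i z \<in> cycles R W i" if "z \<in> cycles R U i" for z
      using F_cyc E.subspace_carrier[OF sub(1)[OF U]] that by blast
    show "\<exists>z\<in>cycles R U i. \<exists>b\<in>boundaries R W i. z' = F i z \<oplus>\<^bsub>U.E i\<^esub> b"
      if z': "z' \<in> cycles R W i" for z'
    proof -
      obtain z where z: "z \<in> carrier (U.E i)" "z' = F i z"
        using F_surj[of z' "\<lambda>I. I" i] z' by (auto simp: cycles_def)
      then have "z \<in> cycles R U i" using F_cyc z' by simp
      moreover have "z' = F i z \<oplus>\<^bsub>U.E i\<^esub> \<zero>\<^bsub>U.E i\<^esub>"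
        using z F.T_im E.M.r_zero by simp
      ultimately show ?thesis using E.subspace_zero[OF sub(2)[OF W]] by blast
    qed
    show "F i z \<in> boundaries R W i \<longleftrightarrow> z \<in> boundaries R U i" if "z \<in> cycles R U i" for z
    proof
      have zc: "z \<in> carrier (U.E i)" by (rule E.subspace_carrier[OF sub(1)[OF U] that])
      assume "F i z \<in> boundaries R W i"
      then obtain y' n' where yn': "y' \<in> subchains W (i + 1)" "n' \<in> subchains (\<lambda>_. W UNIV) i"
        "F i z = U.D (i + 1) y' \<oplus>\<^bsub>U.E i\<^esub> n'"
        by (auto simp: boundaries_def E.mem_set_add)
      obtain y where y: "y \<in> carrier (U.E (i + 1))" "y' = F (i + 1) y"
        using F_surj[of y' "\<lambda>I. I" "i + 1"] yn'(1) by auto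
      obtain n where n: "n \<in> carrier (U.E i)" "n' = F i n"
        using F_surj[of n' "\<lambda>_. UNIV" i] yn'(2) by auto
      have "F i z = F i (U.D (i + 1) y \<oplus>\<^bsub>U.E i\<^esub> n)"
        using F.T_add[OF D'.T_im[OF y(1)] n(1)] F_D[OF y(1)] yn'(3) y(2) n(2) by simp
      then have "z = U.D (i + 1) y \<oplus>\<^bsub>U.E i\<^esub> n"
        using F_inj[OF zc E.M.a_closed[OF D'.T_im[OF y(1)] n(1)]] by simp
      moreover have "y \<in> subchains U (i + 1)" "n \<in> subchains (\<lambda>_. U UNIV) i"
        using F_iff1[OF y(1)] F_iff2[OF n(1)] yn' y(2) n(2) by auto
      ultimately show "z \<in> boundaries R U i"
        unfolding boundaries_def E.mem_set_add by blast
    next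
      assume "z \<in> boundaries R U i"
      then obtain y n where yn: "y \<in> subchains U (i + 1)" "n \<in> subchains (\<lambda>_. U UNIV) i"
        "z = U.D (i + 1) y \<oplus>\<^bsub>U.E i\<^esub> n"
        by (auto simp: boundaries_def E.mem_set_add)
      have yn_c: "y \<in> carrier (U.E (i + 1))" "n \<in> carrier (U.E i)"
        using yn inE by auto
      have "F i z = U.D (i + 1) (F (i + 1) y) \<oplus>\<^bsub>U.E i\<^esub> F i n"
        using F.T_add[OF D'.T_im[OF yn_c(1)] yn_c(2)] F_D[OF yn_c(1)] yn(3) by simp
      moreover have "F (i + 1) y \<in> subchains W (i + 1)" "F i n \<in> subchains (\<lambda>_. W UNIV) i"
        using F_iff1[OF yn_c(1)] F_iff2[OF yn_c(2)] yn by auto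
      ultimately show "F i z \<in> boundaries R W i"
        unfolding boundaries_def E.mem_set_add by blast
    qed
  qed
qed

section \<open>The local ring as a domain and as an algebra\<close>

text \<open>
  This is where irreducibility enters: \<open>X\<close> is the union of the closed subsets where \<open>f\<close> and where \<open>g\<close>
  vanish, so it equals one of them.
\<close>
lemma polynomial_vanishing:
  assumes X: "irreducible_variety X" and f: "f \<in> polynomial_funs" and g: "g \<in> polynomial_funs"
    and fg: "\<And>x. x \<in> X \<Longrightarrow> f x * g x = 0"
  shows "(\<forall>x\<in>X. f x = 0) \<or> (\<forall>x\<in>X. g x = 0)"
proof -
  have alg: "algebraic_set {x \<in> X. f x = 0}" if f: "f \<in> polynomial_funs" for f
  proof -
    obtain F where F: "F \<subseteq> polynomial_funs" "X = {x. \<forall>f\<in>F. f x = 0}"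
      using X unfolding irreducible_variety_def algebraic_set_def by blast
    have "insert f F \<subseteq> polynomial_funs" "{x \<in> X. f x = 0} = {x. \<forall>f'\<in>insert f F. f' x = 0}"
      using F f by auto
    then show ?thesis unfolding algebraic_set_def by blast
  qed
  have "X = {x \<in> X. f x = 0} \<union> {x \<in> X. g x = 0}"
    using fg by auto
  then have "X = {x \<in> X. f x = 0} \<or> X = {x \<in> X. g x = 0}"
  proof -
    have "\<forall>Y Z. algebraic_set Y \<longrightarrow> algebraic_set Z \<longrightarrow> X = Y \<union> Z \<longrightarrow> X = Y \<or> X = Z"
      using X by (simp add: irreducible_variety_def)
    then show ?thesis using alg[OF f] alg[OF g] \<open>X = _ \<union> _\<close> by blast
  qed
  then show ?thesis by blast
qed

text \<open>
  For transitivity, the middle denominator \<open>g'\<close> has to be cancelled from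
  \<open>(f g'' - f'' g) g' = 0\<close>.
\<close>
lemma equiv_fraction_rel:
  assumes X: "irreducible_variety X"
  shows "equiv (fractions X) (fraction_rel X)"
proof (rule equivI)
  show "fraction_rel X \<subseteq> fractions X \<times> fractions X"
    by (auto simp: fraction_rel_def)
  show "refl_on (fractions X) (fraction_rel X)"
    by (auto simp: refl_on_def fraction_rel_def)
  show "sym (fraction_rel X)"
    by (auto simp: sym_def fraction_rel_def)
  show "trans (fraction_rel X)"
  proof (rule transI, clarify)
    fix f g f' g' f'' g''
    assume 1: "((f, g), (f', g')) \<in> fraction_rel X" and 2: "((f', g'), (f'', g'')) \<in> fraction_rel X"
    then have pol: "f \<in> polynomial_funs" "g \<in> polynomial_funs" "g' \<in> polynomial_funs"
      "f'' \<in> polynomial_funs" "g'' \<in> polynomial_funs"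
      by (auto simp: fraction_rel_def fractions_def)
    define d where "d = (\<lambda>x. f x * g'' x + (\<lambda>x. -1) x * (f'' x * g x))"
    have d: "d \<in> polynomial_funs"
      unfolding d_def
      by (rule polynomial_funs.add[OF polynomial_funs.mult[OF pol(1,5)]
            polynomial_funs.mult[OF polynomial_funs.const polynomial_funs.mult[OF pol(4,2)]]])
    have "d x * g' x = 0" if "x \<in> X" for x
    proof -
      have "f x * g' x = f' x * g x" "f' x * g'' x = f'' x * g' x"
        using 1 2 that by (auto simp: fraction_rel_def)
      moreover have "d x * g' x = (f x * g' x) * g'' x - (f'' x * g' x) * g x"
        by (simp add: d_def algebra_simps)
      ultimately show ?thesis by (simp flip: \<open>f' x * g'' x = f'' x * g' x\<close>)
    qed
    then have "(\<forall>x\<in>X. d x = 0) \<or> (\<forall>x\<in>X. g' x = 0)"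
      by (rule polynomial_vanishing[OF X d pol(3)])
    moreover have "\<exists>x\<in>X. g' x \<noteq> 0"
      using 1 by (auto simp: fraction_rel_def fractions_def)
    ultimately have "\<forall>x\<in>X. d x = 0" by blast
    then show "((f, g), (f'', g'')) \<in> fraction_rel X"
      using 1 2 by (auto simp: fraction_rel_def d_def)
  qed
qed

lemma UN_constant_on:
  assumes "\<And>x. x \<in> A \<Longrightarrow> f x = c" "A \<noteq> {}"
  shows "(\<Union>x\<in>A. f x) = c"
  using assms by auto

locale germ_of_variety =
  fixes X :: "(complex ^ 'n) set" and p :: "complex ^ 'n"
  assumes X: "irreducible_variety X" and p: "p \<in> X"
begin

abbreviation "R \<equiv> local_ring X p"

text \<open>
  Pairs that represent elements of the local ring. Products of their denominators do not vanish at \<open>p\<close>,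
  so the class of these pairs is closed under all operations.
\<close>
definition regular :: "(complex ^ 'n \<Rightarrow> complex) \<Rightarrow> (complex ^ 'n \<Rightarrow> complex) \<Rightarrow> bool" where
  "regular f g \<longleftrightarrow> f \<in> polynomial_funs \<and> g \<in> polynomial_funs \<and> g p \<noteq> 0"

lemma rational_fun_eq_iff:
  assumes "(f, g) \<in> fractions X" "(f', g') \<in> fractions X"
  shows "rational_fun X f g = rational_fun X f' g' \<longleftrightarrow> (\<forall>x\<in>X. f x * g' x = f' x * g x)"
  using eq_equiv_class_iff[OF equiv_fraction_rel[OF X] assms] assms
  by (auto simp: rational_fun_def fraction_rel_def)

lemma rational_fun_mem:
  "(f', g') \<in> rational_fun X f g \<longleftrightarrow>
     (f, g) \<in> fractions X \<and> (f', g') \<in> fractions X \<and> (\<forall>x\<in>X. f x * g' x = f' x * g x)"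
  by (auto simp: rational_fun_def fraction_rel_def)

lemma fractions_mult_denominator:
  assumes "(f, g) \<in> fractions X" "(f', g') \<in> fractions X" "k \<in> polynomial_funs"
  shows "(k, \<lambda>x. g x * g' x) \<in> fractions X"
proof -
  have g: "g \<in> polynomial_funs" "g' \<in> polynomial_funs" "\<exists>x\<in>X. g x \<noteq> 0" "\<exists>x\<in>X. g' x \<noteq> 0"
    using assms by (auto simp: fractions_def)
  have "\<exists>x\<in>X. g x * g' x \<noteq> 0"
    using polynomial_vanishing[OF X g(1,2)] g(3,4) by blast
  then show ?thesis
    using assms(3) polynomial_funs.mult[OF g(1,2)] by (simp add: fractions_def)
qed

lemma fractions_polynomials:
  assumes "(f, g) \<in> fractions X"
  shows "f \<in> polynomial_funs" "g \<in> polynomial_funs"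
  using assms by (auto simp: fractions_def)

lemma rational_fun_self: "(f, g) \<in> fractions X \<Longrightarrow> (f, g) \<in> rational_fun X f g"
  by (simp add: rational_fun_mem)

lemma mult_rational_fun:
  assumes fg: "(f, g) \<in> fractions X" and fg': "(f', g') \<in> fractions X"
  shows "rational_fun X f g \<otimes>\<^bsub>function_field X\<^esub> rational_fun X f' g' =
    rational_fun X (\<lambda>x. f x * f' x) (\<lambda>x. g x * g' x)"
proof -
  have eq: "rational_fun X (\<lambda>x. a x * c x) (\<lambda>x. b x * d x) =
      rational_fun X (\<lambda>x. f x * f' x) (\<lambda>x. g x * g' x)"
    if "(a, b) \<in> rational_fun X f g" "(c, d) \<in> rational_fun X f' g'" for a b c d
  proof (subst rational_fun_eq_iff)
    have *: "(a, b) \<in> fractions X" "(c, d) \<in> fractions X" "\<forall>x\<in>X. f x * b x = a x * g x"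
      "\<forall>x\<in>X. f' x * d x = c x * g' x"
      using that by (auto simp: rational_fun_mem)
    show "(\<lambda>x. a x * c x, \<lambda>x. b x * d x) \<in> fractions X"
      "(\<lambda>x. f x * f' x, \<lambda>x. g x * g' x) \<in> fractions X"
      by (intro fractions_mult_denominator[OF *(1,2)] fractions_mult_denominator[OF fg fg']
          polynomial_funs.mult fractions_polynomials[OF *(1)] fractions_polynomials[OF *(2)]
          fractions_polynomials[OF fg] fractions_polynomials[OF fg'])+
    show "\<forall>x\<in>X. a x * c x * (g x * g' x) = f x * f' x * (b x * d x)"
    proof
      fix x assume "x \<in> X"
      then have eqs: "f x * b x = a x * g x" "f' x * d x = c x * g' x" using *(3,4) by auto
      have "a x * c x * (g x * g' x) = (a x * g x) * (c x * g' x)" by simp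
      also have "\<dots> = f x * f' x * (b x * d x)" unfolding eqs[symmetric] by simp
      finally show "a x * c x * (g x * g' x) = f x * f' x * (b x * d x)" .
    qed
  qed
  have "(\<Union>(a, b)\<in>rational_fun X f g. \<Union>(c, d)\<in>rational_fun X f' g'.
      rational_fun X (\<lambda>x. a x * c x) (\<lambda>x. b x * d x)) =
      rational_fun X (\<lambda>x. f x * f' x) (\<lambda>x. g x * g' x)"
  proof (rule UN_constant_on, clarify, rule UN_constant_on, clarify)
    fix a b c d assume "(a, b) \<in> rational_fun X f g" "(c, d) \<in> rational_fun X f' g'"
    then show "rational_fun X (\<lambda>x. a x * c x) (\<lambda>x. b x * d x) =
      rational_fun X (\<lambda>x. f x * f' x) (\<lambda>x. g x * g' x)" by (rule eq)
  qed (use rational_fun_self[OF fg] rational_fun_self[OF fg'] in blast)+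
  then show ?thesis by (simp add: function_field_def)
qed

lemma add_rational_fun:
  assumes fg: "(f, g) \<in> fractions X" and fg': "(f', g') \<in> fractions X"
  shows "rational_fun X f g \<oplus>\<^bsub>function_field X\<^esub> rational_fun X f' g' =
    rational_fun X (\<lambda>x. f x * g' x + f' x * g x) (\<lambda>x. g x * g' x)"
proof -
  have eq: "rational_fun X (\<lambda>x. a x * d x + c x * b x) (\<lambda>x. b x * d x) =
      rational_fun X (\<lambda>x. f x * g' x + f' x * g x) (\<lambda>x. g x * g' x)"
    if "(a, b) \<in> rational_fun X f g" "(c, d) \<in> rational_fun X f' g'" for a b c d
  proof (subst rational_fun_eq_iff)
    have *: "(a, b) \<in> fractions X" "(c, d) \<in> fractions X" "\<forall>x\<in>X. f x * b x = a x * g x"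
      "\<forall>x\<in>X. f' x * d x = c x * g' x"
      using that by (auto simp: rational_fun_mem)
    show "(\<lambda>x. a x * d x + c x * b x, \<lambda>x. b x * d x) \<in> fractions X"
      "(\<lambda>x. f x * g' x + f' x * g x, \<lambda>x. g x * g' x) \<in> fractions X"
      by (intro fractions_mult_denominator[OF *(1,2)] fractions_mult_denominator[OF fg fg']
          polynomial_funs.mult polynomial_funs.add fractions_polynomials[OF *(1)]
          fractions_polynomials[OF *(2)] fractions_polynomials[OF fg] fractions_polynomials[OF fg'])+
    show "\<forall>x\<in>X. (a x * d x + c x * b x) * (g x * g' x) = (f x * g' x + f' x * g x) * (b x * d x)"
    proof
      fix x assume "x \<in> X"
      then have eqs: "f x * b x = a x * g x" "f' x * d x = c x * g' x" using *(3,4) by auto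
      have "(a x * d x + c x * b x) * (g x * g' x) = (a x * g x) * (d x * g' x) + (c x * g' x) * (b x * g x)"
        by (simp add: algebra_simps)
      also have "\<dots> = (f x * g' x + f' x * g x) * (b x * d x)"
        unfolding eqs[symmetric] by (simp add: algebra_simps)
      finally show "(a x * d x + c x * b x) * (g x * g' x) = (f x * g' x + f' x * g x) * (b x * d x)" .
    qed
  qed
  have "(\<Union>(a, b)\<in>rational_fun X f g. \<Union>(c, d)\<in>rational_fun X f' g'.
      rational_fun X (\<lambda>x. a x * d x + c x * b x) (\<lambda>x. b x * d x)) =
      rational_fun X (\<lambda>x. f x * g' x + f' x * g x) (\<lambda>x. g x * g' x)"
  proof (rule UN_constant_on, clarify, rule UN_constant_on, clarify)
    fix a b c d assume "(a, b) \<in> rational_fun X f g" "(c, d) \<in> rational_fun X f' g'"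
    then show "rational_fun X (\<lambda>x. a x * d x + c x * b x) (\<lambda>x. b x * d x) =
      rational_fun X (\<lambda>x. f x * g' x + f' x * g x) (\<lambda>x. g x * g' x)" by (rule eq)
  qed (use rational_fun_self[OF fg] rational_fun_self[OF fg'] in blast)+
  then show ?thesis by (simp add: function_field_def)
qed

lemma smult_rational_fun:
  assumes fg: "(f, g) \<in> fractions X"
  shows "c \<odot>\<^bsub>function_field X\<^esub> rational_fun X f g = rational_fun X (\<lambda>x. c * f x) g"
proof -
  have eq: "rational_fun X (\<lambda>x. c * a x) b = rational_fun X (\<lambda>x. c * f x) g"
    if "(a, b) \<in> rational_fun X f g" for a b
  proof (subst rational_fun_eq_iff)
    have *: "(a, b) \<in> fractions X" "\<forall>x\<in>X. f x * b x = a x * g x"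
      using that by (auto simp: rational_fun_mem)
    show "(\<lambda>x. c * a x, b) \<in> fractions X" "(\<lambda>x. c * f x, g) \<in> fractions X"
      using * fg polynomial_funs.mult[OF polynomial_funs.const] by (auto simp: fractions_def)
    show "\<forall>x\<in>X. c * a x * g x = c * f x * b x"
      using *(2) by (simp add: mult.assoc)
  qed
  have "(\<Union>(a, b)\<in>rational_fun X f g. rational_fun X (\<lambda>x. c * a x) b) = rational_fun X (\<lambda>x. c * f x) g"
  proof (rule UN_constant_on, clarify)
    fix a b assume "(a, b) \<in> rational_fun X f g"
    then show "rational_fun X (\<lambda>x. c * a x) b = rational_fun X (\<lambda>x. c * f x) g" by (rule eq)
  qed (use rational_fun_self[OF fg] in blast)
  then show ?thesis by (simp add: function_field_def)
qed

lemma regular_fractions: "regular f g \<Longrightarrow> (f, g) \<in> fractions X"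
  using p by (auto simp: regular_def fractions_def)

lemma regular_eq_iff:
  "regular f g \<Longrightarrow> regular f' g' \<Longrightarrow>
     rational_fun X f g = rational_fun X f' g' \<longleftrightarrow> (\<forall>x\<in>X. f x * g' x = f' x * g x)"
  by (intro rational_fun_eq_iff regular_fractions)

lemma
  assumes "regular f g" "regular f' g'"
  shows regular_mult: "regular (\<lambda>x. f x * f' x) (\<lambda>x. g x * g' x)"
    and regular_add: "regular (\<lambda>x. f x * g' x + f' x * g x) (\<lambda>x. g x * g' x)"
  using assms by (auto simp: regular_def intro: polynomial_funs.intros)

lemma regular_smult: "regular f g \<Longrightarrow> regular (\<lambda>x. c * f x) g"
  by (auto simp: regular_def intro: polynomial_funs.intros)

lemma regular_const: "regular (\<lambda>_. c) (\<lambda>_. 1)"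
  by (auto simp: regular_def intro: polynomial_funs.intros)

lemma carrier_local_ring: "carrier R = {rational_fun X f g | f g. regular f g}"
  by (simp add: local_ring_def regular_def)

lemma local_ring_rational_fun:
  assumes "regular f g" "regular f' g'"
  shows "rational_fun X f g \<otimes>\<^bsub>R\<^esub> rational_fun X f' g' = rational_fun X (\<lambda>x. f x * f' x) (\<lambda>x. g x * g' x)"
    and "rational_fun X f g \<oplus>\<^bsub>R\<^esub> rational_fun X f' g' =
      rational_fun X (\<lambda>x. f x * g' x + f' x * g x) (\<lambda>x. g x * g' x)"
  using mult_rational_fun add_rational_fun regular_fractions assms by (simp_all add: local_ring_def)

lemma local_ring_smult_rational_fun:
  "regular f g \<Longrightarrow> c \<odot>\<^bsub>R\<^esub> rational_fun X f g = rational_fun X (\<lambda>x. c * f x) g"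
  using smult_rational_fun regular_fractions by (simp add: local_ring_def)

lemma local_ring_constants:
  "\<zero>\<^bsub>R\<^esub> = rational_fun X (\<lambda>_. 0) (\<lambda>_. 1)" "\<one>\<^bsub>R\<^esub> = rational_fun X (\<lambda>_. 1) (\<lambda>_. 1)"
  by (simp_all add: local_ring_def function_field_def)

lemma local_ring_cases:
  assumes "x \<in> carrier R"
  obtains f g where "regular f g" "x = rational_fun X f g"
  using assms by (auto simp: carrier_local_ring)

lemmas local_ring_simps = local_ring_rational_fun local_ring_smult_rational_fun local_ring_constants
  regular_mult regular_add regular_smult regular_const regular_eq_iff

lemma rational_fun_closed: "regular f g \<Longrightarrow> rational_fun X f g \<in> carrier R"
  by (auto simp: carrier_local_ring)

lemma cring_local_ring: "cring R"
proof (rule cringI)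
  show "abelian_group R"
  proof (rule abelian_groupI)
    show "x \<oplus>\<^bsub>R\<^esub> y \<in> carrier R" if "x \<in> carrier R" "y \<in> carrier R" for x y
      using that by (elim local_ring_cases) (simp add: local_ring_simps rational_fun_closed)
    show "\<zero>\<^bsub>R\<^esub> \<in> carrier R"
      by (simp add: local_ring_simps rational_fun_closed)
    show "x \<oplus>\<^bsub>R\<^esub> y \<oplus>\<^bsub>R\<^esub> z = x \<oplus>\<^bsub>R\<^esub> (y \<oplus>\<^bsub>R\<^esub> z)"
      if "x \<in> carrier R" "y \<in> carrier R" "z \<in> carrier R" for x y z
      using that by (elim local_ring_cases) (simp add: local_ring_simps, (simp add: algebra_simps)?)
    show "x \<oplus>\<^bsub>R\<^esub> y = y \<oplus>\<^bsub>R\<^esub> x" if "x \<in> carrier R" "y \<in> carrier R" for x y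
      using that by (elim local_ring_cases) (simp add: local_ring_simps, (simp add: algebra_simps)?)
    show "\<zero>\<^bsub>R\<^esub> \<oplus>\<^bsub>R\<^esub> x = x" if "x \<in> carrier R" for x
      using that by (elim local_ring_cases) (simp add: local_ring_simps)
    show "\<exists>y\<in>carrier R. y \<oplus>\<^bsub>R\<^esub> x = \<zero>\<^bsub>R\<^esub>" if "x \<in> carrier R" for x
      using that
    proof (elim local_ring_cases)
      fix f g assume fg: "regular f g" "x = rational_fun X f g"
      have r: "regular (\<lambda>x. -1 * f x) g" by (rule regular_smult[OF fg(1)])
      have "rational_fun X (\<lambda>x. -1 * f x) g \<oplus>\<^bsub>R\<^esub> x = \<zero>\<^bsub>R\<^esub>"
        unfolding fg(2) local_ring_rational_fun(2)[OF r fg(1)] local_ring_constants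
          regular_eq_iff[OF regular_add[OF r fg(1)] regular_const] by simp
      then show ?thesis
        using rational_fun_closed[OF r] by blast
    qed
  qed
  show "comm_monoid R"
  proof (rule comm_monoidI)
    show "x \<otimes>\<^bsub>R\<^esub> y \<in> carrier R" if "x \<in> carrier R" "y \<in> carrier R" for x y
      using that by (elim local_ring_cases) (simp add: local_ring_simps rational_fun_closed)
    show "\<one>\<^bsub>R\<^esub> \<in> carrier R"
      by (simp add: local_ring_simps rational_fun_closed)
    show "x \<otimes>\<^bsub>R\<^esub> y \<otimes>\<^bsub>R\<^esub> z = x \<otimes>\<^bsub>R\<^esub> (y \<otimes>\<^bsub>R\<^esub> z)"
      if "x \<in> carrier R" "y \<in> carrier R" "z \<in> carrier R" for x y z
      using that by (elim local_ring_cases) (simp add: local_ring_simps, (simp add: algebra_simps)?)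
    show "x \<otimes>\<^bsub>R\<^esub> y = y \<otimes>\<^bsub>R\<^esub> x" if "x \<in> carrier R" "y \<in> carrier R" for x y
      using that by (elim local_ring_cases) (simp add: local_ring_simps, (simp add: algebra_simps)?)
    show "\<one>\<^bsub>R\<^esub> \<otimes>\<^bsub>R\<^esub> x = x" if "x \<in> carrier R" for x
      using that by (elim local_ring_cases) (simp add: local_ring_simps)
  qed
  show "(x \<oplus>\<^bsub>R\<^esub> y) \<otimes>\<^bsub>R\<^esub> z = x \<otimes>\<^bsub>R\<^esub> z \<oplus>\<^bsub>R\<^esub> y \<otimes>\<^bsub>R\<^esub> z"
    if "x \<in> carrier R" "y \<in> carrier R" "z \<in> carrier R" for x y z
    using that by (elim local_ring_cases) (simp add: local_ring_simps, (simp add: algebra_simps)?)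
qed

lemma domain_local_ring: "domain R"
proof (rule domain.intro[OF cring_local_ring], unfold_locales)
  show "\<one>\<^bsub>R\<^esub> \<noteq> \<zero>\<^bsub>R\<^esub>"
    using p by (auto simp: local_ring_simps)
  show "x = \<zero>\<^bsub>R\<^esub> \<or> y = \<zero>\<^bsub>R\<^esub>"
    if "x \<otimes>\<^bsub>R\<^esub> y = \<zero>\<^bsub>R\<^esub>" "x \<in> carrier R" "y \<in> carrier R" for x y
    using that(2,3,1)
  proof (elim local_ring_cases)
    fix f g f' g'
    assume *: "regular f g" "regular f' g'" "x = rational_fun X f g" "y = rational_fun X f' g'"
    assume "x \<otimes>\<^bsub>R\<^esub> y = \<zero>\<^bsub>R\<^esub>"
    then have "\<And>x. x \<in> X \<Longrightarrow> f x * f' x = 0" using * by (simp add: local_ring_simps)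
    then have "(\<forall>x\<in>X. f x = 0) \<or> (\<forall>x\<in>X. f' x = 0)"
      using * polynomial_vanishing[OF X] by (simp add: regular_def)
    then show ?thesis using * by (simp add: local_ring_simps)
  qed
qed

lemma algebra_local_ring: "algebra complex_ring R"
proof (rule algebraI)
  show "cring complex_ring"
    using field_complex_ring by (simp add: field_def domain_def)
  show "cring R" by (rule cring_local_ring)
  show "c \<odot>\<^bsub>R\<^esub> x \<in> carrier R" if "x \<in> carrier R" for c x
    using that by (elim local_ring_cases) (simp add: local_ring_simps rational_fun_closed)
  show "(a \<oplus>\<^bsub>complex_ring\<^esub> b) \<odot>\<^bsub>R\<^esub> x = a \<odot>\<^bsub>R\<^esub> x \<oplus>\<^bsub>R\<^esub> b \<odot>\<^bsub>R\<^esub> x" if "x \<in> carrier R" for a b x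
    using that by (elim local_ring_cases) (simp add: local_ring_simps, (simp add: algebra_simps)?)
  show "a \<odot>\<^bsub>R\<^esub> (x \<oplus>\<^bsub>R\<^esub> y) = a \<odot>\<^bsub>R\<^esub> x \<oplus>\<^bsub>R\<^esub> a \<odot>\<^bsub>R\<^esub> y" if "x \<in> carrier R" "y \<in> carrier R" for a x y
    using that by (elim local_ring_cases) (simp add: local_ring_simps, (simp add: algebra_simps)?)
  show "(a \<otimes>\<^bsub>complex_ring\<^esub> b) \<odot>\<^bsub>R\<^esub> x = a \<odot>\<^bsub>R\<^esub> (b \<odot>\<^bsub>R\<^esub> x)" if "x \<in> carrier R" for a b x
    using that by (elim local_ring_cases) (simp add: local_ring_simps, (simp add: algebra_simps)?)
  show "\<one>\<^bsub>complex_ring\<^esub> \<odot>\<^bsub>R\<^esub> x = x" if "x \<in> carrier R" for x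
    using that by (elim local_ring_cases) (simp add: local_ring_simps)
  show "(a \<odot>\<^bsub>R\<^esub> x) \<otimes>\<^bsub>R\<^esub> y = a \<odot>\<^bsub>R\<^esub> (x \<otimes>\<^bsub>R\<^esub> y)" if "x \<in> carrier R" "y \<in> carrier R" for a x y
    using that by (elim local_ring_cases) (simp add: local_ring_simps, (simp add: algebra_simps)?)
qed

end

section \<open>Valuation ideals and the Poincare series\<close>

text \<open>
  The sum is extended from the support of \<open>1 - t\<^sup>q\<close> to \<open>{0, q}\<close>. For \<open>q = 0\<close> the support is empty and
  both sides are zero.
\<close>
lemma laurent_mult_one_minus_monomial:
  "((1 - laurent_monomial q) \<star> A) v = A v - A (v - q)"
proof -
  let ?p = "1 - laurent_monomial q"
  have "(?p \<star> A) v = (\<Sum>w\<in>{0, q}. Poly_Mapping.lookup ?p w * A (v - w))"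
    unfolding laurent_mult_def
    by (rule sum.mono_neutral_left)
      (auto simp: in_keys_iff lookup_minus lookup_one lookup_single when_def split: if_splits)
  also have "\<dots> = A v - A (v - q)"
    by (cases "q = 0") (auto simp: lookup_minus lookup_one lookup_single when_def)
  finally show ?thesis .
qed

lemma indicator_vec_nth: "indicator_vec I $ j = (if j \<in> I then 1 else 0)"
  by (simp add: indicator_vec_def)

lemma indicator_vec_UNIV: "indicator_vec UNIV = 1"
  by (simp add: vec_eq_iff indicator_vec_nth)

text \<open>
  With \<open>1\<close> rewritten as \<open>e\<^bsub>UNIV\<^esub>\<close>, the space by which \<open>graded_piece\<close> divides becomes the member of the
  family \<open>I \<mapsto> F (v + e\<^sub>I)\<close> with index \<open>UNIV\<close>.
\<close>
lemma graded_piece_eq: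
  "graded_piece R F v =
     (\<lambda>I. quotient_space (R\<lparr>carrier := F (v + indicator_vec I)\<rparr>) (F (v + indicator_vec UNIV)))"
  by (simp add: graded_piece_def indicator_vec_UNIV fun_eq_iff)

lemma has_codim_homology_dim:
  assumes "nested_subspaces R (\<lambda>I. F (v + indicator_vec I))" "poincare_well_defined R F"
  shows "has_codim complex_ring (chain_space (\<lambda>_. R) i) (cycles R (\<lambda>I. F (v + indicator_vec I)) i)
    (boundaries R (\<lambda>I. F (v + indicator_vec I)) i) (homology_dim R F v i)"
proof -
  interpret nested_subspaces R "\<lambda>I. F (v + indicator_vec I)" by fact
  have "has_dim complex_ring (homology_space (graded_piece R F v) i) (homology_dim R F v i)"
    using assms(2) vectorspace_homology
    by (simp add: has_dim_def poincare_well_defined_def finite_homology_def homology_dim_def graded_piece_eq)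
  then show ?thesis
    unfolding graded_piece_eq homology_has_dim_iff .
qed

locale valued_germ = germ_of_variety X p
  for X :: "(complex ^ 'n) set" and p +
  fixes \<nu> :: "'r::{finite,linorder} \<Rightarrow> 'n fraction set \<Rightarrow> int"
  assumes val: "\<And>j. discrete_valuation (function_field X) (\<nu> j)"
    and val_ring: "\<And>j. carrier (local_ring X p) \<subseteq> valuation_ring (function_field X) (\<nu> j)"
begin

sublocale R: domain R by (rule domain_local_ring)
sublocale A: algebra complex_ring R by (rule algebra_local_ring)
sublocale V: vectorspace complex_ring R
  by (intro vectorspace.intro A.module_axioms field_complex_ring)

abbreviation "M \<equiv> valuation_ideal R \<nu>"

lemma carrier_subset_function_field: "x \<in> carrier R \<Longrightarrow> x \<in> carrier (function_field X)"
  using val_ring by (auto simp: valuation_ring_def)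

lemma local_ring_ops: "\<zero>\<^bsub>R\<^esub> = \<zero>\<^bsub>function_field X\<^esub>" "(\<otimes>\<^bsub>R\<^esub>) = (\<otimes>\<^bsub>function_field X\<^esub>)"
  "(\<oplus>\<^bsub>R\<^esub>) = (\<oplus>\<^bsub>function_field X\<^esub>)"
  by (simp_all add: local_ring_def)

lemma
  assumes x: "x \<in> carrier R" "x \<noteq> \<zero>\<^bsub>R\<^esub>"
  shows val_nonneg: "0 \<le> \<nu> j x"
    and val_mult: "y \<in> carrier R \<Longrightarrow> y \<noteq> \<zero>\<^bsub>R\<^esub> \<Longrightarrow> \<nu> j (x \<otimes>\<^bsub>R\<^esub> y) = \<nu> j x + \<nu> j y"
    and val_add: "y \<in> carrier R \<Longrightarrow> y \<noteq> \<zero>\<^bsub>R\<^esub> \<Longrightarrow> x \<oplus>\<^bsub>R\<^esub> y \<noteq> \<zero>\<^bsub>R\<^esub> \<Longrightarrow>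
      min (\<nu> j x) (\<nu> j y) \<le> \<nu> j (x \<oplus>\<^bsub>R\<^esub> y)"
proof -
  note c = carrier_subset_function_field
  show "0 \<le> \<nu> j x"
    using x val_ring[of j] by (auto simp: valuation_ring_def local_ring_ops)
  show "\<nu> j (x \<otimes>\<^bsub>R\<^esub> y) = \<nu> j x + \<nu> j y" if "y \<in> carrier R" "y \<noteq> \<zero>\<^bsub>R\<^esub>"
    using val[of j] c[OF x(1)] c[OF that(1)] x(2) that(2)
    unfolding discrete_valuation_def local_ring_ops by blast
  show "min (\<nu> j x) (\<nu> j y) \<le> \<nu> j (x \<oplus>\<^bsub>R\<^esub> y)"
    if "y \<in> carrier R" "y \<noteq> \<zero>\<^bsub>R\<^esub>" "x \<oplus>\<^bsub>R\<^esub> y \<noteq> \<zero>\<^bsub>R\<^esub>"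
    using val[of j] c[OF x(1)] c[OF that(1)] x(2) that(2,3)
    unfolding discrete_valuation_def local_ring_ops by blast
qed

text \<open>
  Closure under scalars holds because constants lie in \<open>R\<close> and therefore have nonnegative value:
  \<open>c x = (c 1) x\<close>.
\<close>
lemma subspace_valuation_ideal: "subspace complex_ring (M v) R"
proof (rule V.subspaceI)
  show "M v \<subseteq> carrier R" "\<zero>\<^bsub>R\<^esub> \<in> M v" by (auto simp: valuation_ideal_def)
  show "x \<oplus>\<^bsub>R\<^esub> y \<in> M v" if xy: "x \<in> M v" "y \<in> M v" for x y
  proof -
    have c: "x \<in> carrier R" "y \<in> carrier R" using xy by (auto simp: valuation_ideal_def)
    consider "x = \<zero>\<^bsub>R\<^esub>" | "y = \<zero>\<^bsub>R\<^esub>" | "x \<oplus>\<^bsub>R\<^esub> y = \<zero>\<^bsub>R\<^esub>"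
      | "x \<noteq> \<zero>\<^bsub>R\<^esub>" "y \<noteq> \<zero>\<^bsub>R\<^esub>" "x \<oplus>\<^bsub>R\<^esub> y \<noteq> \<zero>\<^bsub>R\<^esub>" by blast
    then show ?thesis
    proof cases
      case 4
      have "v $ j \<le> \<nu> j (x \<oplus>\<^bsub>R\<^esub> y)" for j
      proof -
        have "v $ j \<le> \<nu> j x" "v $ j \<le> \<nu> j y" using xy 4 by (auto simp: valuation_ideal_def)
        then show ?thesis using val_add[OF c(1) 4(1) c(2) 4(2,3), of j] by linarith
      qed
      then show ?thesis using c by (simp add: valuation_ideal_def)
    qed (use xy c in \<open>auto simp: valuation_ideal_def\<close>)
  qed
  show "c \<odot>\<^bsub>R\<^esub> x \<in> M v" if x: "x \<in> M v" for c x
  proof (cases "c \<odot>\<^bsub>R\<^esub> x = \<zero>\<^bsub>R\<^esub>")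
    case False
    let ?c = "c \<odot>\<^bsub>R\<^esub> \<one>\<^bsub>R\<^esub>"
    have c: "x \<in> carrier R" "?c \<in> carrier R" using x by (auto simp: valuation_ideal_def)
    have eq: "c \<odot>\<^bsub>R\<^esub> x = ?c \<otimes>\<^bsub>R\<^esub> x"
      using A.smult_assoc2[of c "\<one>\<^bsub>R\<^esub>" x] c by simp
    have nz: "x \<noteq> \<zero>\<^bsub>R\<^esub>" "?c \<noteq> \<zero>\<^bsub>R\<^esub>"
      using False R.r_null[OF c(2)] R.l_null[OF c(1)] unfolding eq by metis+
    have "v $ j \<le> \<nu> j (c \<odot>\<^bsub>R\<^esub> x)" for j
    proof -
      have "v $ j \<le> \<nu> j x" using x nz by (auto simp: valuation_ideal_def)
      then show ?thesis
        unfolding eq val_mult[OF c(2) nz(2) c(1) nz(1)] using val_nonneg[OF c(2) nz(2), of j] by linarith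
    qed
    moreover have "c \<odot>\<^bsub>R\<^esub> x \<in> carrier R" using c(1) by (simp add: A.smult_closed)
    ultimately show ?thesis by (simp add: valuation_ideal_def)
  qed (simp add: valuation_ideal_def)
qed

lemma nested_valuation_ideal: "nested_subspaces R (\<lambda>I. M (v + indicator_vec I))"
proof (intro nested_subspaces.intro nested_subspaces_axioms.intro V.vectorspace_axioms subspace_valuation_ideal)
  fix I J :: "'r set" assume "J \<subseteq> I"
  then have "(v + indicator_vec J) $ j \<le> (v + indicator_vec I) $ j" for j
    by (auto simp: indicator_vec_nth)
  then show "M (v + indicator_vec I) \<subseteq> M (v + indicator_vec J)"
    unfolding valuation_ideal_def using order_trans by blast
qed

context
  fixes h assumes h: "h \<in> carrier R" "h \<noteq> \<zero>\<^bsub>R\<^esub>"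
begin

abbreviation "J \<equiv> PIdl\<^bsub>R\<^esub> h"

lemma subspace_principal_ideal: "subspace complex_ring J R"
proof (rule V.subspaceI)
  have J: "x \<in> J \<longleftrightarrow> (\<exists>y\<in>carrier R. x = y \<otimes>\<^bsub>R\<^esub> h)" for x by (auto simp: cgenideal_def)
  show "J \<subseteq> carrier R" using h by (auto simp: J)
  have "\<zero>\<^bsub>R\<^esub> = \<zero>\<^bsub>R\<^esub> \<otimes>\<^bsub>R\<^esub> h" using h by simp
  then show "\<zero>\<^bsub>R\<^esub> \<in> J" unfolding J by blast
  show "x \<oplus>\<^bsub>R\<^esub> y \<in> J" if xy: "x \<in> J" "y \<in> J" for x y
  proof -
    obtain a b where ab: "a \<in> carrier R" "b \<in> carrier R" "x = a \<otimes>\<^bsub>R\<^esub> h" "y = b \<otimes>\<^bsub>R\<^esub> h"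
      using xy by (auto simp: J)
    then have "x \<oplus>\<^bsub>R\<^esub> y = (a \<oplus>\<^bsub>R\<^esub> b) \<otimes>\<^bsub>R\<^esub> h" using h by (simp add: R.l_distr)
    then show ?thesis unfolding J using ab by blast
  qed
  show "c \<odot>\<^bsub>R\<^esub> x \<in> J" if x: "x \<in> J" for c x
  proof -
    obtain a where a: "a \<in> carrier R" "x = a \<otimes>\<^bsub>R\<^esub> h" using x by (auto simp: J)
    then have "c \<odot>\<^bsub>R\<^esub> x = (c \<odot>\<^bsub>R\<^esub> a) \<otimes>\<^bsub>R\<^esub> h" using A.smult_assoc2[of c a h] h by simp
    moreover have "c \<odot>\<^bsub>R\<^esub> a \<in> carrier R" using a by simp
    ultimately show ?thesis unfolding J by blast
  qed
qed

lemma mult_mem_valuation_ideal_iff: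
  assumes x: "x \<in> carrier R"
  shows "x \<otimes>\<^bsub>R\<^esub> h \<in> M (v + w) \<longleftrightarrow> x \<in> M (v - (\<chi> j. \<nu> j h) + w)"
proof (cases "x = \<zero>\<^bsub>R\<^esub>")
  case False
  have "x \<otimes>\<^bsub>R\<^esub> h \<noteq> \<zero>\<^bsub>R\<^esub>" using R.integral_iff x h False by simp
  moreover have "(v + w) $ j \<le> \<nu> j (x \<otimes>\<^bsub>R\<^esub> h) \<longleftrightarrow> (v - (\<chi> j. \<nu> j h) + w) $ j \<le> \<nu> j x" for j
    using val_mult[OF x False h, of j] by auto
  ultimately show ?thesis using x h False by (simp add: valuation_ideal_def)
qed (use h in \<open>simp add: valuation_ideal_def\<close>)

text \<open>
  By \<open>mult_mem_valuation_ideal_iff\<close>, multiplication by \<open>h\<close> carries the complex of \<open>M\<close> at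
  \<open>v - \<nu>(h)\<close> to that of the family \<open>M (v + e\<^sub>I) \<inter> J\<close>.
\<close>
theorem poincare_series_principal_ideal:
  assumes wf: "poincare_well_defined R M" "poincare_well_defined R (valuation_ideal_plus R \<nu> J)"
  shows "poincare_series R (valuation_ideal_plus R \<nu> J) v =
    poincare_series R M v - poincare_series R M (v - (\<chi> j. \<nu> j h))"
proof -
  let ?q = "\<chi> j. \<nu> j h"
  let ?U = "\<lambda>v I. M (v + indicator_vec I)"
  interpret U: nested_subspaces R "?U v" by (rule nested_valuation_ideal)
  interpret UJ: nested_subspaces R "\<lambda>I. ?U v I \<inter> J"
    using U.antimono by (intro nested_subspaces.intro nested_subspaces_axioms.intro
      V.vectorspace_axioms V.subspace_Int subspace_valuation_ideal subspace_principal_ideal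
      Int_mono order_refl)
  interpret UpJ: nested_subspaces R "\<lambda>I. ?U v I <+>\<^bsub>R\<^esub> J"
    using U.antimono by (intro nested_subspaces.intro nested_subspaces_axioms.intro
      V.vectorspace_axioms V.subspace_set_add subspace_valuation_ideal subspace_principal_ideal
      V.set_add_mono order_refl)
  have f: "linear_map complex_ring R R (\<lambda>x. x \<otimes>\<^bsub>R\<^esub> h)"
    using h by (intro linear_mapI V.vectorspace_axioms) (simp_all add: R.l_distr A.smult_assoc2)
  have inj: "inj_on (\<lambda>x. x \<otimes>\<^bsub>R\<^esub> h) (carrier R)"
    using h by (intro inj_onI) (simp add: R.m_rcancel)
  have a: "has_codim complex_ring (U.E i) (cycles R (\<lambda>I. ?U v I \<inter> J) i)
      (boundaries R (\<lambda>I. ?U v I \<inter> J) i) (homology_dim R M (v - ?q) i)" for i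
  proof -
    have "x \<otimes>\<^bsub>R\<^esub> h \<in> ?U v I \<inter> J \<longleftrightarrow> x \<in> ?U (v - ?q) I" if "x \<in> carrier R" for x I
    proof -
      have "x \<otimes>\<^bsub>R\<^esub> h \<in> J" using that unfolding cgenideal_def by blast
      then show ?thesis using mult_mem_valuation_ideal_iff[OF that] by blast
    qed
    moreover have "?U v I \<inter> J \<subseteq> (\<lambda>x. x \<otimes>\<^bsub>R\<^esub> h) ` carrier R" for I
      unfolding cgenideal_def by blast
    ultimately show ?thesis
      by (rule iffD1[OF has_codim_cycles_transport[OF nested_valuation_ideal UJ.nested_subspaces_axioms f inj]
            has_codim_homology_dim[OF nested_valuation_ideal wf(1)]])
  qed
  have b: "has_codim complex_ring (U.E i) (cycles R (?U v) i) (boundaries R (?U v) i)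
      (homology_dim R M v i)" for i
    by (rule has_codim_homology_dim[OF nested_valuation_ideal wf(1)])
  have c: "has_codim complex_ring (U.E i) (cycles R (\<lambda>I. ?U v I <+>\<^bsub>R\<^esub> J) i)
      (boundaries R (\<lambda>I. ?U v I <+>\<^bsub>R\<^esub> J) i) (homology_dim R (valuation_ideal_plus R \<nu> J) v i)" for i
    using has_codim_homology_dim[of R "valuation_ideal_plus R \<nu> J" v i] wf(2) UpJ.nested_subspaces_axioms
    by (simp add: valuation_ideal_plus_def)
  show ?thesis
    using U.euler_characteristic_additive[OF subspace_principal_ideal a b c]
    by (simp add: poincare_series_def)
qed

end

end

theorem theorem6:
  fixes X :: "(complex ^ 'n) set" and p :: "complex ^ 'n"
    and h :: "'n fraction set"
    and \<nu> :: "'r::{finite,linorder} \<Rightarrow> 'n fraction set \<Rightarrow> int"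
  assumes "irreducible_variety X" and "p \<in> X"
    and "h \<in> carrier (local_ring X p)" and "h \<noteq> \<zero>\<^bsub>local_ring X p\<^esub>"
    and "\<And>j. discrete_valuation (function_field X) (\<nu> j)"
    and "\<And>j. carrier (local_ring X p) \<subseteq> valuation_ring (function_field X) (\<nu> j)"
    and "poincare_well_defined (local_ring X p) (valuation_ideal (local_ring X p) \<nu>)"
    and "poincare_well_defined (local_ring X p)
           (valuation_ideal_plus (local_ring X p) \<nu> (PIdl\<^bsub>local_ring X p\<^esub> h))"
  shows "poincare_series (local_ring X p)
           (valuation_ideal_plus (local_ring X p) \<nu> (PIdl\<^bsub>local_ring X p\<^esub> h)) =
         (1 - laurent_monomial (\<chi> j. \<nu> j h)) \<star>
           poincare_series (local_ring X p) (valuation_ideal (local_ring X p) \<nu>)"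
proof -
  interpret valued_germ X p \<nu>
    using assms by unfold_locales
  show ?thesis
    by (rule ext) (simp only: laurent_mult_one_minus_monomial
        poincare_series_principal_ideal[OF assms(3,4,7,8)])
qed

end
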